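(* Let $(\vartheta_0,D)$ be one of the pairs $(0.924,6)$, $(0.739,8)$, $(0.643,12)$, $(0.584,16)$, $(0.544,20)$, $(0.516,26)$, and suppose some $\vartheta>\vartheta_0$ satisfies both conditions (A) and (B) below. Then there exist absolute constants $C$, $c>0$, an odd integer $b\le C$ and an even integer $d$ with $0<|d|\le D$ such that $P^-(p+d)>p^c$ and $\Omega(p+d)=b$ for infinitely many primes $p$.
   Context: $P^-(n)$ is the smallest prime factor of $n$; $\Omega(n)$ is the number of prime factors of $n$ counted with multiplicity and $\lambda(n)=(-1)^{\Omega(n)}$. Condition (A): for every $\varepsilon>0$, $A>0$, $\sum_{q\le N^{\vartheta-\varepsilon}}\max_{a:(a,q)=1}\bigl|\sum_{p\le N,\,p\equiv a\ (\mathrm{mod}\ q)}\log p-\frac{N}{\varphi(q)}\bigr|\ll_{\varepsilon,A}\frac{N}{(\log N)^A}$ ($p$ over primes). Condition (B): for every $\varepsilon>0$, $A>0$, $\sum_{q\le N^{\vartheta-\varepsilon}}\max_{y\le N}\max_a\bigl|\sum_{n\le y,\,n\equiv a\ (\mathrm{mod}\ q)}\lambda(n)\bigr|\ll_{\varepsilon,A}\frac{N}{(\log N)^A}$. *)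

theory Defs
  imports "HOL-Analysis.Analysis" "HOL-Number_Theory.Number_Theory"
begin

definition bigOmega :: "nat \<Rightarrow> nat" where
  "bigOmega n = size (prime_factorization n)"

definition liouville :: "nat \<Rightarrow> real" where
  "liouville n = (-1) ^ bigOmega n"

text \<open>Smallest prime factor P^-(n) (meaningful for n > 1).\<close>
definition least_prime_factor :: "nat \<Rightarrow> nat" where
  "least_prime_factor n = Min (prime_factors n)"

definition moduli :: "nat \<Rightarrow> real \<Rightarrow> nat set" where
  "moduli N e = {q. 1 \<le> q \<and> real q \<le> real N powr e}"

definition condA :: "real \<Rightarrow> bool" where
  "condA \<theta> \<longleftrightarrow> (\<forall>\<epsilon>>0. \<forall>A>0. \<exists>K. \<forall>N::nat. N \<ge> 2 \<longrightarrow>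
     (\<Sum>q\<in>moduli N (\<theta> - \<epsilon>).
        Max ((\<lambda>a. \<bar>(\<Sum>p | prime p \<and> p \<le> N \<and> [p = a] (mod q). ln (real p))
                    - real N / real (totient q)\<bar>) ` {a. a < q \<and> coprime a q}))
     \<le> K * real N / (ln (real N)) powr A)"

definition condB :: "real \<Rightarrow> bool" where
  "condB \<theta> \<longleftrightarrow> (\<forall>\<epsilon>>0. \<forall>A>0. \<exists>K. \<forall>N::nat. N \<ge> 2 \<longrightarrow>
     (\<Sum>q\<in>moduli N (\<theta> - \<epsilon>).
        Max ((\<lambda>(y, a). \<bar>\<Sum>n | 1 \<le> n \<and> n \<le> y \<and> [n = a] (mod q). liouville n\<bar>)
               ` ({..N} \<times> {..<q})))
     \<le> K * real N / (ln (real N)) powr A)"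

end

theory Submission
  imports Defs "HOL-Real_Asymp.Real_Asymp"
begin

text \<open>
  Fix an admissible tuple H of k even shifts and weight each n by a Selberg square
  \<open>w n = (\<Sum>d. \<lambda> d)\<^sup>2\<close> over the divisors d of \<open>\<Prod>h\<in>H. n + h\<close>, with d at most
  \<open>R = N powr (\<tau> / 2)\<close>. If no n whose shifts are all free of small primes has one shift prime and another with
  an odd number of prime factors, then for such n
  \<open>(k - 1) * #{h. n + h prime} \<le> k / 2 + (\<Sum>h. liouville (n + h)) / 2\<close>.
  Average this against w. Condition (B) removes the Liouville terms and condition (A) evaluates the prime terms.
  An n with a prime factor \<open>q \<le> N powr c\<close> of some shift contributes little, because the diagonalised form restricted
  to multiples of q only involves the differences \<open>y r - y (q * r)\<close>. What remains is an inequality between two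
  Beta integrals, which the choice \<open>y r = 1 + b * ln (R / r) / ln R\<close> violates for the listed exponents.

  Squarefree moduli are represented by the finite sets of their prime factors, so that divisibility, lcm and
  coprimality become inclusion, union and disjointness. All moments of the sieve weights are compared with the
  zeroth one by a recurrence, hence no singular series has to be evaluated.
\<close>

section \<open>Squarefree moduli as sets of primes\<close>

definition modulus :: "nat set \<Rightarrow> nat" where
  "modulus A = (\<Prod>p\<in>A. p)"

lemma modulus_empty [simp]: "modulus {} = 1"
  by (simp add: modulus_def)

lemma modulus_singleton [simp]: "modulus {p} = p"
  by (simp add: modulus_def)

lemma modulus_insert [simp]: "finite A \<Longrightarrow> p \<notin> A \<Longrightarrow> modulus (insert p A) = p * modulus A"
  by (simp add: modulus_def)

lemma modulus_Un_disjoint: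
  "finite A \<Longrightarrow> finite B \<Longrightarrow> A \<inter> B = {} \<Longrightarrow> modulus (A \<union> B) = modulus A * modulus B"
  by (simp add: modulus_def prod.union_disjoint)

lemma modulus_Un_Int:
  "finite A \<Longrightarrow> finite B \<Longrightarrow> modulus (A \<union> B) * modulus (A \<inter> B) = modulus A * modulus B"
  by (simp add: modulus_def prod.union_inter)

lemma modulus_subset_Diff: "finite C \<Longrightarrow> A \<subseteq> C \<Longrightarrow> modulus C = modulus A * modulus (C - A)"
  by (simp add: modulus_def prod.subset_diff[of A C] mult.commute)

lemma dvd_modulus: "finite A \<Longrightarrow> p \<in> A \<Longrightarrow> p dvd modulus A"
  unfolding modulus_def by (rule dvd_prodI)

lemma modulus_dvd_modulus: "finite B \<Longrightarrow> A \<subseteq> B \<Longrightarrow> modulus A dvd modulus B"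
  by (simp add: modulus_def prod_dvd_prod_subset)

lemma prod_divide_const_modulus: "(\<Prod>p\<in>C. c / real p) = c ^ card C / real (modulus C)"
  by (simp add: modulus_def prod_dividef)

lemma modulus_pos: "(\<And>p. p \<in> A \<Longrightarrow> prime p) \<Longrightarrow> 0 < modulus A"
  unfolding modulus_def by (intro prod_pos) (auto simp: prime_gt_0_nat)

lemma modulus_mono:
  assumes "finite B" "A \<subseteq> B" "\<And>p. p \<in> B \<Longrightarrow> prime p"
  shows "modulus A \<le> modulus B"
  using modulus_dvd_modulus[OF assms(1,2)] modulus_pos[OF assms(3)] by (auto dest: dvd_imp_le)

lemma coprime_modulus_iff: "finite A \<Longrightarrow> coprime n (modulus A) \<longleftrightarrow> (\<forall>p\<in>A. coprime n p)"
  by (induction A rule: finite_induct) auto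

lemma prime_factors_modulus:
  assumes "finite A" "\<And>p. p \<in> A \<Longrightarrow> prime p"
  shows "prime_factors (modulus A) = A"
proof -
  have "prime_factors (modulus A) = (\<Union>p\<in>A. prime_factors p)"
    using assms unfolding modulus_def by (subst prime_factors_prod) (auto dest: prime_gt_0_nat)
  also have "\<dots> = A" using assms by (auto simp: prime_prime_factors)
  finally show ?thesis .
qed

lemma inj_on_modulus: "inj_on modulus {A. finite A \<and> (\<forall>p\<in>A. prime p)}"
  by (rule inj_on_inverseI[where g = prime_factors]) (auto intro!: prime_factors_modulus)

lemma totient_modulus:
  assumes "finite C" "\<And>p. p \<in> C \<Longrightarrow> prime p"
  shows "real (totient (modulus C)) = (\<Prod>p\<in>C. real p - 1)"
  using assms
proof (induction C rule: finite_induct)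
  case (insert q C)
  have "coprime q (modulus C)"
    using insert by (auto simp: coprime_modulus_iff intro!: primes_coprime)
  then have "totient (q * modulus C) = (q - 1) * totient (modulus C)"
    using insert.prems by (simp add: totient_mult_coprime totient_prime)
  then show ?case using insert prime_gt_0_nat[of q] by (simp add: of_nat_diff Suc_le_eq)
qed simp

definition primorial :: "nat \<Rightarrow> nat" where
  "primorial D = modulus {p. prime p \<and> p \<le> D}"

lemma primorial_pos: "0 < primorial D"
  unfolding primorial_def by (rule modulus_pos) auto

lemma prime_dvd_primorial_iff:
  assumes "prime p"
  shows "p dvd primorial D \<longleftrightarrow> p \<le> D"
proof -
  have "p dvd primorial D \<longleftrightarrow> p \<in> prime_factors (primorial D)"
    using assms primorial_pos[of D] by (simp add: prime_factors_dvd)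
  also have "prime_factors (primorial D) = {p. prime p \<and> p \<le> D}"
    unfolding primorial_def by (rule prime_factors_modulus) auto
  finally show ?thesis using assms by simp
qed

lemma totient_primorial_pos: "0 < totient (primorial D)"
  using primorial_pos by simp

definition rough_moduli :: "nat \<Rightarrow> real \<Rightarrow> nat set set" where
  "rough_moduli D x = {A. finite A \<and> (\<forall>p\<in>A. prime p \<and> D < p) \<and> real (modulus A) \<le> x}"

lemma rough_moduliD:
  assumes "A \<in> rough_moduli D x"
  shows "finite A" "\<And>p. p \<in> A \<Longrightarrow> prime p" "\<And>p. p \<in> A \<Longrightarrow> D < p" "real (modulus A) \<le> x"
  using assms by (auto simp: rough_moduli_def)

lemma rough_modulus_pos: "A \<in> rough_moduli D x \<Longrightarrow> 0 < modulus A"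
  by (rule modulus_pos) (auto dest: rough_moduliD)

lemma rough_modulus_ge_1: "A \<in> rough_moduli D x \<Longrightarrow> 1 \<le> real (modulus A)"
  using rough_modulus_pos[of A D x] by linarith

lemma rough_moduli_quotient_ge_1: "C \<in> rough_moduli D x \<Longrightarrow> 1 \<le> x / modulus C"
  using rough_modulus_ge_1[of C D x] rough_moduliD(4)[of C D x] by (simp add: field_simps)

lemma empty_in_rough_moduli [simp]: "{} \<in> rough_moduli D x \<longleftrightarrow> 1 \<le> x"
  by (simp add: rough_moduli_def)

lemma rough_moduli_subset:
  assumes "B \<in> rough_moduli D x" "A \<subseteq> B"
  shows "A \<in> rough_moduli D x"
proof -
  have "real (modulus A) \<le> real (modulus B)"
    using modulus_mono[of B A] assms(2) rough_moduliD[OF assms(1)] by simp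
  also have "\<dots> \<le> x" by (rule rough_moduliD(4)[OF assms(1)])
  finally show ?thesis using assms finite_subset[OF assms(2)] unfolding rough_moduli_def by blast
qed

lemma rough_moduli_element_le:
  assumes "C \<in> rough_moduli D x" "p \<in> C"
  shows "real p \<le> x"
  using rough_moduliD(4)[OF rough_moduli_subset[OF assms(1), of "{p}"]] assms(2) by simp

lemma finite_nat_le_real [simp]: "finite {n. P n \<and> real n \<le> x}"
  by (rule finite_subset[of _ "{..nat \<lfloor>x\<rfloor>}"]) (auto simp: le_nat_floor)

lemma finite_rough_moduli [simp]: "finite (rough_moduli D x)"
proof (rule finite_subset)
  show "rough_moduli D x \<subseteq> Pow {p. True \<and> real p \<le> x}"
    using rough_moduli_element_le by auto
qed (simp only: finite_Pow_iff finite_nat_le_real)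

lemma Un_in_rough_moduli:
  assumes "A \<in> rough_moduli D x" "B \<in> rough_moduli D y"
  shows "A \<union> B \<in> rough_moduli D (x * y)"
proof -
  note A = rough_moduliD[OF assms(1)] and B = rough_moduliD[OF assms(2)]
  have "modulus (A \<union> B) \<le> modulus A * modulus B"
    using modulus_Un_Int[OF A(1) B(1)] modulus_pos[of "A \<inter> B"] A(2)
    by (metis Int_iff One_nat_def Suc_leI mult.right_neutral mult_le_mono2)
  then have "real (modulus (A \<union> B)) \<le> real (modulus A) * real (modulus B)"
    by (simp flip: of_nat_mult)
  also have "\<dots> \<le> x * y"
    using A(4) B(4) rough_modulus_ge_1[OF assms(1)] by (intro mult_mono) auto
  finally show ?thesis using A B by (auto simp: rough_moduli_def)
qed

lemma disjoint_Un_in_rough_moduli_iff: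
  assumes "A \<in> rough_moduli D x" "A \<inter> B = {}"
  shows "A \<union> B \<in> rough_moduli D x \<longleftrightarrow> B \<in> rough_moduli D (x / modulus A)"
proof (cases "finite B")
  case True
  then have "modulus (A \<union> B) = modulus A * modulus B"
    using rough_moduliD(1)[OF assms(1)] assms(2) by (intro modulus_Un_disjoint)
  then show ?thesis
    using True rough_moduliD[OF assms(1)] rough_modulus_pos[OF assms(1)]
    by (auto simp: rough_moduli_def field_simps)
qed (auto dest: rough_moduliD)

lemma insert_in_rough_moduli_iff:
  assumes "C \<in> rough_moduli D x" "prime q" "D < q" "q \<notin> C"
  shows "insert q C \<in> rough_moduli D x \<longleftrightarrow> real q * real (modulus C) \<le> x"
  using assms rough_moduliD[OF assms(1)] by (auto simp: rough_moduli_def)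

lemma coprime_primorial_rough_modulus:
  assumes "C \<in> rough_moduli D x"
  shows "coprime (primorial D) (modulus C)"
proof -
  have "coprime (primorial D) p" if "p \<in> C" for p
  proof -
    have "\<not> p dvd primorial D"
      using rough_moduliD(2,3)[OF assms that] by (simp add: prime_dvd_primorial_iff)
    then have "coprime p (primorial D)"
      by (rule prime_imp_coprime[OF rough_moduliD(2)[OF assms that]])
    then show ?thesis by (simp only: coprime_commute)
  qed
  then show ?thesis by (simp add: coprime_modulus_iff rough_moduliD(1)[OF assms])
qed

lemma totient_primorial_mult_modulus:
  assumes "C \<in> rough_moduli D x"
  shows "real (totient (primorial D * modulus C)) = real (totient (primorial D)) * (\<Prod>p\<in>C. real p - 1)"
  using totient_modulus[of C] rough_moduliD[OF assms]
  by (simp add: totient_mult_coprime coprime_primorial_rough_modulus[OF assms])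

lemma prod_pred_ge_modulus:
  assumes "C \<in> rough_moduli D x"
  shows "real (modulus C) \<le> 2 ^ card C * (\<Prod>p\<in>C. real p - 1)"
proof -
  have "(\<Prod>p\<in>C. real p) \<le> (\<Prod>p\<in>C. 2 * (real p - 1))"
  proof (intro prod_mono conjI)
    fix p assume "p \<in> C"
    then show "real p \<le> 2 * (real p - 1)"
      using rough_moduliD(2)[OF assms] prime_ge_2_nat[of p] by auto
  qed auto
  also have "\<dots> = 2 ^ card C * (\<Prod>p\<in>C. real p - 1)"
    by (simp only: prod.distrib prod_constant)
  finally show ?thesis by (simp add: modulus_def)
qed

lemma inverse_totient_primorial_mult_modulus_le:
  assumes "C \<in> rough_moduli D x"
  shows "1 / real (totient (primorial D * modulus C)) \<le> 2 ^ card C / real (modulus C)"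
proof -
  have pos: "0 < (\<Prod>p\<in>C. real p - 1)" "1 \<le> real (totient (primorial D))"
    using prime_gt_1_nat[OF rough_moduliD(2)[OF assms]] totient_primorial_pos[of D]
    by (auto intro!: prod_pos simp: Suc_le_eq)
  have "real (modulus C) \<le> 2 ^ card C * (1 * (\<Prod>p\<in>C. real p - 1))"
    using prod_pred_ge_modulus[OF assms] by simp
  also have "\<dots> \<le> 2 ^ card C * real (totient (primorial D * modulus C))"
    unfolding totient_primorial_mult_modulus[OF assms] using pos
    by (intro mult_left_mono mult_right_mono) auto
  finally have "real (modulus C) \<le> 2 ^ card C * real (totient (primorial D * modulus C))" .
  moreover have "0 < real (totient (primorial D * modulus C))"
    using primorial_pos rough_modulus_pos[OF assms] by simp
  ultimately show ?thesis using rough_modulus_pos[OF assms] by (simp add: field_simps)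
qed

section \<open>Sums over families of sets\<close>

lemma sum_Pow_prod:
  fixes f :: "'a \<Rightarrow> 'b::comm_ring_1"
  assumes "finite C"
  shows "(\<Sum>A\<in>Pow C. \<Prod>p\<in>A. f p) = (\<Prod>p\<in>C. 1 + f p)"
  using prod_add[OF assms, of f "\<lambda>_. 1"] by (simp add: add.commute)

lemma sum_swap_inner_outer:
  "(\<Sum>n\<in>X. \<Sum>A\<in>Y. \<Sum>B\<in>Z. f n A B) = (\<Sum>A\<in>Y. \<Sum>B\<in>Z. \<Sum>n\<in>X. f n A B)"
  by (subst sum.swap, rule sum.cong[OF refl], rule sum.swap)

lemma prod_Un_eq_sum_Pow_Int:
  fixes g :: "'a \<Rightarrow> real"
  assumes "finite A" "finite B" "\<And>p. p \<in> A \<Longrightarrow> g p \<noteq> 0"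
  shows "(\<Prod>p\<in>A \<union> B. g p) = (\<Sum>C\<in>Pow (A \<inter> B). \<Prod>p\<in>C. 1 / g p - 1) * ((\<Prod>p\<in>A. g p) * (\<Prod>p\<in>B. g p))"
proof -
  have "(\<Sum>C\<in>Pow (A \<inter> B). \<Prod>p\<in>C. 1 / g p - 1) = 1 / (\<Prod>p\<in>A \<inter> B. g p)"
    using sum_Pow_prod[of "A \<inter> B" "\<lambda>p. 1 / g p - 1"] assms(1) by (simp add: prod_dividef)
  moreover have "(\<Prod>p\<in>A. g p) * (\<Prod>p\<in>B. g p) = (\<Prod>p\<in>A \<union> B. g p) * (\<Prod>p\<in>A \<inter> B. g p)"
    using prod.union_inter[OF assms(1,2), of g] by simp
  moreover have "(\<Prod>p\<in>A \<inter> B. g p) \<noteq> 0" using assms by auto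
  ultimately show ?thesis by simp
qed

context
  fixes \<D> :: "'a set set"
  assumes fin: "finite \<D>" and down: "\<And>A B. B \<in> \<D> \<Longrightarrow> A \<subseteq> B \<Longrightarrow> A \<in> \<D>"
begin

lemma finite_member: "A \<in> \<D> \<Longrightarrow> finite A"
  using fin down finite_subset[of "Pow A" \<D>] by auto

lemma quadratic_form_diagonal:
  fixes g :: "'a \<Rightarrow> real" and l :: "'a set \<Rightarrow> real"
  assumes g: "\<And>A p. A \<in> \<D> \<Longrightarrow> p \<in> A \<Longrightarrow> g p \<noteq> 0"
  shows "(\<Sum>A\<in>\<D>. \<Sum>B\<in>\<D>. l A * l B * (\<Prod>p\<in>A \<union> B. g p))
    = (\<Sum>C\<in>\<D>. (\<Prod>p\<in>C. 1 / g p - 1) * (\<Sum>A | A \<in> \<D> \<and> C \<subseteq> A. l A * (\<Prod>p\<in>A. g p))\<^sup>2)"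
proof -
  let ?m = "\<lambda>A. l A * (\<Prod>p\<in>A. g p)" and ?f = "\<lambda>C. \<Prod>p\<in>C. 1 / g p - 1"
  let ?t = "\<lambda>A B C. if C \<subseteq> A \<and> C \<subseteq> B then ?f C * ?m A * ?m B else 0"
  have "(\<Sum>C\<in>\<D>. ?f C * (\<Sum>A | A \<in> \<D> \<and> C \<subseteq> A. ?m A)\<^sup>2) = (\<Sum>C\<in>\<D>. \<Sum>A\<in>\<D>. \<Sum>B\<in>\<D>. ?t A B C)"
  proof (intro sum.cong refl)
    fix C assume "C \<in> \<D>"
    have "(\<Sum>A | A \<in> \<D> \<and> C \<subseteq> A. ?m A) = (\<Sum>A\<in>\<D>. if C \<subseteq> A then ?m A else 0)"
      using fin by (simp add: sum.inter_filter)
    then show "?f C * (\<Sum>A | A \<in> \<D> \<and> C \<subseteq> A. ?m A)\<^sup>2 = (\<Sum>A\<in>\<D>. \<Sum>B\<in>\<D>. ?t A B C)"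
      by (auto simp: power2_eq_square sum_product sum_distrib_left mult_ac intro!: sum.cong)
  qed
  also have "\<dots> = (\<Sum>A\<in>\<D>. \<Sum>B\<in>\<D>. \<Sum>C\<in>\<D>. ?t A B C)"
    by (rule sum_swap_inner_outer)
  also have "\<dots> = (\<Sum>A\<in>\<D>. \<Sum>B\<in>\<D>. l A * l B * (\<Prod>p\<in>A \<union> B. g p))"
  proof (intro sum.cong refl)
    fix A B assume A: "A \<in> \<D>" and B: "B \<in> \<D>"
    have "(\<Sum>C\<in>\<D>. ?t A B C) = (\<Sum>C | C \<in> \<D> \<and> C \<subseteq> A \<and> C \<subseteq> B. ?f C * ?m A * ?m B)"
      using fin by (simp add: sum.inter_filter)
    also have "{C. C \<in> \<D> \<and> C \<subseteq> A \<and> C \<subseteq> B} = Pow (A \<inter> B)" using down A by auto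
    also have "(\<Sum>C\<in>Pow (A \<inter> B). ?f C * ?m A * ?m B) = sum ?f (Pow (A \<inter> B)) * ?m A * ?m B"
      by (simp only: sum_distrib_right)
    also have "\<dots> = l A * l B * (\<Prod>p\<in>A \<union> B. g p)"
      using prod_Un_eq_sum_Pow_Int[of A B g, OF finite_member[OF A] finite_member[OF B] g[OF A]]
      by (simp only: mult_ac)
    finally show "(\<Sum>C\<in>\<D>. ?t A B C) = l A * l B * (\<Prod>p\<in>A \<union> B. g p)" .
  qed
  finally show ?thesis ..
qed

lemma sum_interval_prod:
  fixes f :: "'a \<Rightarrow> 'b::comm_ring_1"
  assumes B: "B \<in> \<D>" "C \<subseteq> B"
  shows "(\<Sum>A | A \<in> \<D> \<and> C \<subseteq> A \<and> A \<subseteq> B. \<Prod>p\<in>A. f p) = (\<Prod>p\<in>C. f p) * (\<Prod>p\<in>B - C. 1 + f p)"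
proof -
  have "(\<Sum>A | A \<in> \<D> \<and> C \<subseteq> A \<and> A \<subseteq> B. \<Prod>p\<in>A. f p) = (\<Sum>E\<in>Pow (B - C). (\<Prod>p\<in>C. f p) * (\<Prod>p\<in>E. f p))"
  proof (rule sum.reindex_bij_witness[where i = "\<lambda>E. C \<union> E" and j = "\<lambda>A. A - C"])
    fix A assume A: "A \<in> {A. A \<in> \<D> \<and> C \<subseteq> A \<and> A \<subseteq> B}"
    then have "(\<Prod>p\<in>A. f p) = (\<Prod>p\<in>A - C. f p) * (\<Prod>p\<in>C. f p)"
      by (intro prod.subset_diff) (auto intro: finite_member)
    then show "(\<Prod>p\<in>C. f p) * (\<Prod>p\<in>A - C. f p) = (\<Prod>p\<in>A. f p)" by (simp add: mult.commute)
  next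
    fix E assume "E \<in> Pow (B - C)"
    then show "C \<union> E \<in> {A. A \<in> \<D> \<and> C \<subseteq> A \<and> A \<subseteq> B}" using B down[of B "C \<union> E"] by auto
  qed (use B in auto)
  also have "\<dots> = (\<Prod>p\<in>C. f p) * (\<Prod>p\<in>B - C. 1 + f p)"
    using sum_Pow_prod[of "B - C" f] finite_member[OF B(1)] by (simp add: sum_distrib_left[symmetric])
  finally show ?thesis .
qed

lemma superset_inversion:
  fixes \<psi> :: "'a \<Rightarrow> real" and z :: "'a set \<Rightarrow> real"
  shows "(\<Sum>A | A \<in> \<D> \<and> C \<subseteq> A. (\<Prod>p\<in>A. - \<psi> p) * (\<Sum>B | B \<in> \<D> \<and> A \<subseteq> B. z B))
    = (\<Prod>p\<in>C. - \<psi> p) * (\<Sum>B | B \<in> \<D> \<and> C \<subseteq> B. z B * (\<Prod>p\<in>B - C. 1 - \<psi> p))"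
proof -
  let ?P = "\<lambda>A. \<Prod>p\<in>A. - \<psi> p"
  have "(\<Sum>A | A \<in> \<D> \<and> C \<subseteq> A. ?P A * (\<Sum>B | B \<in> \<D> \<and> A \<subseteq> B. z B))
      = (\<Sum>A | A \<in> \<D> \<and> C \<subseteq> A. \<Sum>B | B \<in> \<D> \<and> A \<subseteq> B. ?P A * z B)"
    by (simp add: sum_distrib_left)
  also have "\<dots> = (\<Sum>B | B \<in> \<D> \<and> C \<subseteq> B. \<Sum>A | A \<in> \<D> \<and> C \<subseteq> A \<and> A \<subseteq> B. ?P A * z B)"
    using fin by (subst sum.Sigma, simp, simp, subst sum.Sigma, simp, simp,
        intro sum.reindex_bij_witness[where i = "\<lambda>(x, y). (y, x)" and j = "\<lambda>(x, y). (y, x)"]) auto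
  also have "\<dots> = (\<Sum>B | B \<in> \<D> \<and> C \<subseteq> B. ?P C * (z B * (\<Prod>p\<in>B - C. 1 - \<psi> p)))"
    by (intro sum.cong refl) (simp add: sum_interval_prod sum_distrib_right[symmetric])
  finally show ?thesis by (simp add: sum_distrib_left)
qed

end

lemmas rough_quadratic_form_diagonal = quadratic_form_diagonal[OF finite_rough_moduli rough_moduli_subset]
lemmas rough_superset_inversion = superset_inversion[OF finite_rough_moduli rough_moduli_subset]

lemma sum_rough_moduli_convolution_le:
  fixes \<phi> \<psi> F :: "nat \<Rightarrow> real"
  assumes \<phi>: "\<And>p. prime p \<Longrightarrow> D < p \<Longrightarrow> 0 \<le> \<phi> p" and \<psi>: "\<And>p. prime p \<Longrightarrow> D < p \<Longrightarrow> 0 \<le> \<psi> p"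
    and F: "\<And>n. 0 \<le> F n"
  shows "(\<Sum>C\<in>rough_moduli D x. (\<Prod>p\<in>C. \<phi> p + \<psi> p) * F (modulus C))
     \<le> (\<Sum>A\<in>rough_moduli D x. (\<Prod>p\<in>A. \<phi> p) *
         (\<Sum>B\<in>rough_moduli D (x / modulus A). (\<Prod>p\<in>B. \<psi> p) * F (modulus A * modulus B)))"
proof -
  let ?t = "\<lambda>(A, B). (\<Prod>p\<in>A. \<phi> p) * ((\<Prod>p\<in>B. \<psi> p) * F (modulus A * modulus B))"
  let ?j = "\<lambda>(C, A). (A, C - A)"
  let ?S = "Sigma (rough_moduli D x) Pow" and ?T = "Sigma (rough_moduli D x) (\<lambda>A. rough_moduli D (x / modulus A))"
  have nonneg: "0 \<le> (\<Prod>p\<in>A. \<phi> p)" "0 \<le> (\<Prod>p\<in>A. \<psi> p)" if "A \<in> rough_moduli D y" for A y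
    using that \<phi> \<psi> by (auto intro!: prod_nonneg dest: rough_moduliD)
  have image: "?j ` ?S \<subseteq> ?T"
  proof (clarify)
    fix C A assume C: "C \<in> rough_moduli D x" and A: "A \<subseteq> C"
    have "A \<in> rough_moduli D x" using C A by (rule rough_moduli_subset)
    moreover have "A \<union> (C - A) \<in> rough_moduli D x" using C A by (simp add: Un_absorb1)
    ultimately show "A \<in> rough_moduli D x \<and> C - A \<in> rough_moduli D (x / modulus A)"
      using disjoint_Un_in_rough_moduli_iff[of A D x "C - A"] by blast
  qed
  have inj: "inj_on ?j ?S" by (auto simp: inj_on_def)
  have "(\<Sum>C\<in>rough_moduli D x. (\<Prod>p\<in>C. \<phi> p + \<psi> p) * F (modulus C))
      = (\<Sum>C\<in>rough_moduli D x. \<Sum>A\<in>Pow C. ?t (?j (C, A)))"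
  proof (intro sum.cong refl)
    fix C assume "C \<in> rough_moduli D x"
    then have C: "finite C" by (rule rough_moduliD)
    show "(\<Prod>p\<in>C. \<phi> p + \<psi> p) * F (modulus C) = (\<Sum>A\<in>Pow C. ?t (?j (C, A)))"
      unfolding prod_add[OF C] sum_distrib_right
      by (intro sum.cong refl) (use modulus_subset_Diff[OF C] in \<open>simp add: mult.assoc\<close>)
  qed
  also have "\<dots> = (\<Sum>y\<in>?S. ?t (?j y))"
    by (subst sum.Sigma) (auto dest: rough_moduliD simp: case_prod_unfold)
  also have "\<dots> = sum ?t (?j ` ?S)" by (simp only: sum.reindex[OF inj] o_def)
  also have "\<dots> \<le> sum ?t ?T"
    using nonneg F by (intro sum_mono2[OF _ image]) (auto intro!: mult_nonneg_nonneg)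
  also have "\<dots> = (\<Sum>A\<in>rough_moduli D x. (\<Prod>p\<in>A. \<phi> p) *
         (\<Sum>B\<in>rough_moduli D (x / modulus A). (\<Prod>p\<in>B. \<psi> p) * F (modulus A * modulus B)))"
    by (subst sum.Sigma[symmetric]) (auto simp: sum_distrib_left)
  finally show ?thesis .
qed

lemma sum_rough_moduli_Un_le:
  fixes f :: "nat set \<Rightarrow> real"
  assumes "\<And>C. C \<in> rough_moduli D (x * y) \<Longrightarrow> 0 \<le> f C"
  shows "(\<Sum>A\<in>rough_moduli D x. \<Sum>B\<in>rough_moduli D y. f (A \<union> B))
    \<le> (\<Sum>C\<in>rough_moduli D (x * y). 4 ^ card C * f C)"
proof -
  let ?P = "rough_moduli D x \<times> rough_moduli D y"
  have "(\<Sum>A\<in>rough_moduli D x. \<Sum>B\<in>rough_moduli D y. f (A \<union> B)) = (\<Sum>z\<in>?P. f (fst z \<union> snd z))"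
    by (simp add: sum.cartesian_product case_prod_unfold)
  also have "\<dots> = (\<Sum>C\<in>rough_moduli D (x * y). \<Sum>z | z \<in> ?P \<and> fst z \<union> snd z = C. f (fst z \<union> snd z))"
    by (rule sum.group[symmetric]) (auto intro: Un_in_rough_moduli)
  also have "\<dots> \<le> (\<Sum>C\<in>rough_moduli D (x * y). 4 ^ card C * f C)"
  proof (rule sum_mono)
    fix C assume C: "C \<in> rough_moduli D (x * y)"
    let ?Z = "{z. z \<in> ?P \<and> fst z \<union> snd z = C}"
    have "card ?Z \<le> card (Pow C \<times> Pow C)"
      using rough_moduliD(1)[OF C] by (intro card_mono) auto
    also have "\<dots> = 4 ^ card C"
      using rough_moduliD(1)[OF C]
      by (simp add: card_cartesian_product card_Pow power_mult_distrib[symmetric])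
    finally have "real (card ?Z) \<le> real (4 ^ card C)" by (simp only: of_nat_le_iff)
    then have "real (card ?Z) * f C \<le> 4 ^ card C * f C"
      using assms[OF C] by (intro mult_right_mono) auto
    then show "(\<Sum>z\<in>?Z. f (fst z \<union> snd z)) \<le> 4 ^ card C * f C" by simp
  qed
  finally show ?thesis .
qed

lemma sum_prod_add_le:
  fixes F :: "nat \<Rightarrow> real"
  assumes "\<And>p. prime p \<Longrightarrow> D < p \<Longrightarrow> 0 \<le> b p" and "\<And>n. 0 \<le> F n"
    and "\<And>A. A \<in> rough_moduli D x \<Longrightarrow>
      (\<Sum>B\<in>rough_moduli D (x / modulus A). (\<Prod>p\<in>B. c p) * F (modulus A * modulus B)) \<le> U (x / modulus A)"
    and "\<And>p. prime p \<Longrightarrow> D < p \<Longrightarrow> 0 \<le> c p"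
  shows "(\<Sum>C\<in>rough_moduli D x. (\<Prod>p\<in>C. b p + c p) * F (modulus C))
    \<le> (\<Sum>A\<in>rough_moduli D x. (\<Prod>p\<in>A. b p) * U (x / modulus A))"
proof -
  have "(\<Sum>C\<in>rough_moduli D x. (\<Prod>p\<in>C. b p + c p) * F (modulus C))
    \<le> (\<Sum>A\<in>rough_moduli D x. (\<Prod>p\<in>A. b p) *
         (\<Sum>B\<in>rough_moduli D (x / modulus A). (\<Prod>p\<in>B. c p) * F (modulus A * modulus B)))"
    using assms by (intro sum_rough_moduli_convolution_le)
  also have "\<dots> \<le> (\<Sum>A\<in>rough_moduli D x. (\<Prod>p\<in>A. b p) * U (x / modulus A))"
  proof (intro sum_mono mult_left_mono prod_nonneg)
    fix A p assume "A \<in> rough_moduli D x" "p \<in> A"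
    then show "0 \<le> b p" using rough_moduliD assms(1) by blast
  qed (rule assms)
  finally show ?thesis .
qed

lemma sum_modulus_le_sum_nat:
  fixes F :: "nat \<Rightarrow> real"
  assumes "\<C> \<subseteq> rough_moduli D x" "finite X" "modulus ` \<C> \<subseteq> X" "\<And>n. n \<in> X \<Longrightarrow> 0 \<le> F n"
  shows "(\<Sum>C\<in>\<C>. F (modulus C)) \<le> (\<Sum>n\<in>X. F n)"
proof -
  have "inj_on modulus \<C>"
    by (rule inj_on_subset[OF inj_on_modulus]) (use assms in \<open>auto simp: rough_moduli_def\<close>)
  then have "(\<Sum>C\<in>\<C>. F (modulus C)) = (\<Sum>n\<in>modulus ` \<C>. F n)"
    by (simp add: sum.reindex)
  also have "\<dots> \<le> (\<Sum>n\<in>X. F n)"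
    using assms by (intro sum_mono2) auto
  finally show ?thesis .
qed

section \<open>Comparison of sums with antiderivatives\<close>

lemma antimono_increment_bounds:
  fixes G g :: "real \<Rightarrow> real"
  assumes deriv: "\<And>t. a \<le> t \<Longrightarrow> t \<le> b \<Longrightarrow> (G has_real_derivative g t) (at t)"
    and antimono: "\<And>s t. a \<le> s \<Longrightarrow> s \<le> t \<Longrightarrow> t \<le> b \<Longrightarrow> g t \<le> g s"
    and "a \<le> b"
  shows "(b - a) * g b \<le> G b - G a" "G b - G a \<le> (b - a) * g a"
proof -
  have "(b - a) * g b \<le> G b - G a \<and> G b - G a \<le> (b - a) * g a"
  proof (cases "a = b")
    case False
    then have "a < b" using \<open>a \<le> b\<close> by simp
    then obtain z where z: "a < z" "z < b" "G b - G a = (b - a) * g z"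
      using MVT2[of a b G g] deriv by blast
    then show ?thesis using antimono[of a z] antimono[of z b] by (auto intro!: mult_left_mono)
  qed simp
  then show "(b - a) * g b \<le> G b - G a" "G b - G a \<le> (b - a) * g a" by auto
qed

lemma antimono_sum_bounds:
  fixes G g :: "real \<Rightarrow> real" and a :: nat
  assumes deriv: "\<And>t. real a \<le> t \<Longrightarrow> t \<le> y \<Longrightarrow> (G has_real_derivative g t) (at t)"
    and antimono: "\<And>s t. real a \<le> s \<Longrightarrow> s \<le> t \<Longrightarrow> t \<le> y \<Longrightarrow> g t \<le> g s"
    and nonneg: "0 \<le> g y" and y: "real a \<le> y"
  shows "G y - G a \<le> (\<Sum>n | a \<le> n \<and> real n \<le> y. g (real n))"
    and "(\<Sum>n | a \<le> n \<and> real n \<le> y. g (real n)) \<le> g a + (G y - G a)"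
proof -
  have increment: "(t - s) * g t \<le> G t - G s" "G t - G s \<le> (t - s) * g s"
    if "real a \<le> s" "s \<le> t" "t \<le> y" for s t
    using antimono_increment_bounds[of s t G g] deriv antimono that by auto
  define m where "m = nat \<lfloor>y\<rfloor>"
  have m: "a \<le> m" "real m \<le> y" "y \<le> real m + 1"
    unfolding m_def using y by (auto simp: le_nat_floor)
  have range: "{n. a \<le> n \<and> real n \<le> y} = {a..m}"
    unfolding m_def using y by (auto simp: le_nat_floor) linarith
  have partial: "G i - G a + g i \<le> (\<Sum>n=a..i. g (real n)) \<and> (\<Sum>n=a..i. g (real n)) \<le> g a + (G i - G a)"
    if "a \<le> i" "i \<le> m" for i
    using that
  proof (induction i rule: dec_induct)
    case (step i)
    have "real (Suc i) \<le> y" using step.prems m by linarith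
    then show ?case using step increment[of "real i" "real (Suc i)"] by auto
  qed auto
  have "(y - m) * g m \<le> 1 * g m"
    using m y nonneg antimono[of m y] by (intro mult_right_mono) auto
  then have "G y \<le> G m + g m" using increment(2)[of m y] m by simp
  then show "G y - G a \<le> (\<Sum>n | a \<le> n \<and> real n \<le> y. g (real n))"
    using partial[of m] m unfolding range by linarith
  have "0 \<le> (y - m) * g y" using m nonneg by simp
  then have "G m \<le> G y" using increment(1)[of m y] m by simp
  then show "(\<Sum>n | a \<le> n \<and> real n \<le> y. g (real n)) \<le> g a + (G y - G a)"
    using partial[of m] m unfolding range by linarith
qed

lemma log_power_sum_bounds:
  fixes y :: real
  assumes "1 \<le> y"
  shows "ln y ^ (j + 1) / real (j + 1) \<le> (\<Sum>n | 1 \<le> n \<and> real n \<le> y. ln (y / real n) ^ j / real n)"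
    and "(\<Sum>n | 1 \<le> n \<and> real n \<le> y. ln (y / real n) ^ j / real n) \<le> ln y ^ (j + 1) / real (j + 1) + ln y ^ j"
proof -
  define G where "G t = - (ln (y / t) ^ (j + 1)) / real (j + 1)" for t
  define g where "g t = ln (y / t) ^ j / t" for t
  have deriv: "(G has_real_derivative g t) (at t)" if "real 1 \<le> t" "t \<le> y" for t
  proof -
    have "((\<lambda>t. ln (y / t)) has_real_derivative - (1 / t)) (at t)"
      using that assms by (auto intro!: derivative_eq_intros simp: field_simps)
    from DERIV_power[OF this, of "j + 1"]
    have "((\<lambda>t. ln (y / t) ^ (j + 1)) has_real_derivative - (real (j + 1) * g t)) (at t)"
      by (simp add: g_def)
    from DERIV_cdivide[OF DERIV_minus[OF this], of "real (j + 1)"] show ?thesis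
      unfolding G_def by simp
  qed
  have antimono: "g t \<le> g s" if "real 1 \<le> s" "s \<le> t" "t \<le> y" for s t
    unfolding g_def using that assms
    by (intro frac_le power_mono ln_ge_zero zero_le_power) (auto simp: field_simps frac_le)
  have "0 \<le> g y" "real 1 \<le> y" unfolding g_def using assms by auto
  note bounds = antimono_sum_bounds[of 1 y G g, OF deriv antimono this]
  have "G y = 0" "G 1 = - (ln y ^ (j + 1) / real (j + 1))" "g 1 = ln y ^ j"
    unfolding G_def g_def using assms by simp_all
  then show "ln y ^ (j + 1) / real (j + 1) \<le> (\<Sum>n | 1 \<le> n \<and> real n \<le> y. ln (y / real n) ^ j / real n)"
    "(\<Sum>n | 1 \<le> n \<and> real n \<le> y. ln (y / real n) ^ j / real n) \<le> ln y ^ (j + 1) / real (j + 1) + ln y ^ j"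
    using bounds by (simp_all add: g_def)
qed

lemma harmonic_sum_le:
  assumes "1 \<le> x"
  shows "(\<Sum>n | 1 \<le> n \<and> real n \<le> x. 1 / real n) \<le> 1 + ln x"
  using log_power_sum_bounds(2)[OF assms, of 0] by simp

lemma harmonic_tail_le:
  assumes z: "1 \<le> z" and q: "1 \<le> q"
  shows "(\<Sum>n | (1 \<le> n \<and> z < q * real n) \<and> real n \<le> z. 1 / real n) \<le> 1 + ln q"
proof -
  define a where "a = nat \<lfloor>z / q\<rfloor> + 1"
  have zq: "0 \<le> z / q" using z q by simp
  have a: "1 \<le> a" "z / q < real a" unfolding a_def using zq by linarith+
  have "a \<le> n" if "z < q * real n" for n
  proof -
    have "z / q < real n" using that q by (simp add: divide_less_eq mult.commute)
    then have "\<lfloor>z / q\<rfloor> < int n" by (simp add: floor_less_iff)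
    then show ?thesis unfolding a_def using zq by linarith
  qed
  then have "(\<Sum>n | (1 \<le> n \<and> z < q * real n) \<and> real n \<le> z. 1 / real n)
      \<le> (\<Sum>n | a \<le> n \<and> real n \<le> z. 1 / real n)"
    by (intro sum_mono2) auto
  also have "\<dots> \<le> 1 + ln q"
  proof (cases "real a \<le> z")
    case True
    have "(ln has_real_derivative 1 / t) (at t)" if "real a \<le> t" for t
      using DERIV_ln[of t] that a by (simp add: inverse_eq_divide)
    then have "(\<Sum>n | a \<le> n \<and> real n \<le> z. 1 / real n) \<le> 1 / real a + (ln z - ln (real a))"
      using a z True by (intro antimono_sum_bounds(2)) (auto intro: divide_left_mono)
    also have "1 / real a \<le> 1" using a by simp
    also have "ln z \<le> ln (q * real a)"
      using a z q by (simp add: divide_less_eq mult.commute)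
    also have "ln (q * real a) - ln (real a) = ln q" using a q by (simp add: ln_mult)
    finally show ?thesis by simp
  next
    case False
    then have "(\<Sum>n | a \<le> n \<and> real n \<le> z. 1 / real n) = 0"
      by (intro sum.neutral) auto
    then show ?thesis using q by simp
  qed
  finally show ?thesis .
qed

lemma inverse_square_tail_le:
  assumes "0 < (D::nat)" "finite A" "\<And>n. n \<in> A \<Longrightarrow> D < n"
  shows "(\<Sum>n\<in>A. 1 / (real n)\<^sup>2) \<le> 1 / real D"
proof -
  have telescope: "(\<Sum>n=Suc D..m. 1 / (real n)\<^sup>2) \<le> 1 / real D - 1 / real m" if "D \<le> m" for m
    using that
  proof (induction m rule: dec_induct)
    case (step m)
    have "1 / (real (Suc m))\<^sup>2 \<le> 1 / (real m * real (Suc m))"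
      using step assms(1) by (intro divide_left_mono) (auto simp: power2_eq_square intro!: mult_right_mono)
    also have "\<dots> = 1 / real m - 1 / real (Suc m)" using step assms(1) by (simp add: field_simps)
    finally show ?case using step by simp
  qed simp
  define m where "m = Max (insert D A)"
  have "(\<Sum>n\<in>A. 1 / (real n)\<^sup>2) \<le> (\<Sum>n=Suc D..m. 1 / (real n)\<^sup>2)"
    using assms by (intro sum_mono2) (auto simp: m_def Suc_le_eq)
  also have "\<dots> \<le> 1 / real D - 1 / real m" using assms by (intro telescope) (auto simp: m_def)
  finally show ?thesis by (simp add: order_trans)
qed

lemma abel_summation_bound:
  fixes e F :: "nat \<Rightarrow> real"
  assumes E: "\<And>i. i \<le> m \<Longrightarrow> \<bar>\<Sum>n=1..i. e n\<bar> \<le> E"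
    and F: "\<And>i. 1 \<le> i \<Longrightarrow> i < m \<Longrightarrow> F (Suc i) \<le> F i" "0 \<le> F m" and m: "1 \<le> m"
  shows "\<bar>\<Sum>n=1..m. e n * F n\<bar> \<le> E * F 1"
proof -
  have by_parts: "(\<Sum>n=1..m. e n * F n)
      = (\<Sum>n=1..<m. (\<Sum>i=1..n. e i) * (F n - F (Suc n))) + (\<Sum>i=1..m. e i) * F m"
    using m by (induction m rule: dec_induct) (auto simp: algebra_simps)
  have telescope: "(\<Sum>n=1..<m. F n - F (Suc n)) = F 1 - F m"
    using m by (induction m rule: dec_induct) auto
  have "\<bar>\<Sum>n=1..m. e n * F n\<bar> \<le> (\<Sum>n=1..<m. \<bar>(\<Sum>i=1..n. e i) * (F n - F (Suc n))\<bar>) + \<bar>(\<Sum>i=1..m. e i) * F m\<bar>"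
    unfolding by_parts by (rule order_trans[OF abs_triangle_ineq]) auto
  also have "\<dots> \<le> (\<Sum>n=1..<m. E * (F n - F (Suc n))) + E * F m"
    unfolding abs_mult using F E by (intro add_mono sum_mono mult_mono) (auto intro: order_trans[OF abs_ge_zero])
  also have "\<dots> = E * F 1"
    by (simp only: sum_distrib_left[symmetric] telescope) (simp add: algebra_simps)
  finally show ?thesis .
qed

section \<open>Harmonic sums over moduli and over coprime integers\<close>

lemma sum_inverse_modulus_le:
  assumes "1 \<le> x"
  shows "(\<Sum>C\<in>rough_moduli D x. 1 / real (modulus C)) \<le> 1 + ln x"
proof -
  have "(\<Sum>C\<in>rough_moduli D x. 1 / real (modulus C)) \<le> (\<Sum>n | 1 \<le> n \<and> real n \<le> x. 1 / real n)"
    by (rule sum_modulus_le_sum_nat[OF order_refl])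
      (use rough_modulus_pos in \<open>auto dest: rough_moduliD simp: Suc_le_eq\<close>)
  also have "\<dots> \<le> 1 + ln x" by (rule harmonic_sum_le[OF assms])
  finally show ?thesis .
qed

lemma sum_power_card_div_modulus_le:
  assumes "1 \<le> x"
  shows "(\<Sum>C\<in>rough_moduli D x. real K ^ card C / real (modulus C)) \<le> (1 + ln x) ^ K"
proof (induction K)
  case 0
  have "(\<Sum>C\<in>rough_moduli D x. real 0 ^ card C / real (modulus C)) = (\<Sum>C\<in>rough_moduli D x. if C = {} then 1 else 0)"
    by (intro sum.cong refl) (auto dest: rough_moduliD)
  then show ?case by simp
next
  case (Suc K)
  have "(\<Sum>C\<in>rough_moduli D x. real (Suc K) ^ card C / real (modulus C))
      = (\<Sum>C\<in>rough_moduli D x. (\<Prod>p\<in>C. real K / real p + 1 / real p) * 1)"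
    unfolding prod_divide_const_modulus[symmetric] by (simp add: add_divide_distrib add.commute)
  also have "\<dots> \<le> (\<Sum>A\<in>rough_moduli D x. (\<Prod>p\<in>A. real K / real p) * (1 + ln x))"
  proof (rule sum_prod_add_le)
    fix A assume A: "A \<in> rough_moduli D x"
    have "(\<Sum>B\<in>rough_moduli D (x / modulus A). 1 / real (modulus B)) \<le> 1 + ln (x / modulus A)"
      by (rule sum_inverse_modulus_le[OF rough_moduli_quotient_ge_1[OF A]])
    also have "\<dots> \<le> 1 + ln x"
      using rough_moduli_quotient_ge_1[OF A] rough_modulus_ge_1[OF A] by (simp add: field_simps)
    finally show "(\<Sum>B\<in>rough_moduli D (x / modulus A). (\<Prod>p\<in>B. 1 / real p) * 1) \<le> 1 + ln x"
      by (simp add: prod_divide_const_modulus)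
  qed auto
  also have "\<dots> = (\<Sum>A\<in>rough_moduli D x. real K ^ card A / real (modulus A)) * (1 + ln x)"
    by (simp add: prod_divide_const_modulus sum_distrib_right)
  also have "\<dots> \<le> (1 + ln x) ^ K * (1 + ln x)"
    using Suc assms by (intro mult_right_mono) auto
  finally show ?case by (simp add: mult.commute)
qed

lemma sum_power_card_le:
  assumes "1 \<le> x"
  shows "(\<Sum>C\<in>rough_moduli D x. real K ^ card C) \<le> x * (1 + ln x) ^ K"
proof -
  have "(\<Sum>C\<in>rough_moduli D x. real K ^ card C) \<le> (\<Sum>C\<in>rough_moduli D x. x * (real K ^ card C / real (modulus C)))"
  proof (intro sum_mono)
    fix C assume C: "C \<in> rough_moduli D x"
    have "1 * real K ^ card C \<le> x / real (modulus C) * real K ^ card C"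
      using rough_moduli_quotient_ge_1[OF C] by (intro mult_right_mono) auto
    then show "real K ^ card C \<le> x * (real K ^ card C / real (modulus C))" by simp
  qed
  also have "\<dots> \<le> x * (1 + ln x) ^ K"
    unfolding sum_distrib_left[symmetric] using assms
    by (intro mult_left_mono sum_power_card_div_modulus_le) auto
  finally show ?thesis .
qed

lemma sum_prod_rough_moduli_le_exp:
  fixes b :: "nat \<Rightarrow> real"
  assumes b: "\<And>p. prime p \<Longrightarrow> D < p \<Longrightarrow> 0 \<le> b p"
  shows "(\<Sum>C\<in>rough_moduli D x. \<Prod>p\<in>C. b p) \<le> exp (\<Sum>p | (prime p \<and> D < p) \<and> real p \<le> x. b p)"
proof -
  let ?Q = "{p. (prime p \<and> D < p) \<and> real p \<le> x}"
  have "rough_moduli D x \<subseteq> Pow ?Q"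
    using rough_moduli_element_le by (auto dest: rough_moduliD)
  then have "(\<Sum>C\<in>rough_moduli D x. \<Prod>p\<in>C. b p) \<le> (\<Sum>C\<in>Pow ?Q. \<Prod>p\<in>C. b p)"
    using b by (intro sum_mono2) (auto intro!: prod_nonneg)
  also have "\<dots> = (\<Prod>p\<in>?Q. 1 + b p)" by (intro sum_Pow_prod) simp
  also have "\<dots> \<le> (\<Prod>p\<in>?Q. exp (b p))" using b by (intro prod_mono) (auto intro: add_nonneg_nonneg)
  also have "\<dots> = exp (\<Sum>p\<in>?Q. b p)" by (simp add: exp_sum)
  finally show ?thesis .
qed

text \<open>Splitting \<open>1 / (p - k) = k / (p * (p - k)) + 1 / p\<close> replaces the sieve weights by reciprocals, at the cost
  of a constant that tends to 1 as D grows.\<close>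

lemma sum_prod_inverse_shift_le:
  fixes F :: "nat \<Rightarrow> real"
  assumes D: "2 * k \<le> D" "0 < D" and F: "\<And>n. 0 \<le> F n"
    and U: "\<And>A. A \<in> rough_moduli D x \<Longrightarrow>
      (\<Sum>B\<in>rough_moduli D (x / modulus A). 1 / real (modulus B) * F (modulus A * modulus B)) \<le> U"
    and U0: "0 \<le> U"
  shows "(\<Sum>B\<in>rough_moduli D x. (\<Prod>p\<in>B. 1 / (real p - real k)) * F (modulus B)) \<le> exp (2 * real k / real D) * U"
proof -
  define b where "b p = real k / (real p * (real p - real k))" for p :: nat
  have p_minus_k: "0 < real p - real k" "real p \<le> 2 * (real p - real k)" if "D < p" for p using that D by auto
  have b_nonneg: "0 \<le> b p" if "D < p" for p using p_minus_k[OF that] by (simp add: b_def)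
  have split: "1 / (real p - real k) = b p + 1 / real p" if "D < p" for p
    unfolding b_def using p_minus_k[OF that] that by (simp add: field_simps)
  have b_le: "b p \<le> 2 * real k * (1 / (real p)\<^sup>2)" if "D < p" for p
    unfolding b_def using p_minus_k[OF that] that mult_right_mono[OF p_minus_k(2)[OF that], of "real k * real p"]
    by (simp add: field_simps power2_eq_square)
  have "(\<Sum>B\<in>rough_moduli D x. (\<Prod>p\<in>B. 1 / (real p - real k)) * F (modulus B))
    = (\<Sum>B\<in>rough_moduli D x. (\<Prod>p\<in>B. b p + 1 / real p) * F (modulus B))"
    by (intro sum.cong refl arg_cong2[of _ _ _ _ "(*)"] prod.cong split) (auto dest: rough_moduliD)
  also have "\<dots> \<le> (\<Sum>A\<in>rough_moduli D x. (\<Prod>p\<in>A. b p) * U)"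
    using b_nonneg F U by (intro sum_prod_add_le) (auto simp: prod_divide_const_modulus)
  also have "\<dots> = (\<Sum>A\<in>rough_moduli D x. \<Prod>p\<in>A. b p) * U" by (simp add: sum_distrib_right)
  also have "\<dots> \<le> exp (2 * real k / real D) * U"
  proof (intro mult_right_mono U0)
    let ?Q = "{p. (prime p \<and> D < p) \<and> real p \<le> x}"
    have "(\<Sum>A\<in>rough_moduli D x. \<Prod>p\<in>A. b p) \<le> exp (\<Sum>p\<in>?Q. b p)"
      using b_nonneg by (intro sum_prod_rough_moduli_le_exp) auto
    also have "(\<Sum>p\<in>?Q. b p) \<le> (\<Sum>p\<in>?Q. 2 * real k * (1 / (real p)\<^sup>2))"
      using b_le by (intro sum_mono) auto
    also have "\<dots> \<le> 2 * real k * (1 / real D)"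
      unfolding sum_distrib_left[symmetric] using D by (intro mult_left_mono inverse_square_tail_le) auto
    finally show "(\<Sum>A\<in>rough_moduli D x. \<Prod>p\<in>A. b p) \<le> exp (2 * real k / real D)" by simp
  qed
  finally show ?thesis .
qed

definition prime_free_part :: "nat \<Rightarrow> nat \<Rightarrow> nat" where
  "prime_free_part p n = n div p ^ multiplicity p n"

lemma prime_free_part_decompose: "n = p ^ multiplicity p n * prime_free_part p n"
  unfolding prime_free_part_def by (simp add: multiplicity_dvd)

lemma prime_free_part_pos: "0 < n \<Longrightarrow> 0 < prime_free_part p n"
  using prime_free_part_decompose[of n p] by (metis gr0I mult_0_right)

lemma prime_factors_prime_free_part:
  assumes "prime p" "0 < n"
  shows "prime_factors (prime_free_part p n) \<subseteq> prime_factors n - {p}"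
proof -
  have "prime_free_part p n dvd n"
    using prime_free_part_decompose[of n p] by (metis dvd_triv_right)
  then have "prime_factors (prime_free_part p n) \<subseteq> prime_factors n"
    using assms by (intro dvd_prime_factors) auto
  moreover have "\<not> p dvd prime_free_part p n"
    using multiplicity_decompose[of n p] prime_gt_1_nat[OF assms(1)] assms(2)
    by (auto simp: prime_free_part_def)
  ultimately show ?thesis by auto
qed

lemma sum_inverse_le_sum_prime_free_part:
  assumes p: "prime p" and X: "finite X"
  shows "(\<Sum>n\<in>X. 1 / real n) \<le> real p / (real p - 1) * (\<Sum>m\<in>prime_free_part p ` X. 1 / real m)"
proof -
  define L where "L = Max (multiplicity p ` X)"
  let ?Y = "{..L} \<times> prime_free_part p ` X"
  have p_ge_2: "2 \<le> p" using p by (rule prime_ge_2_nat)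
  have "(\<Sum>n\<in>X. 1 / real n) \<le> (\<Sum>y\<in>?Y. (1 / real p) ^ fst y * (1 / real (snd y)))"
  proof (rule sum_le_included[where i = "\<lambda>(e, m). p ^ e * m"], goal_cases finite_dom finite_cod nonneg cover)
    case cover
    show ?case
    proof
      fix n assume n: "n \<in> X"
      have "real n = real p ^ multiplicity p n * real (prime_free_part p n)"
        using arg_cong[OF prime_free_part_decompose[of n p], of real] by simp
      then have "1 / real n = (1 / real p) ^ multiplicity p n * (1 / real (prime_free_part p n))"
        by (simp add: power_one_over field_simps)
      moreover have "multiplicity p n \<le> L" unfolding L_def using n X by auto
      ultimately show "\<exists>y\<in>?Y. (case y of (e, m) \<Rightarrow> p ^ e * m) = n \<and> 1 / real n \<le> (1 / real p) ^ fst y * (1 / real (snd y))"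
        using n prime_free_part_decompose[of n p]
        by (intro bexI[of _ "(multiplicity p n, prime_free_part p n)"]) auto
    qed
  qed (use X in auto)
  also have "\<dots> = (\<Sum>e\<le>L. (1 / real p) ^ e) * (\<Sum>m\<in>prime_free_part p ` X. 1 / real m)"
    by (simp add: sum_product sum.cartesian_product case_prod_unfold)
  also have "\<dots> \<le> real p / (real p - 1) * (\<Sum>m\<in>prime_free_part p ` X. 1 / real m)"
  proof (intro mult_right_mono sum_nonneg)
    have "(\<Sum>e\<le>L. (1 / real p) ^ e) \<le> (\<Sum>e. (1 / real p) ^ e)"
      using p_ge_2 by (intro sum_le_suminf summable_geometric) auto
    also have "\<dots> = real p / (real p - 1)"
      using p_ge_2 by (subst suminf_geometric) (auto simp: field_simps)
    finally show "(\<Sum>e\<le>L. (1 / real p) ^ e) \<le> real p / (real p - 1)" .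
  qed simp
  finally show ?thesis .
qed

lemma sum_inverse_smooth_le:
  assumes "finite G" "\<And>p. p \<in> G \<Longrightarrow> prime (p::nat)" "finite X"
    "\<And>n. n \<in> X \<Longrightarrow> 0 < n \<and> prime_factors n \<subseteq> G"
  shows "(\<Sum>n\<in>X. 1 / real n) \<le> (\<Prod>p\<in>G. real p / (real p - 1))"
  using assms
proof (induction G arbitrary: X rule: finite_induct)
  case empty
  then have "n = 1" if "n \<in> X" for n
    using empty.prems(3)[OF that] prime_factorization_empty_iff[of n] by auto
  then have "X \<subseteq> {1}" by auto
  then have "(\<Sum>n\<in>X. 1 / real n) \<le> (\<Sum>n\<in>{1}. 1 / real n)" by (intro sum_mono2) auto
  then show ?case by simp
next
  case (insert p G)
  have p: "prime p" using insert.prems by auto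
  have smooth: "0 < m \<and> prime_factors m \<subseteq> G" if m: "m \<in> prime_free_part p ` X" for m
  proof -
    obtain n where n: "n \<in> X" "m = prime_free_part p n" using m by auto
    then show ?thesis
      using insert.prems(3)[OF n(1)] prime_free_part_pos[of n p] prime_factors_prime_free_part[OF p, of n] by auto
  qed
  have "(\<Sum>n\<in>X. 1 / real n) \<le> real p / (real p - 1) * (\<Sum>m\<in>prime_free_part p ` X. 1 / real m)"
    using insert.prems p by (intro sum_inverse_le_sum_prime_free_part) auto
  also have "\<dots> \<le> real p / (real p - 1) * (\<Prod>p\<in>G. real p / (real p - 1))"
    using insert.prems smooth prime_gt_1_nat[OF p] by (intro mult_left_mono insert.IH) auto
  finally show ?case using insert.hyps by simp
qed

lemma modulus_prime_factors_subset_dvd: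
  assumes "0 < n" "A \<subseteq> prime_factors n"
  shows "modulus A dvd n"
proof -
  have "modulus A dvd modulus (prime_factors n)"
    using assms by (intro modulus_dvd_modulus) auto
  also have "\<dots> dvd (\<Prod>p\<in>prime_factors n. p ^ multiplicity p n)"
    unfolding modulus_def by (intro prod_dvd_prod dvd_power) (auto simp: prime_factors_multiplicity)
  also have "\<dots> = n" using prime_factorization_nat[of n] assms by simp
  finally show ?thesis .
qed

lemma sum_inverse_fixed_prime_factors_le:
  assumes G: "finite G" "\<And>p. p \<in> G \<Longrightarrow> prime p" and m: "finite m" "\<And>p. p \<in> m \<Longrightarrow> prime p" "m \<inter> G = {}"
    and Y: "finite Y" "\<And>n. n \<in> Y \<Longrightarrow> 0 < n \<and> prime_factors n - G = m"
  shows "(\<Sum>n\<in>Y. 1 / real n) \<le> (\<Prod>p\<in>G. real p / (real p - 1)) * (\<Prod>p\<in>m. 1 / (real p - 1))"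
proof -
  let ?d = "\<lambda>n. n div modulus m"
  have dvd: "modulus m dvd n" if "n \<in> Y" for n
    using Y(2)[OF that] by (intro modulus_prime_factors_subset_dvd) auto
  have m_pos: "0 < real (modulus m)" using modulus_pos[OF m(2)] by simp
  have "(\<Sum>n\<in>Y. 1 / real n) = (\<Sum>n\<in>Y. 1 / real (modulus m) * (1 / real (?d n)))"
    using dvd by (intro sum.cong) (auto simp: real_of_nat_div)
  also have "\<dots> = 1 / real (modulus m) * (\<Sum>q\<in>?d ` Y. 1 / real q)"
  proof -
    have "inj_on ?d Y" using dvd by (auto intro!: inj_onI) (metis dvd_div_mult_self)
    then show ?thesis by (simp add: sum.reindex sum_distrib_left)
  qed
  also have "\<dots> \<le> 1 / real (modulus m) * (\<Prod>p\<in>G \<union> m. real p / (real p - 1))"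
  proof (intro mult_left_mono sum_inverse_smooth_le)
    fix q assume "q \<in> ?d ` Y"
    then obtain n where n: "n \<in> Y" "n = modulus m * q" using dvd by auto
    have "0 < n" using Y(2)[OF n(1)] by simp
    then have "0 < q" using n(2) by (cases q) auto
    moreover have "prime_factors q \<subseteq> prime_factors n"
      using n(2) \<open>0 < n\<close> by (intro dvd_prime_factors) auto
    ultimately show "0 < q \<and> prime_factors q \<subseteq> G \<union> m" using Y(2)[OF n(1)] by auto
  qed (use G m Y in auto)
  also have "(\<Prod>p\<in>G \<union> m. real p / (real p - 1))
      = (\<Prod>p\<in>G. real p / (real p - 1)) * (real (modulus m) * (\<Prod>p\<in>m. 1 / (real p - 1)))"
    using G(1) m by (simp add: prod.union_disjoint Int_commute modulus_def prod.distrib[symmetric])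
  finally show ?thesis using m_pos by simp
qed

lemma antimono_harmonic_sum_le:
  fixes F :: "nat \<Rightarrow> real" and D :: nat
  assumes nonneg: "\<And>n. 1 \<le> n \<Longrightarrow> real n \<le> x \<Longrightarrow> 0 \<le> F n"
    and antimono: "\<And>m n. 1 \<le> m \<Longrightarrow> m \<le> n \<Longrightarrow> real n \<le> x \<Longrightarrow> F n \<le> F m"
    and C: "finite C" "\<And>p. p \<in> C \<Longrightarrow> prime p"
  defines "G \<equiv> {p. prime p \<and> p \<le> D} \<union> C"
  shows "(\<Sum>n | 1 \<le> n \<and> real n \<le> x. F n / real n)
    \<le> (\<Prod>p\<in>G. real p / (real p - 1)) *
       (\<Sum>m | m \<in> rough_moduli D x \<and> m \<inter> C = {}. (\<Prod>p\<in>m. 1 / (real p - 1)) * F (modulus m))"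
proof -
  let ?X = "{n. 1 \<le> n \<and> real n \<le> x}" and ?M = "{m. m \<in> rough_moduli D x \<and> m \<inter> C = {}}"
  let ?r = "\<lambda>n. prime_factors n - G" and ?g = "\<Prod>p\<in>G. real p / (real p - 1)"
  have G: "finite G" "\<And>p. p \<in> G \<Longrightarrow> prime p" unfolding G_def using C by auto
  have modulus_le: "modulus (?r n) \<le> n" if "n \<in> ?X" for n
    using modulus_prime_factors_subset_dvd[of n "?r n"] that by (auto intro: dvd_imp_le)
  have rough: "?r n \<in> ?M" if "n \<in> ?X" for n
    using that modulus_le[OF that] unfolding rough_moduli_def G_def by (auto simp: not_le intro: order_trans)
  \<comment> \<open>Group the n by the set m of their prime factors outside G, and use \<open>F n \<le> F (modulus m)\<close>.\<close>
  have "(\<Sum>n\<in>?X. F n / real n) = (\<Sum>m\<in>?M. \<Sum>n | n \<in> ?X \<and> ?r n = m. F n / real n)"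
    using rough by (intro sum.group[symmetric]) auto
  also have "\<dots> \<le> (\<Sum>m\<in>?M. ?g * ((\<Prod>p\<in>m. 1 / (real p - 1)) * F (modulus m)))"
  proof (intro sum_mono)
    fix m assume m: "m \<in> ?M"
    then have primes: "finite m" "\<And>p. p \<in> m \<Longrightarrow> prime p" "m \<inter> G = {}"
      by (auto dest: rough_moduliD simp: G_def)
    have range: "1 \<le> modulus m" "real (modulus m) \<le> x"
      using m rough_modulus_pos[of m D x] by (auto dest: rough_moduliD simp: Suc_le_eq)
    let ?Y = "{n. n \<in> ?X \<and> ?r n = m}"
    have "(\<Sum>n\<in>?Y. F n / real n) \<le> (\<Sum>n\<in>?Y. F (modulus m) * (1 / real n))"
    proof (intro sum_mono)
      fix n assume n: "n \<in> ?Y"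
      then have "F n \<le> F (modulus m)" using antimono[of "modulus m" n] modulus_le[of n] range by auto
      then show "F n / real n \<le> F (modulus m) * (1 / real n)" by (simp add: divide_right_mono)
    qed
    also have "\<dots> = F (modulus m) * (\<Sum>n\<in>?Y. 1 / real n)" by (simp add: sum_distrib_left)
    also have "\<dots> \<le> F (modulus m) * (?g * (\<Prod>p\<in>m. 1 / (real p - 1)))"
      using nonneg[OF range] G primes
      by (intro mult_left_mono sum_inverse_fixed_prime_factors_le) (auto intro: finite_subset[of _ ?X])
    finally show "(\<Sum>n\<in>?Y. F n / real n) \<le> ?g * ((\<Prod>p\<in>m. 1 / (real p - 1)) * F (modulus m))"
      by (simp add: mult_ac)
  qed
  finally show ?thesis by (simp add: sum_distrib_left)
qed

lemma totatives_decomposition: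
  assumes "coprime n W" "0 < W" "W < n"
  obtains a j where "a \<in> totatives W" "1 \<le> j" "n = a + j * W"
proof -
  define j where "j = (n - 1) div W"
  define a where "a = (n - 1) mod W + 1"
  have "n - 1 = (n - 1) mod W + j * W" unfolding j_def by (simp add: mult.commute)
  then have n: "n = a + j * W" using assms(3) unfolding a_def by auto
  have a: "1 \<le> a" "a \<le> W" unfolding a_def using assms by (auto simp: Suc_le_eq)
  have "gcd W n = gcd W (j * W + a)" by (subst n) (simp only: add.commute)
  also have "\<dots> = gcd W a" by (rule gcd_add_mult)
  finally have "coprime a W"
    using assms(1) by (metis coprime_commute coprime_iff_gcd_eq_1)
  then have "a \<in> totatives W" using a by (auto simp: totatives_def)
  moreover have "1 \<le> j" using n a assms(3) by (cases j) auto
  ultimately show ?thesis using n by (rule that)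
qed

lemma coprime_harmonic_sum_le:
  assumes W: "0 < W" and x: "1 \<le> x"
  shows "(\<Sum>n | (1 \<le> n \<and> coprime n W) \<and> real n \<le> x. 1 / real n)
    \<le> real (totient W) / real W * ln x + (1 + 2 * real W)"
proof -
  let ?X = "{n. (1 \<le> n \<and> coprime n W) \<and> real n \<le> x}" and ?J = "{j. 1 \<le> j \<and> real j \<le> x}"
  let ?T = "{n \<in> ?X. W < n}"
  have fin: "finite ?T" by (rule finite_subset[of _ ?X]) auto
  have "(\<Sum>n\<in>?X. 1 / real n) \<le> (\<Sum>n\<in>{1..W} \<union> ?T. 1 / real n)"
    using fin by (intro sum_mono2) auto
  also have "\<dots> \<le> (\<Sum>n\<in>{1..W}. 1 / real n) + (\<Sum>n\<in>?T. 1 / real n)"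
    using fin by (subst sum.union_disjoint) auto
  also have "(\<Sum>n\<in>{1..W}. 1 / real n) \<le> (\<Sum>n\<in>{1..W}. 1)" by (intro sum_mono) auto
  also have "(\<Sum>n\<in>?T. 1 / real n) \<le> (\<Sum>y\<in>totatives W \<times> ?J. 1 / (real W * real (snd y)))"
  proof (rule sum_le_included[where i = "\<lambda>(a, j). a + j * W"], goal_cases finite_dom finite_cod nonneg cover)
    case cover
    show ?case
    proof
      fix n assume n: "n \<in> ?T"
      then obtain a j where aj: "a \<in> totatives W" "1 \<le> j" "n = a + j * W"
        using totatives_decomposition[of n W] W by blast
      have "j \<le> j * W" using W by simp
      then have "j \<le> n" "j * W \<le> n" using aj(3) by linarith+
      then have "j \<in> ?J" "1 / real n \<le> 1 / (real W * real j)"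
        using aj n W by (auto intro!: divide_left_mono simp: mult.commute simp flip: of_nat_mult)
      then show "\<exists>y\<in>totatives W \<times> ?J. (case y of (a, j) \<Rightarrow> a + j * W) = n \<and> 1 / real n \<le> 1 / (real W * real (snd y))"
        using aj by (intro bexI[of _ "(a, j)"]) auto
    qed
  qed (use fin in auto)
  also have "\<dots> = (\<Sum>a\<in>totatives W. \<Sum>j\<in>?J. 1 / (real W * real j))"
    by (simp only: sum.cartesian_product case_prod_unfold)
  also have "\<dots> = real (totient W) / real W * (\<Sum>j\<in>?J. 1 / real j)"
    by (simp add: totient_def sum_distrib_left)
  also have "\<dots> \<le> real (totient W) / real W * (1 + ln x)"
    using harmonic_sum_le[OF x] by (intro mult_left_mono) auto
  also have "\<dots> \<le> real (totient W) / real W * ln x + 1"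
    using W totient_le[of W] by (simp add: distrib_left)
  finally show ?thesis by simp
qed

section \<open>A Mertens-type estimate\<close>

definition ln_prime :: "nat \<Rightarrow> real" where
  "ln_prime n = (if prime n then ln (real n) else 0)"

lemma sum_ln_prime: "(\<Sum>n | 1 \<le> n \<and> n \<le> N \<and> P n. ln_prime n) = (\<Sum>p | prime p \<and> p \<le> N \<and> P p. ln (real p))"
  by (rule sum.mono_neutral_cong_right) (auto simp: ln_prime_def Suc_le_eq prime_gt_0_nat)

definition mertens_bound :: "real \<Rightarrow> bool" where
  "mertens_bound E \<longleftrightarrow> (\<forall>m. \<bar>\<Sum>n=1..m. ln_prime n / real n - 1 / real n\<bar> \<le> E)"

lemma sum_ln_div_square_bounded:
  obtains Z :: real where "0 \<le> Z" "\<And>A::nat set. finite A \<Longrightarrow> (\<Sum>n\<in>A. ln (real n) / real n ^ 2) \<le> Z"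
proof -
  have summable: "summable (\<lambda>n::nat. ln (real n) / real n ^ 2)"
  proof (rule summable_comparison_test_bigo)
    show "summable (\<lambda>n::nat. norm (real n powr (-3/2)))"
      by (simp add: summable_real_powr_iff)
    show "(\<lambda>n::nat. ln (real n) / real n ^ 2) \<in> O(\<lambda>n. real n powr (-3/2))"
      by real_asymp
  qed
  have nonneg: "0 \<le> ln (real n) / real n ^ 2" for n :: nat by (cases n) auto
  show ?thesis
  proof (rule that)
    show "0 \<le> (\<Sum>n. ln (real n) / real n ^ 2)"
      using summable nonneg by (rule suminf_nonneg)
    show "(\<Sum>n\<in>A. ln (real n) / real n ^ 2) \<le> (\<Sum>n. ln (real n) / real n ^ 2)" if "finite A" for A :: "nat set"
      using that by (intro sum_le_suminf summable nonneg) auto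
  qed
qed

lemma sum_inverse_ln_square_le:
  assumes "2 \<le> m"
  shows "(\<Sum>n=2..<m. 1 / ((real n + 1) * ln (real n) ^ 2)) \<le> 2 * (1 / ln 2 - 1 / ln (real m))"
  using assms
proof (induction m rule: dec_induct)
  case (step n)
  have n: "2 \<le> n" using step by simp
  let ?a = "ln (real n)" and ?b = "ln (real n + 1)"
  have a_pos: "0 < ?a" and b_pos: "0 < ?b" using n by auto
  have "real n + 1 \<le> real n * 2" using n by simp
  also have "\<dots> \<le> real n * real n" using n by (intro mult_left_mono) auto
  finally have "?b \<le> ln (real n ^ 2)" using n by (subst ln_le_cancel_iff) (auto simp: power2_eq_square)
  then have b_le: "?b \<le> 2 * ?a" using n by (simp add: ln_realpow)
  have "ln (real n / (real n + 1)) \<le> real n / (real n + 1) - 1" using n by (intro ln_le_minus_one) auto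
  also have "\<dots> = - (1 / (real n + 1))" by (simp add: field_simps)
  finally have increment: "1 / (real n + 1) \<le> ?b - ?a" using n by (simp add: ln_div)
  have "1 / ((real n + 1) * ?a ^ 2) = 1 / (real n + 1) * (1 / (?a * ?a))" by (simp add: power2_eq_square)
  also have "\<dots> \<le> (?b - ?a) * (2 / (?a * ?b))"
  proof (intro mult_mono increment)
    have "1 / (?a * ?a) = 2 / (?a * (2 * ?a))" by simp
    also have "\<dots> \<le> 2 / (?a * ?b)"
      using a_pos b_pos b_le n by (intro divide_left_mono mult_left_mono mult_pos_pos) auto
    finally show "1 / (?a * ?a) \<le> 2 / (?a * ?b)" .
    show "0 \<le> ?b - ?a" using n by simp
  qed (use a_pos in auto)
  also have "\<dots> = 2 * (1 / ?a - 1 / ?b)" using a_pos b_pos by (simp add: field_simps)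
  finally show ?case using step by (simp add: add.commute)
qed simp

lemma sum_div_bounded_of_partial_sums:
  fixes t :: "nat \<Rightarrow> real"
  assumes S: "\<And>m. 2 \<le> m \<Longrightarrow> \<bar>\<Sum>n=1..m. t n\<bar> \<le> K * real m / (ln (real m))\<^sup>2" and K: "0 \<le> K"
  shows "\<bar>\<Sum>n=1..m. t n / real n\<bar> \<le> \<bar>t 1\<bar> + 2 * K / ln 2 + K / (ln 2)\<^sup>2"
proof (cases "2 \<le> m")
  case True
  define S where "S m = (\<Sum>n=1..m. t n)" for m
  let ?u = "\<lambda>n. S n * (1 / real n - 1 / real (Suc n))"
  have by_parts: "(\<Sum>n=1..m. t n / real n) = (\<Sum>n=1..<m. ?u n) + S m / real m" if "1 \<le> m" for m
    using that by (induction m rule: dec_induct) (auto simp: S_def algebra_simps add_divide_distrib)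
  have S_div: "\<bar>S n\<bar> / real n \<le> K / (ln (real n))\<^sup>2" if "2 \<le> n" for n
    using S[OF that] that by (simp add: S_def field_simps)
  have u_le: "\<bar>?u n\<bar> \<le> K * (1 / ((real n + 1) * ln (real n) ^ 2))" if "2 \<le> n" for n
  proof -
    have "1 / real n - 1 / real (Suc n) = 1 / real n * (1 / (real n + 1))"
      using that by (simp add: field_simps)
    then have "\<bar>?u n\<bar> = \<bar>S n\<bar> / real n * (1 / (real n + 1))"
      by (simp add: abs_mult)
    also have "\<dots> \<le> K / (ln (real n))\<^sup>2 * (1 / (real n + 1))" by (intro mult_right_mono S_div that) auto
    finally show ?thesis by (simp add: mult.commute)
  qed
  have "\<bar>\<Sum>n=1..m. t n / real n\<bar> \<le> (\<Sum>n=1..<m. \<bar>?u n\<bar>) + \<bar>S m\<bar> / real m"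
    using True unfolding by_parts[of m, OF order_trans[OF one_le_numeral True]]
    by (intro order_trans[OF abs_triangle_ineq] add_mono sum_abs) simp
  also have "(\<Sum>n=1..<m. \<bar>?u n\<bar>) = \<bar>t 1\<bar> / 2 + (\<Sum>n=2..<m. \<bar>?u n\<bar>)"
    using True by (subst sum.atLeast_Suc_lessThan) (auto simp: S_def numeral_2_eq_2)
  also have "(\<Sum>n=2..<m. \<bar>?u n\<bar>) \<le> K * (\<Sum>n=2..<m. 1 / ((real n + 1) * ln (real n) ^ 2))"
    using u_le unfolding sum_distrib_left by (intro sum_mono) auto
  also have "\<dots> \<le> K * (2 * (1 / ln 2 - 1 / ln (real m)))"
    by (intro mult_left_mono sum_inverse_ln_square_le True K)
  also have "\<dots> \<le> 2 * K / ln 2" using K True by (simp add: algebra_simps)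
  also have "\<bar>S m\<bar> / real m \<le> K / (ln 2)\<^sup>2"
    using True K by (intro order_trans[OF S_div] divide_left_mono power_mono) auto
  finally show ?thesis by simp
next
  case False
  then have "m = 0 \<or> m = 1" by auto
  moreover have "0 \<le> 2 * K / ln 2" "0 \<le> K / (ln 2)\<^sup>2" using K by auto
  ultimately show ?thesis by auto
qed

lemma mertens_bound_of_prime_number_theorem:
  fixes K :: real
  assumes PNT: "\<And>N::nat. 2 \<le> N \<Longrightarrow> \<bar>(\<Sum>p | prime p \<and> p \<le> N. ln (real p)) - real N\<bar> \<le> K * real N / (ln (real N))\<^sup>2"
  obtains E where "mertens_bound E"
proof -
  define t where "t n = ln_prime n - 1" for n
  have "0 \<le> K * real (2::nat) / (ln (real (2::nat)))\<^sup>2"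
    by (rule order_trans[OF abs_ge_zero PNT]) simp
  then have K: "0 \<le> K" by (simp add: zero_le_divide_iff zero_le_mult_iff)
  have "(\<Sum>n=1..m. t n) = (\<Sum>p | prime p \<and> p \<le> m. ln (real p)) - real m" for m
  proof -
    have "{1..m} = {n. 1 \<le> n \<and> n \<le> m \<and> True}" by auto
    then have "(\<Sum>n=1..m. ln_prime n) = (\<Sum>p | prime p \<and> p \<le> m. ln (real p))"
      using sum_ln_prime[of m "\<lambda>_. True"] by simp
    then show ?thesis by (simp add: t_def sum_subtractf)
  qed
  then have "\<bar>\<Sum>n=1..m. t n / real n\<bar> \<le> \<bar>t 1\<bar> + 2 * K / ln 2 + K / (ln 2)\<^sup>2" for m
    using PNT by (intro sum_div_bounded_of_partial_sums K) auto
  then show ?thesis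
    by (intro that[of "\<bar>t 1\<bar> + 2 * K / ln 2 + K / (ln 2)\<^sup>2"]) (simp add: mertens_bound_def t_def diff_divide_distrib)
qed

section \<open>Logarithmic moments of a multiplicative density\<close>

definition sieve_moment :: "nat \<Rightarrow> (nat \<Rightarrow> real) \<Rightarrow> nat \<Rightarrow> real \<Rightarrow> real" where
  "sieve_moment D g j x = (\<Sum>C\<in>rough_moduli D x. (\<Prod>p\<in>C. g p) * ln (x / modulus C) ^ j)"

lemma prod_rough_nonneg:
  fixes g :: "nat \<Rightarrow> real"
  assumes "\<And>p. prime p \<Longrightarrow> D < p \<Longrightarrow> 0 \<le> g p" "C \<in> rough_moduli D x"
  shows "0 \<le> (\<Prod>p\<in>C. g p)"
  using assms by (auto intro!: prod_nonneg dest: rough_moduliD)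

lemma sieve_moment_nonneg:
  assumes "\<And>p. prime p \<Longrightarrow> D < p \<Longrightarrow> 0 \<le> g p"
  shows "0 \<le> sieve_moment D g j x"
  unfolding sieve_moment_def
  by (intro sum_nonneg mult_nonneg_nonneg prod_rough_nonneg[OF assms] zero_le_power ln_ge_zero rough_moduli_quotient_ge_1)

lemma sieve_moment_0_ge_1:
  assumes "\<And>p. prime p \<Longrightarrow> D < p \<Longrightarrow> 0 \<le> g p" "1 \<le> x"
  shows "1 \<le> sieve_moment D g 0 x"
proof -
  have "(\<Sum>C\<in>{{}}. \<Prod>p\<in>C. g p) \<le> (\<Sum>C\<in>rough_moduli D x. \<Prod>p\<in>C. g p)"
    using assms(2) prod_rough_nonneg[of D g, OF assms(1)] by (intro sum_mono2) auto
  then show ?thesis unfolding sieve_moment_def by simp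
qed

text \<open>The quotient of the Beta integrals of \<open>(1 - u) ^ j * u powr (\<kappa> - 1)\<close> and \<open>u powr (\<kappa> - 1)\<close> over the unit interval.\<close>

definition beta_ratio :: "real \<Rightarrow> nat \<Rightarrow> real" where
  "beta_ratio \<kappa> j = (\<Prod>i=1..j. real i / (real i + \<kappa>))"

lemma beta_ratio_pos: "0 \<le> \<kappa> \<Longrightarrow> 0 < beta_ratio \<kappa> j"
  unfolding beta_ratio_def by (intro prod_pos) auto

lemma beta_ratio_Suc: "beta_ratio \<kappa> (Suc j) = beta_ratio \<kappa> j * (real (Suc j) / (real (Suc j) + \<kappa>))"
  by (simp add: beta_ratio_def)

lemma beta_ratio_0 [simp]: "beta_ratio \<kappa> 0 = 1"
  by (simp add: beta_ratio_def)

definition extension_primes :: "nat \<Rightarrow> real \<Rightarrow> nat set \<Rightarrow> nat set" where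
  "extension_primes D x C = {p. (prime p \<and> D < p) \<and> real p \<le> x / modulus C}"

lemma finite_extension_primes [simp]: "finite (extension_primes D x C)"
  unfolding extension_primes_def by (rule finite_nat_le_real)

lemma extension_primesD:
  assumes "p \<in> extension_primes D x C"
  shows "prime p" "D < p" "real p \<le> x / modulus C" "1 < real p" "1 \<le> x / modulus C / real p"
proof -
  show p: "prime p" "D < p" "real p \<le> x / modulus C" using assms by (auto simp: extension_primes_def)
  then show "1 < real p" using prime_gt_1_nat[of p] by simp
  then show "1 \<le> x / modulus C / real p" using p(3) by (subst pos_le_divide_eq) auto
qed

lemma ln_quotient_insert:
  assumes "C \<in> rough_moduli D x" "p \<in> extension_primes D x C - C"
  shows "ln (x / modulus (insert p C)) = ln (x / modulus C / real p)"
  using assms rough_moduliD(1)[OF assms(1)] by (simp add: mult.commute)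

lemma ln_quotient_div_le:
  assumes "p \<in> extension_primes D x C"
  shows "ln (x / modulus C / real p) ^ j \<le> ln (x / modulus C) ^ j"
proof -
  note p = extension_primesD[OF assms]
  have "x / modulus C / real p \<le> x / modulus C"
    using frac_le[of "x / modulus C" "x / modulus C" 1 "real p"] p by simp
  then show ?thesis using p by (intro power_mono) (auto simp: ln_ge_zero)
qed

lemma sum_rough_moduli_elements:
  fixes f :: "nat set \<Rightarrow> nat \<Rightarrow> real"
  shows "(\<Sum>C\<in>rough_moduli D x. \<Sum>p\<in>C. f C p)
    = (\<Sum>C\<in>rough_moduli D x. \<Sum>p\<in>extension_primes D x C - C. f (insert p C) p)"
proof -
  let ?Q = "\<lambda>C. extension_primes D x C - C"
  have extension: "insert p C \<in> rough_moduli D x \<longleftrightarrow> real p \<le> x / modulus C"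
    if "C \<in> rough_moduli D x" "prime p" "D < p" "p \<notin> C" for p C
    using insert_in_rough_moduli_iff[OF that] rough_modulus_pos[OF that(1)] by (simp add: field_simps)
  have "(\<Sum>C\<in>rough_moduli D x. \<Sum>p\<in>C. f C p) = (\<Sum>(C, p)\<in>Sigma (rough_moduli D x) (\<lambda>C. C). f C p)"
    by (subst sum.Sigma) (auto dest: rough_moduliD)
  also have "\<dots> = (\<Sum>(C, p)\<in>Sigma (rough_moduli D x) ?Q. f (insert p C) p)"
  proof (rule sum.reindex_bij_witness[where i = "\<lambda>(C, p). (insert p C, p)" and j = "\<lambda>(C, p). (C - {p}, p)"],
      goal_cases left_inverse maps_to right_inverse maps_back summand)
    case (maps_to a)
    then obtain C p where a: "a = (C, p)" "C \<in> rough_moduli D x" "p \<in> C" by auto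
    have "C - {p} \<in> rough_moduli D x" by (rule rough_moduli_subset[OF a(2)]) auto
    then show ?case
      using a extension[of "C - {p}" p] rough_moduliD[OF a(2)] by (auto simp: extension_primes_def insert_absorb)
  next
    case (maps_back b)
    then show ?case using extension by (auto simp: extension_primes_def)
  qed (auto simp: insert_absorb)
  also have "\<dots> = (\<Sum>C\<in>rough_moduli D x. \<Sum>p\<in>?Q C. f (insert p C) p)"
    by (subst sum.Sigma) auto
  finally show ?thesis .
qed

lemma log_quotient_power_antimono:
  fixes y :: real
  assumes "1 \<le> i" "i \<le> n" "real n \<le> y"
  shows "ln (y / real n) ^ j \<le> ln (y / real i) ^ j"
proof (rule power_mono)
  have "1 \<le> y / real n" using assms by (subst pos_le_divide_eq) auto
  moreover have "y / real n \<le> y / real i" using assms by (intro divide_left_mono) auto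
  ultimately show "0 \<le> ln (y / real n)" "ln (y / real n) \<le> ln (y / real i)"
    by (auto intro: ln_ge_zero ln_mono)
qed

lemma sum_rough_primes_eq:
  "(\<Sum>p | (prime p \<and> D < p) \<and> real p \<le> y. f p)
    = (\<Sum>n | 1 \<le> n \<and> real n \<le> y. if prime n \<and> D < n then f n else 0)"
proof -
  have "{p. (prime p \<and> D < p) \<and> real p \<le> y} = {n \<in> {n. 1 \<le> n \<and> real n \<le> y}. prime n \<and> D < n}"
    using prime_ge_1_nat by auto
  then show ?thesis by (simp only:) (rule sum.inter_filter, simp)
qed

locale sieve_density =
  fixes D :: nat and g :: "nat \<Rightarrow> real" and \<kappa> E Z :: real
  assumes density_nonneg: "\<And>p. prime p \<Longrightarrow> D < p \<Longrightarrow> 0 \<le> g p"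
    and dimension_nonneg: "0 \<le> \<kappa>"
    and dimension: "\<And>m. \<bar>\<Sum>n=1..m. (if prime n \<and> D < n then g n * ln (real n) else 0) - \<kappa> / real n\<bar> \<le> E"
    and square_sum: "\<And>A. finite A \<Longrightarrow> (\<And>p. p \<in> A \<Longrightarrow> prime p \<and> D < p) \<Longrightarrow> (\<Sum>p\<in>A. (g p)\<^sup>2 * ln (real p)) \<le> Z"
begin

lemma prod_density_nonneg: "C \<in> rough_moduli D x \<Longrightarrow> 0 \<le> (\<Prod>p\<in>C. g p)"
  by (rule prod_rough_nonneg) (use density_nonneg in auto)

lemma moment_0_ge_1: "1 \<le> x \<Longrightarrow> 1 \<le> sieve_moment D g 0 x"
  by (rule sieve_moment_0_ge_1) (use density_nonneg in auto)

lemma sum_density_log_power: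
  assumes y: "1 \<le> y"
  shows "\<bar>(\<Sum>p | (prime p \<and> D < p) \<and> real p \<le> y. g p * ln (real p) * ln (y / real p) ^ j)
       - \<kappa> * ln y ^ (j + 1) / real (j + 1)\<bar> \<le> (E + \<kappa>) * ln y ^ j"
proof -
  define a where "a n = (if prime n \<and> D < n then g n * ln (real n) else 0)" for n
  define e where "e n = a n - \<kappa> / real n" for n
  define F where "F n = ln (y / real n) ^ j" for n
  define m where "m = nat \<lfloor>y\<rfloor>"
  have m: "1 \<le> m" "real m \<le> y" unfolding m_def using y by (auto simp: le_nat_floor)
  have range: "{n. 1 \<le> n \<and> real n \<le> y} = {1..m}" unfolding m_def using y by (auto simp: le_nat_floor) linarith
  have "\<bar>\<Sum>n=1..m. e n * F n\<bar> \<le> E * F 1"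
  proof (rule abel_summation_bound)
    show "\<bar>\<Sum>n=1..i. e n\<bar> \<le> E" for i using dimension[of i] by (simp add: e_def a_def)
    show "F (Suc i) \<le> F i" if "1 \<le> i" "i < m" for i
      unfolding F_def using that m by (intro log_quotient_power_antimono) auto
    have "1 \<le> y / real m" using m by (subst pos_le_divide_eq) auto
    then show "0 \<le> F m" by (simp add: F_def)
  qed (rule m(1))
  moreover have "(\<Sum>n=1..m. e n * F n) = (\<Sum>n=1..m. a n * F n) - \<kappa> * (\<Sum>n=1..m. F n / real n)"
    by (simp add: e_def algebra_simps sum_subtractf sum_distrib_left)
  moreover have "\<bar>\<kappa> * (\<Sum>n=1..m. F n / real n) - \<kappa> * ln y ^ (j + 1) / real (j + 1)\<bar> \<le> \<kappa> * ln y ^ j"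
  proof -
    have "\<bar>(\<Sum>n=1..m. F n / real n) - ln y ^ (j + 1) / real (j + 1)\<bar> \<le> ln y ^ j"
      using log_power_sum_bounds[OF y, of j] unfolding range F_def by linarith
    from mult_left_mono[OF this dimension_nonneg] show ?thesis
      using dimension_nonneg abs_mult[of \<kappa> "(\<Sum>n=1..m. F n / real n) - ln y ^ (j + 1) / real (j + 1)"]
      by (simp add: right_diff_distrib)
  qed
  moreover have "(\<Sum>n=1..m. a n * F n) = (\<Sum>p | (prime p \<and> D < p) \<and> real p \<le> y. g p * ln (real p) * F p)"
    unfolding sum_rough_primes_eq range by (intro sum.cong) (auto simp: a_def)
  ultimately show ?thesis by (simp add: F_def distrib_right)
qed

lemma sum_density_div_le:
  assumes "1 \<le> y"
  shows "(\<Sum>p | (prime p \<and> D < p) \<and> real p \<le> y. g p * ln (real p)) \<le> \<kappa> * ln y + (E + \<kappa>)"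
  using sum_density_log_power[OF assms, of 0] by simp

text \<open>Splitting \<open>ln (modulus C)\<close> over the primes of C and removing one of them leads back to sums over moduli;
  the primes that would then divide twice are negligible.\<close>

lemma log_modulus_moment:
  assumes x: "1 \<le> x"
  shows "ln x * sieve_moment D g j x - sieve_moment D g (j + 1) x
    = (\<Sum>C\<in>rough_moduli D x. (\<Prod>p\<in>C. g p) *
        (\<Sum>p\<in>extension_primes D x C - C. g p * ln (real p) * ln (x / modulus C / real p) ^ j))"
proof -
  let ?w = "\<lambda>C. \<Prod>p\<in>C. g p" and ?L = "\<lambda>C. ln (x / modulus C)"
  have ln_modulus: "ln (real (modulus C)) = (\<Sum>p\<in>C. ln (real p))" if "C \<in> rough_moduli D x" for C
  proof -
    have "ln (\<Prod>p\<in>C. real p) = (\<Sum>p\<in>C. ln (real p))"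
      using rough_moduliD[OF that] prime_gt_0_nat by (intro ln_prod) auto
    then show ?thesis by (simp add: modulus_def)
  qed
  have "ln x * sieve_moment D g j x - sieve_moment D g (j + 1) x
      = (\<Sum>C\<in>rough_moduli D x. ?w C * (ln x - ?L C) * ?L C ^ j)"
    unfolding sieve_moment_def sum_distrib_left sum_subtractf[symmetric]
    by (intro sum.cong refl) (simp add: algebra_simps)
  also have "\<dots> = (\<Sum>C\<in>rough_moduli D x. \<Sum>p\<in>C. ?w C * ln (real p) * ?L C ^ j)"
  proof (intro sum.cong refl)
    fix C assume C: "C \<in> rough_moduli D x"
    have "ln x - ?L C = (\<Sum>p\<in>C. ln (real p))"
      using x rough_modulus_ge_1[OF C] ln_modulus[OF C] by (simp add: ln_div)
    then show "?w C * (ln x - ?L C) * ?L C ^ j = (\<Sum>p\<in>C. ?w C * ln (real p) * ?L C ^ j)"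
      by (simp add: sum_distrib_left sum_distrib_right)
  qed
  also have "\<dots> = (\<Sum>C\<in>rough_moduli D x. \<Sum>p\<in>extension_primes D x C - C.
      ?w (insert p C) * ln (real p) * ?L (insert p C) ^ j)"
    by (rule sum_rough_moduli_elements)
  also have "\<dots> = (\<Sum>C\<in>rough_moduli D x. ?w C *
      (\<Sum>p\<in>extension_primes D x C - C. g p * ln (real p) * ln (x / modulus C / real p) ^ j))"
    unfolding sum_distrib_left
    by (intro sum.cong refl, subst ln_quotient_insert) (auto dest: rough_moduliD)
  finally show ?thesis .
qed

lemma extension_prime_sum_moment:
  "\<bar>(\<Sum>C\<in>rough_moduli D x. (\<Prod>p\<in>C. g p) *
        (\<Sum>p\<in>extension_primes D x C. g p * ln (real p) * ln (x / modulus C / real p) ^ j))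
      - \<kappa> / real (j + 1) * sieve_moment D g (j + 1) x\<bar> \<le> (E + \<kappa>) * sieve_moment D g j x"
proof -
  let ?w = "\<lambda>C. \<Prod>p\<in>C. g p" and ?L = "\<lambda>C. ln (x / modulus C)"
  define V where "V C = (\<Sum>p\<in>extension_primes D x C. g p * ln (real p) * ln (x / modulus C / real p) ^ j)" for C
  have "\<bar>(\<Sum>C\<in>rough_moduli D x. ?w C * V C) - \<kappa> / real (j + 1) * sieve_moment D g (j + 1) x\<bar>
      = \<bar>\<Sum>C\<in>rough_moduli D x. ?w C * (V C - \<kappa> * ?L C ^ (j + 1) / real (j + 1))\<bar>"
    unfolding sieve_moment_def sum_distrib_left sum_subtractf[symmetric]
    by (intro arg_cong[of _ _ abs] sum.cong refl) (simp add: algebra_simps)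
  also have "\<dots> \<le> (\<Sum>C\<in>rough_moduli D x. ?w C * ((E + \<kappa>) * ?L C ^ j))"
  proof (intro order_trans[OF sum_abs] sum_mono)
    fix C assume C: "C \<in> rough_moduli D x"
    have "\<bar>V C - \<kappa> * ?L C ^ (j + 1) / real (j + 1)\<bar> \<le> (E + \<kappa>) * ?L C ^ j"
      unfolding V_def extension_primes_def by (rule sum_density_log_power[OF rough_moduli_quotient_ge_1[OF C]])
    then show "\<bar>?w C * (V C - \<kappa> * ?L C ^ (j + 1) / real (j + 1))\<bar> \<le> ?w C * ((E + \<kappa>) * ?L C ^ j)"
      using prod_density_nonneg[OF C] unfolding abs_mult by (simp add: mult_left_mono)
  qed
  also have "\<dots> = (E + \<kappa>) * sieve_moment D g j x"
    unfolding sieve_moment_def by (simp add: sum_distrib_left mult_ac)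
  finally show ?thesis unfolding V_def .
qed

lemma density_ln_nonneg: "prime p \<Longrightarrow> D < p \<Longrightarrow> 0 \<le> g p * ln (real p)"
  using density_nonneg[of p] prime_gt_0_nat[of p] by (auto simp: Suc_le_eq)

lemma sum_repeated_primes_le:
  assumes C: "C \<in> rough_moduli D x"
  shows "(\<Sum>p\<in>extension_primes D x C \<inter> C. g p * ln (real p) * ln (x / modulus C / real p) ^ j)
    \<le> ln (x / modulus C) ^ j * (\<Sum>p\<in>C. g p * ln (real p))"
proof -
  let ?Q = "extension_primes D x C"
  have "(\<Sum>p\<in>?Q \<inter> C. g p * ln (real p) * ln (x / modulus C / real p) ^ j)
      \<le> (\<Sum>p\<in>?Q \<inter> C. g p * ln (real p) * ln (x / modulus C) ^ j)"
    by (intro sum_mono mult_left_mono density_ln_nonneg ln_quotient_div_le) (auto dest: extension_primesD)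
  also have "\<dots> \<le> (\<Sum>p\<in>C. g p * ln (real p) * ln (x / modulus C) ^ j)"
    using rough_moduliD[OF C] rough_moduli_quotient_ge_1[OF C]
    by (intro sum_mono2 mult_nonneg_nonneg[OF density_ln_nonneg]) auto
  finally show ?thesis by (simp add: sum_distrib_left mult_ac)
qed

lemma repeated_prime_sum_le:
  "(\<Sum>C\<in>rough_moduli D x. (\<Prod>p\<in>C. g p) *
      (\<Sum>p\<in>extension_primes D x C \<inter> C. g p * ln (real p) * ln (x / modulus C / real p) ^ j))
    \<le> Z * sieve_moment D g j x"
proof -
  let ?w = "\<lambda>C. \<Prod>p\<in>C. g p" and ?L = "\<lambda>C. ln (x / modulus C)" and ?Q = "extension_primes D x"
  have wL: "0 \<le> ?w C * ?L C ^ j" if "C \<in> rough_moduli D x" for C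
    using prod_density_nonneg[OF that] rough_moduli_quotient_ge_1[OF that] by simp
  have "(\<Sum>C\<in>rough_moduli D x. ?w C * (\<Sum>p\<in>?Q C \<inter> C. g p * ln (real p) * ln (x / modulus C / real p) ^ j))
      \<le> (\<Sum>C\<in>rough_moduli D x. \<Sum>p\<in>C. ?w C * ?L C ^ j * (g p * ln (real p)))"
    unfolding sum_distrib_left[symmetric]
    by (intro sum_mono) (use mult_left_mono[OF sum_repeated_primes_le prod_density_nonneg] in \<open>simp only: mult.assoc\<close>)
  also have "\<dots> = (\<Sum>C\<in>rough_moduli D x. \<Sum>p\<in>?Q C - C. ?w (insert p C) * ?L (insert p C) ^ j * (g p * ln (real p)))"
    by (rule sum_rough_moduli_elements)
  also have "\<dots> \<le> (\<Sum>C\<in>rough_moduli D x. \<Sum>p\<in>?Q C - C. ?w C * ?L C ^ j * ((g p)\<^sup>2 * ln (real p)))"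
  proof (intro sum_mono)
    fix C p assume C: "C \<in> rough_moduli D x" and p: "p \<in> ?Q C - C"
    then have "0 \<le> (g p)\<^sup>2 * ln (real p)" using extension_primesD(4)[of p D x C] by auto
    moreover have "?L (insert p C) ^ j \<le> ?L C ^ j"
      unfolding ln_quotient_insert[OF C p] using p by (intro ln_quotient_div_le) auto
    ultimately have "?w C * ((g p)\<^sup>2 * ln (real p)) * ?L (insert p C) ^ j \<le> ?w C * ((g p)\<^sup>2 * ln (real p)) * ?L C ^ j"
      using prod_density_nonneg[OF C]
      by (intro mult_left_mono mult_nonneg_nonneg[of "?w C" "(g p)\<^sup>2 * ln (real p)"])
    then show "?w (insert p C) * ?L (insert p C) ^ j * (g p * ln (real p)) \<le> ?w C * ?L C ^ j * ((g p)\<^sup>2 * ln (real p))"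
      using p rough_moduliD(1)[OF C] by (simp add: power2_eq_square mult_ac)
  qed
  also have "\<dots> \<le> (\<Sum>C\<in>rough_moduli D x. ?w C * ?L C ^ j * Z)"
    unfolding sum_distrib_left[symmetric] using wL
    by (intro sum_mono mult_left_mono square_sum) (auto dest: extension_primesD)
  also have "\<dots> = Z * sieve_moment D g j x"
    unfolding sieve_moment_def by (simp add: sum_distrib_left mult_ac)
  finally show ?thesis .
qed

lemma moment_recurrence:
  assumes x: "1 \<le> x"
  shows "\<bar>ln x * sieve_moment D g j x - (1 + \<kappa> / real (j + 1)) * sieve_moment D g (j + 1) x\<bar>
    \<le> (E + \<kappa> + Z) * sieve_moment D g j x"
proof -
  let ?w = "\<lambda>C. \<Prod>p\<in>C. g p" and ?Q = "extension_primes D x"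
  let ?f = "\<lambda>C p. g p * ln (real p) * ln (x / modulus C / real p) ^ j"
  let ?V = "\<Sum>C\<in>rough_moduli D x. ?w C * (\<Sum>p\<in>?Q C. ?f C p)"
  let ?Y = "\<Sum>C\<in>rough_moduli D x. ?w C * (\<Sum>p\<in>?Q C \<inter> C. ?f C p)"
  have "(\<Sum>p\<in>?Q C - C. ?f C p) = (\<Sum>p\<in>?Q C. ?f C p) - (\<Sum>p\<in>?Q C \<inter> C. ?f C p)" for C
    using sum.Int_Diff[OF finite_extension_primes, of "?f C" D x C C] by linarith
  then have "ln x * sieve_moment D g j x - sieve_moment D g (j + 1) x = ?V - ?Y"
    unfolding log_modulus_moment[OF x] by (simp add: right_diff_distrib sum_subtractf)
  moreover have "0 \<le> ?Y"
  proof (intro sum_nonneg mult_nonneg_nonneg prod_density_nonneg)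
    fix C p assume "p \<in> ?Q C \<inter> C"
    then show "0 \<le> g p" "0 \<le> ln (real p)" "0 \<le> ln (x / modulus C / real p) ^ j"
      using extension_primesD[of p D x C] density_nonneg by auto
  qed
  ultimately show ?thesis
    using extension_prime_sum_moment[of x j] repeated_prime_sum_le[of x j]
    by (simp add: distrib_right)
qed

theorem moment_ratio_limit:
  "((\<lambda>x. sieve_moment D g j x / (sieve_moment D g 0 x * ln x ^ j)) \<longlongrightarrow> beta_ratio \<kappa> j) at_top"
proof (induction j)
  case 0
  have "\<forall>\<^sub>F x in at_top. sieve_moment D g 0 x / (sieve_moment D g 0 x * ln x ^ 0) = 1"
    using eventually_ge_at_top[of 1] by eventually_elim (use moment_0_ge_1 in force)
  then show ?case by (simp add: tendsto_eventually)
next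
  case (Suc j)
  define r where "r i x = sieve_moment D g i x / (sieve_moment D g 0 x * ln x ^ i)" for i x
  define s where "s = 1 + \<kappa> / real (j + 1)"
  define K where "K = E + \<kappa> + Z"
  have s_pos: "0 < s" unfolding s_def using dimension_nonneg by (intro add_pos_nonneg) auto
  have r_limit: "(r j \<longlongrightarrow> beta_ratio \<kappa> j) at_top" using Suc unfolding r_def .
  have r_difference_le: "\<forall>\<^sub>F x in at_top. norm (r j x - s * r (j + 1) x) \<le> K * r j x / ln x"
    using eventually_gt_at_top[of 1]
  proof eventually_elim
    case (elim x)
    let ?d = "sieve_moment D g 0 x * ln x ^ (j + 1)"
    have pos: "0 < ln x" "0 < ?d" using elim moment_0_ge_1[of x] by auto
    have r_expand: "r j x = ln x * sieve_moment D g j x / ?d" using pos unfolding r_def by simp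
    have "r j x - s * r (j + 1) x = (ln x * sieve_moment D g j x - s * sieve_moment D g (j + 1) x) / ?d"
      unfolding r_expand by (simp add: r_def diff_divide_distrib)
    then have "\<bar>r j x - s * r (j + 1) x\<bar> = \<bar>ln x * sieve_moment D g j x - s * sieve_moment D g (j + 1) x\<bar> / ?d"
      using pos by (simp add: abs_divide)
    also have "\<dots> \<le> K * sieve_moment D g j x / ?d"
      unfolding s_def K_def using elim pos by (intro divide_right_mono moment_recurrence) auto
    also have "\<dots> = K * r j x / ln x" using pos unfolding r_def by simp
    finally show ?case by simp
  qed
  have "((\<lambda>x. K * r j x * inverse (ln x)) \<longlongrightarrow> K * beta_ratio \<kappa> j * 0) at_top"
    by (intro tendsto_mult tendsto_const r_limit tendsto_inverse_0_at_top ln_at_top)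
  then have "((\<lambda>x. K * r j x / ln x) \<longlongrightarrow> 0) at_top" by (simp add: divide_inverse)
  from Lim_null_comparison[OF r_difference_le this] have "((\<lambda>x. r j x - s * r (j + 1) x) \<longlongrightarrow> 0) at_top" .
  from tendsto_diff[OF r_limit this] have "((\<lambda>x. s * r (j + 1) x) \<longlongrightarrow> beta_ratio \<kappa> j) at_top" by simp
  from tendsto_divide[OF this tendsto_const, of s]
  have "((\<lambda>x. r (j + 1) x) \<longlongrightarrow> beta_ratio \<kappa> j / s) at_top" using s_pos by simp
  moreover have "beta_ratio \<kappa> j / s = beta_ratio \<kappa> (Suc j)"
    unfolding s_def beta_ratio_Suc using dimension_nonneg by (simp add: field_simps)
  ultimately show ?case unfolding r_def by simp
qed

end

lemma ln_density_deviation_le: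
  fixes \<kappa> :: real
  assumes D: "2 * k \<le> D" and \<kappa>: "0 \<le> \<kappa>" and n: "1 \<le> n"
  shows "\<bar>(if prime n \<and> D < n then \<kappa> / (real n - real k) * ln (real n) else 0) - \<kappa> * (ln_prime n / real n)\<bar>
    \<le> \<kappa> * (2 * k + D) * (ln (real n) / real n ^ 2)"
proof -
  have ln_nonneg: "0 \<le> ln (real n)" using n by simp
  consider (not_prime) "\<not> prime n" | (small) "prime n" "n \<le> D" | (large) "prime n" "D < n" by linarith
  then show ?thesis
  proof cases
    case not_prime
    then show ?thesis using ln_nonneg \<kappa> by (simp add: ln_prime_def)
  next
    case small
    then have "\<bar>(if prime n \<and> D < n then \<kappa> / (real n - real k) * ln (real n) else 0) - \<kappa> * (ln_prime n / real n)\<bar>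
        = \<kappa> * real n * (ln (real n) / real n ^ 2)"
      using n ln_nonneg \<kappa> by (simp add: ln_prime_def power2_eq_square field_simps abs_mult)
    also have "\<dots> \<le> \<kappa> * (2 * k + D) * (ln (real n) / real n ^ 2)"
      using small ln_nonneg \<kappa> by (intro mult_right_mono mult_left_mono) auto
    finally show ?thesis .
  next
    case large
    then have n_minus_k: "real n \<le> 2 * (real n - real k)" "0 < real n - real k" using D by auto
    have "1 / (real n - real k) - 1 / real n = real k / ((real n - real k) * real n)"
      using n_minus_k n by (simp add: field_simps)
    also have "\<dots> \<le> 2 * real k / real n ^ 2"
      using n_minus_k n mult_right_mono[OF n_minus_k(1), of "real k * real n"] by (simp add: field_simps power2_eq_square)
    also have "\<dots> \<le> (2 * k + D) / real n ^ 2" by (intro divide_right_mono) auto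
    finally have upper: "1 / (real n - real k) - 1 / real n \<le> (2 * k + D) / real n ^ 2" .
    have lower: "0 \<le> 1 / (real n - real k) - 1 / real n" using n_minus_k by (simp add: frac_le)
    have "\<bar>(if prime n \<and> D < n then \<kappa> / (real n - real k) * ln (real n) else 0) - \<kappa> * (ln_prime n / real n)\<bar>
        = \<bar>\<kappa> * ln (real n) * (1 / (real n - real k) - 1 / real n)\<bar>"
      using large by (simp add: ln_prime_def algebra_simps)
    also have "\<dots> = \<kappa> * ln (real n) * (1 / (real n - real k) - 1 / real n)"
      using \<kappa> ln_nonneg lower by simp
    also have "\<dots> \<le> \<kappa> * ln (real n) * ((2 * k + D) / real n ^ 2)"
      using \<kappa> ln_nonneg upper by (intro mult_left_mono) auto
    finally show ?thesis by (simp add: mult_ac)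
  qed
qed

lemma shifted_density_dimension:
  fixes \<kappa> Z :: real
  assumes mertens: "mertens_bound E" and D: "2 * k \<le> D" and \<kappa>: "0 \<le> \<kappa>"
    and Z: "(\<Sum>n=1..m. ln (real n) / real n ^ 2) \<le> Z"
  shows "\<bar>\<Sum>n=1..m. (if prime n \<and> D < n then \<kappa> / (real n - real k) * ln (real n) else 0) - \<kappa> / real n\<bar>
    \<le> \<kappa> * E + \<kappa> * (2 * k + D) * Z"
proof -
  define a where "a n = (if prime n \<and> D < n then \<kappa> / (real n - real k) * ln (real n) else 0)" for n
  have deviation: "\<bar>a n - \<kappa> * (ln_prime n / real n)\<bar> \<le> \<kappa> * (2 * k + D) * (ln (real n) / real n ^ 2)"
    if "1 \<le> n" for n
    unfolding a_def by (rule ln_density_deviation_le[OF D \<kappa> that])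
  have "(\<Sum>n=1..m. a n - \<kappa> / real n)
      = \<kappa> * (\<Sum>n=1..m. ln_prime n / real n - 1 / real n) + (\<Sum>n=1..m. a n - \<kappa> * (ln_prime n / real n))"
    by (simp add: sum_subtractf sum_distrib_left right_diff_distrib)
  also have "\<bar>\<dots>\<bar> \<le> \<kappa> * \<bar>\<Sum>n=1..m. ln_prime n / real n - 1 / real n\<bar>
      + (\<Sum>n=1..m. \<bar>a n - \<kappa> * (ln_prime n / real n)\<bar>)"
    using \<kappa> by (intro order_trans[OF abs_triangle_ineq] add_mono sum_abs) (simp add: abs_mult)
  also have "\<dots> \<le> \<kappa> * E + (\<Sum>n=1..m. \<kappa> * (2 * k + D) * (ln (real n) / real n ^ 2))"
    using mertens \<kappa> unfolding mertens_bound_def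
    by (intro add_mono mult_left_mono sum_mono deviation) auto
  also have "\<dots> \<le> \<kappa> * E + \<kappa> * (2 * k + D) * Z"
    unfolding sum_distrib_left[symmetric] using Z \<kappa> by (intro add_mono mult_left_mono) auto
  finally show ?thesis by (simp only: a_def)
qed

lemma shifted_density_square_sum_le:
  fixes \<kappa> :: real
  assumes D: "2 * k \<le> D" and \<kappa>: "0 \<le> \<kappa>" and A: "\<And>p. p \<in> A \<Longrightarrow> D < p"
  shows "(\<Sum>p\<in>A. (\<kappa> / (real p - real k))\<^sup>2 * ln (real p)) \<le> 4 * \<kappa>\<^sup>2 * (\<Sum>p\<in>A. ln (real p) / real p ^ 2)"
proof -
  have "(\<Sum>p\<in>A. (\<kappa> / (real p - real k))\<^sup>2 * ln (real p)) \<le> (\<Sum>p\<in>A. (2 * \<kappa> / real p)\<^sup>2 * ln (real p))"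
  proof (intro sum_mono mult_right_mono power_mono)
    fix p assume "p \<in> A"
    then have p: "1 \<le> real p" "0 < real p - real k" "real p \<le> 2 * (real p - real k)"
      using A[of p] D by auto
    then show "\<kappa> / (real p - real k) \<le> 2 * \<kappa> / real p"
      using mult_right_mono[OF p(3) \<kappa>] by (simp add: field_simps)
    show "0 \<le> \<kappa> / (real p - real k)" "0 \<le> ln (real p)" using \<kappa> p by auto
  qed
  also have "\<dots> = 4 * \<kappa>\<^sup>2 * (\<Sum>p\<in>A. ln (real p) / real p ^ 2)"
    by (simp add: sum_distrib_left power_divide power_mult_distrib)
  finally show ?thesis .
qed

lemma sieve_density_shift:
  fixes \<kappa> :: real
  assumes mertens: "mertens_bound E" and D: "2 * k \<le> D" and \<kappa>: "0 \<le> \<kappa>"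
  obtains E' Z where "sieve_density D (\<lambda>p. \<kappa> / (real p - real k)) \<kappa> E' Z"
proof -
  obtain Z where Z: "0 \<le> Z" "\<And>A::nat set. finite A \<Longrightarrow> (\<Sum>n\<in>A. ln (real n) / real n ^ 2) \<le> Z"
    using sum_ln_div_square_bounded by blast
  have "sieve_density D (\<lambda>p. \<kappa> / (real p - real k)) \<kappa> (\<kappa> * E + \<kappa> * (2 * k + D) * Z) (4 * \<kappa>\<^sup>2 * Z)"
  proof
    show "0 \<le> \<kappa> / (real p - real k)" if "D < p" for p using \<kappa> D that by simp
    show "\<bar>\<Sum>n=1..m. (if prime n \<and> D < n then \<kappa> / (real n - real k) * ln (real n) else 0) - \<kappa> / real n\<bar>
        \<le> \<kappa> * E + \<kappa> * (2 * k + D) * Z" for m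
      by (intro shifted_density_dimension mertens D \<kappa> Z) simp
    fix A assume A: "finite A" "\<And>p. p \<in> A \<Longrightarrow> prime p \<and> D < p"
    have "(\<Sum>p\<in>A. (\<kappa> / (real p - real k))\<^sup>2 * ln (real p)) \<le> 4 * \<kappa>\<^sup>2 * (\<Sum>p\<in>A. ln (real p) / real p ^ 2)"
      using A by (intro shifted_density_square_sum_le[OF D \<kappa>]) auto
    also have "\<dots> \<le> 4 * \<kappa>\<^sup>2 * Z" using Z(2)[OF A(1)] by (intro mult_left_mono) auto
    finally show "(\<Sum>p\<in>A. (\<kappa> / (real p - real k))\<^sup>2 * ln (real p)) \<le> 4 * \<kappa>\<^sup>2 * Z" .
  qed (rule \<kappa>)
  then show ?thesis by (rule that)
qed

section \<open>Residue classes\<close>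

lemma card_residues_coprime:
  fixes m n :: nat
  assumes coprime: "coprime m n" and X: "X \<subseteq> {..<m}" and Y: "Y \<subseteq> {..<n}" and m: "0 < m" and n: "0 < n"
  shows "card {a. a < m * n \<and> a mod m \<in> X \<and> a mod n \<in> Y} = card X * card Y"
proof -
  let ?A = "{a. a < m * n \<and> a mod m \<in> X \<and> a mod n \<in> Y}"
  have "bij_betw (\<lambda>a. (a mod m, a mod n)) ?A (X \<times> Y)"
  proof (rule bij_betwI')
    fix a b assume a: "a \<in> ?A" and b: "b \<in> ?A"
    show "((a mod m, a mod n) = (b mod m, b mod n)) = (a = b)"
    proof
      assume "(a mod m, a mod n) = (b mod m, b mod n)"
      then have "[a = b] (mod m)" "[a = b] (mod n)" by (auto simp: cong_def)
      then have "[a = b] (mod m * n)" using coprime by (intro coprime_cong_mult_nat)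
      then show "a = b" using a b by (auto simp: cong_def)
    qed auto
  next
    fix y assume "y \<in> X \<times> Y"
    then obtain u v where y: "y = (u, v)" "u \<in> X" "v \<in> Y" by auto
    obtain a where a: "a < m * n" "[a = u] (mod m)" "[a = v] (mod n)"
      using binary_chinese_remainder_unique_nat[OF coprime, of u v] m n by auto
    have "u < m" "v < n" using y X Y by auto
    then have "a mod m = u" "a mod n = v" using a by (auto simp: cong_def)
    then show "\<exists>a\<in>?A. y = (a mod m, a mod n)" using y a by auto
  qed auto
  from bij_betw_same_card[OF this] show ?thesis by (simp add: card_cartesian_product)
qed

definition res_classes :: "nat \<Rightarrow> nat \<Rightarrow> (nat \<Rightarrow> nat set) \<Rightarrow> nat set \<Rightarrow> nat set" where
  "res_classes W v S C = {a. a < W * modulus C \<and> a mod W = v \<and> (\<forall>p\<in>C. a mod p \<in> S p)}"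

lemma res_classes_insert:
  assumes "finite C" "\<And>p. p \<in> C \<Longrightarrow> prime p" "0 < W" "q \<notin> C"
  shows "res_classes W v S (insert q C)
    = {a. a < W * modulus C * q \<and> a mod (W * modulus C) \<in> res_classes W v S C \<and> a mod q \<in> S q}"
proof -
  have "0 < W * modulus C" using assms modulus_pos[of C] by simp
  then have "a mod (W * modulus C) < W * modulus C" for a by (rule mod_less_divisor)
  moreover have "a mod (W * modulus C) mod W = a mod W" for a by (simp add: mod_mod_cancel)
  moreover have "a mod (W * modulus C) mod p = a mod p" if "p \<in> C" for a p
    using dvd_modulus[OF assms(1) that] by (intro mod_mod_cancel) auto
  ultimately show ?thesis unfolding res_classes_def using assms by (auto simp: mult_ac)
qed

lemma card_res_classes:
  assumes "finite C" "\<And>p. p \<in> C \<Longrightarrow> prime p" "\<And>p. p \<in> C \<Longrightarrow> \<not> p dvd W" "v < W"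
    "\<And>p. p \<in> C \<Longrightarrow> S p \<subseteq> {..<p}"
  shows "card (res_classes W v S C) = (\<Prod>p\<in>C. card (S p))"
  using assms
proof (induction C rule: finite_induct)
  case empty
  then have "res_classes W v S {} = {v}" by (auto simp: res_classes_def)
  then show ?case by simp
next
  case (insert q C)
  have q: "prime q" "\<not> q dvd W" using insert.prems by auto
  have "coprime q W" using q by (rule prime_imp_coprime)
  moreover have "coprime q (modulus C)"
    using insert q by (auto simp: coprime_modulus_iff intro!: primes_coprime)
  ultimately have coprime: "coprime (W * modulus C) q" by (simp add: coprime_commute)
  have "card (res_classes W v S (insert q C)) = card (res_classes W v S C) * card (S q)"
  proof (subst res_classes_insert)
    show "card {a. a < W * modulus C * q \<and> a mod (W * modulus C) \<in> res_classes W v S C \<and> a mod q \<in> S q}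
        = card (res_classes W v S C) * card (S q)"
      using insert.prems prime_gt_0_nat[OF q(1)] modulus_pos[of C]
      by (intro card_residues_coprime[OF coprime]) (auto simp: res_classes_def)
  qed (use insert in auto)
  also have "\<dots> = (\<Prod>p\<in>insert q C. card (S p))" using insert by simp
  finally show ?case .
qed

lemma sum_over_res_classes:
  fixes F :: "nat \<Rightarrow> real"
  assumes "finite X" "finite C" "0 < W" "\<And>p. p \<in> C \<Longrightarrow> prime p"
  shows "(\<Sum>n | n \<in> X \<and> n mod W = v \<and> (\<forall>p\<in>C. n mod p \<in> S p). F n)
    = (\<Sum>a\<in>res_classes W v S C. \<Sum>n | n \<in> X \<and> n mod (W * modulus C) = a. F n)"
proof -
  let ?q = "W * modulus C" and ?Y = "{n. n \<in> X \<and> n mod W = v \<and> (\<forall>p\<in>C. n mod p \<in> S p)}"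
  have "0 < ?q" using assms modulus_pos[of C] by simp
  moreover have "p dvd ?q" if "p \<in> C" for p using dvd_modulus[OF assms(2) that] by simp
  ultimately have residue: "n mod ?q \<in> res_classes W v S C \<longleftrightarrow> n mod W = v \<and> (\<forall>p\<in>C. n mod p \<in> S p)" for n
    unfolding res_classes_def by (auto simp: mod_mod_cancel)
  have "finite (res_classes W v S C)" unfolding res_classes_def by auto
  then have "(\<Sum>n\<in>?Y. F n) = (\<Sum>a\<in>res_classes W v S C. \<Sum>n | n \<in> ?Y \<and> n mod ?q = a. F n)"
    using assms(1) residue by (intro sum.group[symmetric]) auto
  also have "\<dots> = (\<Sum>a\<in>res_classes W v S C. \<Sum>n | n \<in> X \<and> n mod ?q = a. F n)"
    by (intro sum.cong refl) (use residue in auto)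
  finally show ?thesis .
qed

lemma card_residue_less:
  fixes q a y :: nat
  assumes "a < q"
  shows "card {n. n < y \<and> n mod q = a} = (y + (q - 1 - a)) div q"
proof (induction y)
  case (Suc y)
  have "[y + (q - a) = a + (q - a)] (mod q) \<longleftrightarrow> [y = a] (mod q)"
    by (rule cong_add_rcancel_nat)
  moreover have "Suc (y + (q - 1 - a)) = y + (q - a)" using assms by simp
  ultimately have "Suc (y + (q - 1 - a)) mod q = 0 \<longleftrightarrow> y mod q = a"
    using assms by (simp add: cong_def)
  moreover have "{n. n < Suc y \<and> n mod q = a}
      = (if y mod q = a then insert y {n. n < y \<and> n mod q = a} else {n. n < y \<and> n mod q = a})"
    by (auto simp: less_Suc_eq)
  ultimately show ?case using Suc by (simp add: div_Suc)
qed (use assms in simp)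

lemma card_residue_interval:
  fixes q a N M :: nat
  assumes "a < q" "N \<le> M"
  shows "\<bar>real (card {n \<in> {N<..M}. n mod q = a}) - (real M - real N) / real q\<bar> \<le> 1"
proof -
  let ?S = "{n \<in> {N<..M}. n mod q = a}"
  let ?c = "\<lambda>y. (Suc y + (q - 1 - a)) div q"
  have "card ({n. n < Suc N \<and> n mod q = a} \<union> ?S) = card {n. n < Suc N \<and> n mod q = a} + card ?S"
    by (rule card_Un_disjoint) auto
  moreover have "{n. n < Suc N \<and> n mod q = a} \<union> ?S = {n. n < Suc M \<and> n mod q = a}"
    using assms(2) by auto
  ultimately have "?c M = ?c N + card ?S"
    by (simp only: card_residue_less[OF assms(1)])
  then have "real (card ?S) = real (?c M) - real (?c N)" by simp
  moreover have "real (?c y) \<le> (real y + real (q - a)) / real q" "(real y + real (q - a)) / real q - 1 \<le> real (?c y)" for y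
  proof -
    let ?u = "Suc y + (q - 1 - a)"
    have "real ?u = real y + real (q - a)" using assms(1) by linarith
    then have "(real y + real (q - a)) / real q = real (?u div q) + real (?u mod q) / real q"
      using of_nat_of_nat_div_aux[of ?u q, where ?'a = real] by simp
    moreover have "?u mod q < q" using assms(1) by simp
    then have "0 \<le> real (?u mod q) / real q" "real (?u mod q) / real q \<le> 1" by simp_all
    ultimately show "real (?c y) \<le> (real y + real (q - a)) / real q" "(real y + real (q - a)) / real q - 1 \<le> real (?c y)"
      by linarith+
  qed
  from this[of M] this[of N] have "\<bar>real (?c M) - real (?c N) - (real M / real q - real N / real q)\<bar> \<le> 1"
    unfolding add_divide_distrib by linarith
  ultimately show ?thesis by (simp add: diff_divide_distrib)
qed

lemma dvd_mod_add_iff: "(p::nat) dvd n mod p + h \<longleftrightarrow> p dvd n + h"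
  by (simp add: dvd_eq_mod_eq_0 mod_add_left_eq)

lemma dvd_add_iff_eq_neg_residue:
  fixes p a h :: nat
  assumes "a < p" "h < p"
  shows "p dvd a + h \<longleftrightarrow> a = (p - h) mod p"
proof -
  have "[a + h = (p - h) + h] (mod p) \<longleftrightarrow> [a = p - h] (mod p)" by (rule cong_add_rcancel_nat)
  then show ?thesis using assms by (simp add: cong_def dvd_eq_mod_eq_0)
qed

lemma inj_on_neg_residue: "inj_on (\<lambda>h. (p - h) mod p) {..<p :: nat}"
proof (rule inj_onI)
  fix x y assume "x \<in> {..<p}" "y \<in> {..<p}" "(p - x) mod p = (p - y) mod p"
  then show "x = y" by (cases "x = 0"; cases "y = 0") auto
qed

section \<open>The Selberg weights\<close>

lemma sum_supersets_vanishing: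
  fixes f :: "'a \<Rightarrow> real" and z :: "'a set \<Rightarrow> real"
  assumes fin: "finite \<D>" "\<And>B. B \<in> \<D> \<Longrightarrow> finite B" and C: "C \<in> \<D>" "q \<notin> C"
    and f: "\<And>B p. B \<in> \<D> \<Longrightarrow> p \<in> B \<Longrightarrow> p \<noteq> q \<Longrightarrow> f p = 0"
  shows "(\<Sum>B | B \<in> \<D> \<and> C \<subseteq> B. z B * (\<Prod>p\<in>B - C. f p))
    = z C + (if insert q C \<in> \<D> then z (insert q C) * f q else 0)"
proof -
  let ?t = "\<lambda>B. z B * (\<Prod>p\<in>B - C. f p)"
  have "(\<Sum>B | B \<in> \<D> \<and> C \<subseteq> B. ?t B) = (\<Sum>B\<in>{C, insert q C} \<inter> \<D>. ?t B)"
  proof (rule sum.mono_neutral_right)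
    show "\<forall>B\<in>{B. B \<in> \<D> \<and> C \<subseteq> B} - {C, insert q C} \<inter> \<D>. ?t B = 0"
    proof
      fix B assume B: "B \<in> {B. B \<in> \<D> \<and> C \<subseteq> B} - {C, insert q C} \<inter> \<D>"
      then obtain p where p: "p \<in> B - C" "p \<noteq> q" by auto
      have "f p = 0" using f[of B p] B p by auto
      then have "(\<Prod>p\<in>B - C. f p) = 0" using B p fin(2)[of B] by (intro prod_zero) auto
      then show "?t B = 0" by simp
    qed
  qed (use fin C in auto)
  also have "\<dots> = z C + (if insert q C \<in> \<D> then z (insert q C) * f q else 0)"
  proof -
    have "insert q C - C = {q}" "C \<noteq> insert q C" using C by auto
    then show ?thesis using C by (cases "insert q C \<in> \<D>") (auto simp: Int_insert_left)
  qed
  finally show ?thesis .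
qed

definition bounded_profile :: "real \<Rightarrow> real \<Rightarrow> (nat \<Rightarrow> real) \<Rightarrow> bool" where
  "bounded_profile R Y y \<longleftrightarrow> (\<forall>n. 1 \<le> n \<and> real n \<le> R \<longrightarrow> 0 \<le> y n \<and> y n \<le> Y)"

lemma bounded_profile_modulus:
  assumes "bounded_profile R Y y" "C \<in> rough_moduli D R"
  shows "0 \<le> y (modulus C)" "y (modulus C) \<le> Y"
  using assms rough_modulus_pos[OF assms(2)] rough_moduliD(4)[OF assms(2)]
  by (auto simp: bounded_profile_def Suc_le_eq)

lemma bounded_profile_nonneg: "bounded_profile R Y y \<Longrightarrow> 1 \<le> R \<Longrightarrow> 0 \<le> Y"
  unfolding bounded_profile_def by (erule allE[of _ 1]) auto

locale tuple_sieve =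
  fixes H :: "nat set" and k D v :: nat
  assumes finite_H: "finite H" and card_H: "card H = k" and k_ge_2: "2 \<le> k"
    and D_ge: "2 * k \<le> D" and H_le_D: "\<And>h. h \<in> H \<Longrightarrow> h \<le> D"
    and v_less: "v < primorial D" and v_coprime: "\<And>h. h \<in> H \<Longrightarrow> coprime (v + h) (primorial D)"
begin

abbreviation W :: nat where "W \<equiv> primorial D"

lemma D_pos: "0 < D" using D_ge k_ge_2 by simp

lemma rough_prime_bounds:
  assumes "D < p"
  shows "real k < real p" "real p \<le> 2 * (real p - real k)" "1 < real p"
  using assms D_ge k_ge_2 by auto

definition has_root :: "nat \<Rightarrow> nat \<Rightarrow> bool" where
  "has_root n p \<longleftrightarrow> (\<exists>h\<in>H. p dvd n + h)"

lemma has_root_mod: "has_root (n mod p) p \<longleftrightarrow> has_root n p"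
  by (simp add: has_root_def dvd_mod_add_iff)

definition window :: "nat \<Rightarrow> nat set" where
  "window N = {n \<in> {N<..2 * N}. n mod W = v}"

definition root_window :: "nat \<Rightarrow> nat set \<Rightarrow> nat set" where
  "root_window N C = {n \<in> window N. \<forall>p\<in>C. has_root n p}"

lemma finite_window [simp]: "finite (window N)"
  unfolding window_def by simp

lemma finite_root_window [simp]: "finite (root_window N C)"
  unfolding root_window_def by simp

text \<open>The coefficients are parametrised by the diagonalising variables y: \<open>root_weight\<close> is the inverse of the
  multiplicative function with value \<open>p / k - 1\<close> at p, and \<open>selberg_coeff\<close> is the Moebius-type inversion of y.\<close>

definition root_weight :: "nat set \<Rightarrow> real" where
  "root_weight C = (\<Prod>p\<in>C. real k / (real p - real k))"

definition selberg_coeff :: "real \<Rightarrow> (nat \<Rightarrow> real) \<Rightarrow> nat set \<Rightarrow> real" where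
  "selberg_coeff R y A = (\<Prod>p\<in>A. - (real p / real k)) *
     (\<Sum>B | B \<in> rough_moduli D R \<and> A \<subseteq> B. root_weight B * y (modulus B))"

definition selberg_weight :: "real \<Rightarrow> (nat \<Rightarrow> real) \<Rightarrow> nat \<Rightarrow> real" where
  "selberg_weight R y n = (\<Sum>A | A \<in> rough_moduli D R \<and> (\<forall>p\<in>A. has_root n p). selberg_coeff R y A)\<^sup>2"

definition selberg_form :: "real \<Rightarrow> (nat \<Rightarrow> real) \<Rightarrow> (nat set \<Rightarrow> real) \<Rightarrow> real" where
  "selberg_form R y G = (\<Sum>A\<in>rough_moduli D R. \<Sum>B\<in>rough_moduli D R.
     selberg_coeff R y A * selberg_coeff R y B * G (A \<union> B))"

lemma selberg_weight_nonneg: "0 \<le> selberg_weight R y n"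
  by (simp add: selberg_weight_def)

lemma root_weight_nonneg: "C \<in> rough_moduli D x \<Longrightarrow> 0 \<le> root_weight C"
  unfolding root_weight_def using D_ge by (auto intro!: prod_nonneg dest: rough_moduliD)

lemma root_weight_subset_Diff: "finite B \<Longrightarrow> A \<subseteq> B \<Longrightarrow> root_weight B = root_weight A * root_weight (B - A)"
  unfolding root_weight_def by (simp add: prod.subset_diff[of A B] mult.commute)

lemma sum_selberg_weight:
  fixes F :: "nat \<Rightarrow> real"
  shows "(\<Sum>n\<in>window N. selberg_weight R y n * F n) = selberg_form R y (\<lambda>C. \<Sum>n\<in>root_window N C. F n)"
proof -
  let ?P = "\<lambda>n A. \<forall>p\<in>A. has_root n p" and ?l = "selberg_coeff R y" and ?D = "rough_moduli D R"
  let ?t = "\<lambda>n A B. if ?P n (A \<union> B) then ?l A * ?l B * F n else 0"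
  have "(\<Sum>n\<in>window N. selberg_weight R y n * F n) = (\<Sum>n\<in>window N. \<Sum>A\<in>?D. \<Sum>B\<in>?D. ?t n A B)"
  proof (intro sum.cong refl)
    fix n
    have "(\<Sum>A | A \<in> ?D \<and> ?P n A. ?l A) = (\<Sum>A\<in>?D. if ?P n A then ?l A else 0)"
      by (simp add: sum.inter_filter)
    then have "selberg_weight R y n * F n
        = (\<Sum>A\<in>?D. \<Sum>B\<in>?D. (if ?P n A then ?l A else 0) * (if ?P n B then ?l B else 0)) * F n"
      by (simp only: selberg_weight_def power2_eq_square sum_product)
    also have "\<dots> = (\<Sum>A\<in>?D. \<Sum>B\<in>?D. ?t n A B)"
      unfolding sum_distrib_right by (intro sum.cong refl) auto
    finally show "selberg_weight R y n * F n = (\<Sum>A\<in>?D. \<Sum>B\<in>?D. ?t n A B)" .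
  qed
  also have "\<dots> = (\<Sum>A\<in>?D. \<Sum>B\<in>?D. \<Sum>n\<in>window N. ?t n A B)"
    by (rule sum_swap_inner_outer)
  also have "\<dots> = selberg_form R y (\<lambda>C. \<Sum>n\<in>root_window N C. F n)"
    unfolding selberg_form_def root_window_def
    by (intro sum.cong refl) (simp only: sum.inter_filter[OF finite_window] sum_distrib_left
        if_distrib[of "\<lambda>x. _ * x"] mult_zero_right cong: if_cong)
  finally show ?thesis .
qed

lemma root_weight_le:
  assumes C: "C \<in> rough_moduli D x"
  shows "root_weight C \<le> real (2 * k) ^ card C / real (modulus C)"
  unfolding root_weight_def prod_divide_const_modulus[symmetric]
proof (intro prod_mono conjI)
  fix p assume "p \<in> C"
  note p = rough_prime_bounds[OF rough_moduliD(3)[OF C this]]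
  show "0 \<le> real k / (real p - real k)" using p by simp
  show "real k / (real p - real k) \<le> real (2 * k) / real p"
    using p mult_right_mono[OF p(2), of "real k"] by (simp add: field_simps)
qed

lemma sum_root_weight_le:
  assumes "1 \<le> R"
  shows "(\<Sum>B\<in>rough_moduli D R. root_weight B) \<le> (1 + ln R) ^ (2 * k)"
  by (rule order_trans[OF sum_mono[OF root_weight_le] sum_power_card_div_modulus_le[OF assms]])

lemma prod_div_k_mult_root_weight_le:
  assumes A: "A \<in> rough_moduli D x"
  shows "(\<Prod>p\<in>A. real p / real k) * root_weight A \<le> 2 ^ card A"
proof -
  have "(\<Prod>p\<in>A. real p / real k) * root_weight A = (\<Prod>p\<in>A. real p / (real p - real k))"
    unfolding root_weight_def prod.distrib[symmetric] using k_ge_2 by (intro prod.cong refl) auto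
  also have "\<dots> \<le> (\<Prod>p\<in>A. 2)"
  proof (intro prod_mono conjI)
    fix p assume "p \<in> A"
    note p = rough_prime_bounds[OF rough_moduliD(3)[OF A this]]
    show "0 \<le> real p / (real p - real k)" using p by simp
    show "real p / (real p - real k) \<le> 2" using p by (subst pos_divide_le_eq) auto
  qed
  finally show ?thesis by simp
qed

lemma sum_supersets_root_weight_le:
  assumes R: "1 \<le> R" and y: "bounded_profile R Y y" and A: "A \<in> rough_moduli D R"
  shows "(\<Sum>B | B \<in> rough_moduli D R \<and> A \<subseteq> B. root_weight B * y (modulus B))
    \<le> root_weight A * (Y * (1 + ln R) ^ (2 * k))"
proof -
  let ?S = "{B. B \<in> rough_moduli D R \<and> A \<subseteq> B}"
  have Y: "0 \<le> Y" using y R by (rule bounded_profile_nonneg)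
  have "(\<Sum>B\<in>?S. root_weight B * y (modulus B)) \<le> (\<Sum>B\<in>?S. root_weight A * Y * root_weight (B - A))"
  proof (intro sum_mono)
    fix B assume "B \<in> ?S"
    then have B: "B \<in> rough_moduli D R" "A \<subseteq> B" by auto
    have "root_weight B * y (modulus B) \<le> root_weight B * Y"
      using root_weight_nonneg[OF B(1)] bounded_profile_modulus[OF y B(1)] by (intro mult_left_mono) auto
    then show "root_weight B * y (modulus B) \<le> root_weight A * Y * root_weight (B - A)"
      using root_weight_subset_Diff[OF rough_moduliD(1)[OF B(1)] B(2)] by (simp add: mult_ac)
  qed
  also have "\<dots> = root_weight A * Y * (\<Sum>B\<in>(\<lambda>B. B - A) ` ?S. root_weight B)"
    by (subst sum.reindex) (auto simp: inj_on_def sum_distrib_left)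
  also have "\<dots> \<le> root_weight A * Y * (\<Sum>B\<in>rough_moduli D R. root_weight B)"
    using root_weight_nonneg[OF A] Y
    by (intro mult_left_mono sum_mono2) (auto intro: rough_moduli_subset root_weight_nonneg)
  also have "\<dots> \<le> root_weight A * Y * (1 + ln R) ^ (2 * k)"
    using root_weight_nonneg[OF A] Y by (intro mult_left_mono sum_root_weight_le R) auto
  finally show ?thesis by (simp only: mult.assoc)
qed

lemma abs_selberg_coeff_le:
  assumes R: "1 \<le> R" and y: "bounded_profile R Y y" and A: "A \<in> rough_moduli D R"
  shows "\<bar>selberg_coeff R y A\<bar> \<le> 2 ^ card A * (Y * (1 + ln R) ^ (2 * k))"
proof -
  let ?S = "\<Sum>B | B \<in> rough_moduli D R \<and> A \<subseteq> B. root_weight B * y (modulus B)"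
  let ?L = "Y * (1 + ln R) ^ (2 * k)" and ?P = "\<Prod>p\<in>A. real p / real k"
  have "0 \<le> ?S"
    using root_weight_nonneg bounded_profile_modulus(1)[OF y] by (intro sum_nonneg mult_nonneg_nonneg) auto
  then have "\<bar>selberg_coeff R y A\<bar> = ?P * ?S"
    unfolding selberg_coeff_def abs_mult abs_prod by simp
  also have "\<dots> \<le> ?P * (root_weight A * ?L)"
    by (intro mult_left_mono sum_supersets_root_weight_le R y A prod_nonneg) auto
  also have "\<dots> \<le> 2 ^ card A * ?L"
    using prod_div_k_mult_root_weight_le[OF A] bounded_profile_nonneg[OF y R] R
    unfolding mult.assoc[symmetric, of ?P] by (intro mult_right_mono) auto
  finally show ?thesis .
qed

lemma selberg_form_approx:
  assumes coeff: "\<And>A. A \<in> rough_moduli D R \<Longrightarrow> \<bar>selberg_coeff R y A\<bar> \<le> 2 ^ card A * L" and L: "0 \<le> L"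
    and error: "\<And>C. C \<in> rough_moduli D (R * R) \<Longrightarrow> \<bar>M C - X * G C\<bar> \<le> err C"
  shows "\<bar>selberg_form R y M - X * selberg_form R y G\<bar> \<le> L\<^sup>2 * (\<Sum>C\<in>rough_moduli D (R * R). 16 ^ card C * err C)"
proof -
  let ?l = "selberg_coeff R y" and ?D = "rough_moduli D R"
  let ?f = "\<lambda>C. 4 ^ card C * err C"
  have "\<bar>selberg_form R y M - X * selberg_form R y G\<bar>
     = \<bar>\<Sum>A\<in>?D. \<Sum>B\<in>?D. ?l A * ?l B * (M (A \<union> B) - X * G (A \<union> B))\<bar>"
    unfolding selberg_form_def
    by (simp add: sum_distrib_left sum_subtractf[symmetric] right_diff_distrib mult_ac)
  also have "\<dots> \<le> (\<Sum>A\<in>?D. \<Sum>B\<in>?D. \<bar>?l A * ?l B * (M (A \<union> B) - X * G (A \<union> B))\<bar>)"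
    by (intro order_trans[OF sum_abs] sum_mono order_refl)
  also have "\<dots> \<le> (\<Sum>A\<in>?D. \<Sum>B\<in>?D. L\<^sup>2 * ?f (A \<union> B))"
  proof (intro sum_mono)
    fix A B assume A: "A \<in> ?D" and B: "B \<in> ?D"
    let ?c = "2 ^ card (A \<union> B) :: real"
    have "\<bar>?l A'\<bar> \<le> ?c * L" if "A' \<in> ?D" "A' \<subseteq> A \<union> B" for A'
      using that A B L by (intro order_trans[OF coeff] mult_right_mono power_increasing card_mono)
        (auto dest: rough_moduliD)
    then have "\<bar>?l A\<bar> * \<bar>?l B\<bar> * \<bar>M (A \<union> B) - X * G (A \<union> B)\<bar> \<le> (?c * L) * (?c * L) * err (A \<union> B)"
      using A B L error[OF Un_in_rough_moduli[OF A B]] by (intro mult_mono) auto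
    also have "\<dots> = L\<^sup>2 * (?c * ?c * err (A \<union> B))" by (simp add: power2_eq_square)
    also have "?c * ?c = 4 ^ card (A \<union> B)" by (simp add: power_mult_distrib[symmetric])
    finally show "\<bar>?l A * ?l B * (M (A \<union> B) - X * G (A \<union> B))\<bar> \<le> L\<^sup>2 * ?f (A \<union> B)"
      by (simp add: abs_mult)
  qed
  also have "\<dots> = L\<^sup>2 * (\<Sum>A\<in>?D. \<Sum>B\<in>?D. ?f (A \<union> B))"
    by (simp only: sum_distrib_left)
  also have "\<dots> \<le> L\<^sup>2 * (\<Sum>C\<in>rough_moduli D (R * R). 4 ^ card C * ?f C)"
    using order_trans[OF abs_ge_zero error] by (intro mult_left_mono sum_rough_moduli_Un_le) auto
  also have "(\<Sum>C\<in>rough_moduli D (R * R). 4 ^ card C * ?f C) = (\<Sum>C\<in>rough_moduli D (R * R). 16 ^ card C * err C)"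
    by (simp add: mult.assoc[symmetric] power_mult_distrib[symmetric])
  finally show ?thesis .
qed

lemma selberg_form_prod:
  fixes g :: "nat \<Rightarrow> real"
  assumes g: "\<And>p. prime p \<Longrightarrow> D < p \<Longrightarrow> g p \<noteq> 0"
  defines "\<psi> \<equiv> (\<lambda>p. g p * real p / real k)"
  shows "selberg_form R y (\<lambda>C. \<Prod>p\<in>C. g p)
    = (\<Sum>C\<in>rough_moduli D R. (\<Prod>p\<in>C. (1 / g p - 1) * (\<psi> p)\<^sup>2) *
        (\<Sum>B | B \<in> rough_moduli D R \<and> C \<subseteq> B. root_weight B * y (modulus B) * (\<Prod>p\<in>B - C. 1 - \<psi> p))\<^sup>2)"
proof -
  have coeff: "selberg_coeff R y A * (\<Prod>p\<in>A. g p)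
      = (\<Prod>p\<in>A. - \<psi> p) * (\<Sum>B | B \<in> rough_moduli D R \<and> A \<subseteq> B. root_weight B * y (modulus B))" for A
  proof -
    have "(\<Prod>p\<in>A. - (real p / real k)) * (\<Prod>p\<in>A. g p) = (\<Prod>p\<in>A. - \<psi> p)"
      unfolding prod.distrib[symmetric] \<psi>_def by (intro prod.cong refl) simp
    then show ?thesis unfolding selberg_coeff_def by (simp add: mult.commute mult.left_commute)
  qed
  have "selberg_form R y (\<lambda>C. \<Prod>p\<in>C. g p) = (\<Sum>C\<in>rough_moduli D R. (\<Prod>p\<in>C. 1 / g p - 1) *
      (\<Sum>A | A \<in> rough_moduli D R \<and> C \<subseteq> A. selberg_coeff R y A * (\<Prod>p\<in>A. g p))\<^sup>2)"
    unfolding selberg_form_def using g by (intro rough_quadratic_form_diagonal) (auto dest: rough_moduliD)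
  also have "\<dots> = (\<Sum>C\<in>rough_moduli D R. (\<Prod>p\<in>C. (1 / g p - 1) * (\<psi> p)\<^sup>2) *
      (\<Sum>B | B \<in> rough_moduli D R \<and> C \<subseteq> B. root_weight B * y (modulus B) * (\<Prod>p\<in>B - C. 1 - \<psi> p))\<^sup>2)"
    unfolding coeff by (subst rough_superset_inversion)
      (simp_all add: power_mult_distrib prod.distrib prod_power_distrib mult.assoc)
  finally show ?thesis .
qed

lemma diagonal_term_root:
  assumes C: "C \<in> rough_moduli D R" "q \<notin> C" and g: "\<And>p. p \<noteq> q \<Longrightarrow> g p = real k / real p"
  defines "\<psi> \<equiv> (\<lambda>p. g p * real p / real k)"
  shows "(\<Prod>p\<in>C. (1 / g p - 1) * (\<psi> p)\<^sup>2) *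
      (\<Sum>B | B \<in> rough_moduli D R \<and> C \<subseteq> B. root_weight B * y (modulus B) * (\<Prod>p\<in>B - C. 1 - \<psi> p))\<^sup>2
    = root_weight C * (y (modulus C) + (if insert q C \<in> rough_moduli D R
        then real k / (real q - real k) * (1 - \<psi> q) * y (q * modulus C) else 0))\<^sup>2"
proof -
  let ?Y = "y (modulus C) + (if insert q C \<in> rough_moduli D R
        then real k / (real q - real k) * (1 - \<psi> q) * y (q * modulus C) else 0)"
  have k_nonzero: "real k \<noteq> 0" using k_ge_2 by simp
  have \<psi>_one: "\<psi> p = 1" if "D < p" "p \<noteq> q" for p
    using rough_prime_bounds[OF that(1)] g[OF that(2)] k_nonzero by (simp add: \<psi>_def)
  have "(\<Sum>B | B \<in> rough_moduli D R \<and> C \<subseteq> B. root_weight B * y (modulus B) * (\<Prod>p\<in>B - C. 1 - \<psi> p))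
      = root_weight C * y (modulus C) + (if insert q C \<in> rough_moduli D R
          then root_weight (insert q C) * y (modulus (insert q C)) * (1 - \<psi> q) else 0)"
    using C \<psi>_one by (intro sum_supersets_vanishing) (auto dest: rough_moduliD)
  also have "\<dots> = root_weight C * ?Y"
    using C rough_moduliD(1)[OF C(1)] by (simp add: root_weight_def algebra_simps)
  finally have inner: "(\<Sum>B | B \<in> rough_moduli D R \<and> C \<subseteq> B. root_weight B * y (modulus B) * (\<Prod>p\<in>B - C. 1 - \<psi> p))
      = root_weight C * ?Y" .
  have "(\<Prod>p\<in>C. (1 / g p - 1) * (\<psi> p)\<^sup>2) * root_weight C = 1"
    unfolding root_weight_def prod.distrib[symmetric]
  proof (intro prod.neutral ballI)
    fix p assume p: "p \<in> C"
    note bounds = rough_prime_bounds[OF rough_moduliD(3)[OF C(1) p]]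
    have "p \<noteq> q" using p C by auto
    then show "(1 / g p - 1) * (\<psi> p)\<^sup>2 * (real k / (real p - real k)) = 1"
      using bounds \<psi>_one[OF rough_moduliD(3)[OF C(1) p]] k_nonzero by (simp add: g field_simps)
  qed
  then show ?thesis unfolding inner by (simp add: power2_eq_square mult.assoc[symmetric])
qed

definition root_form :: "real \<Rightarrow> (nat \<Rightarrow> real) \<Rightarrow> real" where
  "root_form R y = (\<Sum>C\<in>rough_moduli D R. root_weight C * (y (modulus C))\<^sup>2)"

definition root_form_at :: "nat \<Rightarrow> real \<Rightarrow> (nat \<Rightarrow> real) \<Rightarrow> real" where
  "root_form_at q R y = (\<Sum>C | C \<in> rough_moduli D R \<and> q \<notin> C. root_weight C *
     (y (modulus C) - (if insert q C \<in> rough_moduli D R then y (q * modulus C) else 0))\<^sup>2)"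

definition prime_inner_sum :: "real \<Rightarrow> (nat \<Rightarrow> real) \<Rightarrow> nat set \<Rightarrow> real" where
  "prime_inner_sum R y C = (\<Sum>m | m \<in> rough_moduli D (R / modulus C) \<and> m \<inter> C = {}.
     (\<Prod>p\<in>m. 1 / (real p - 1)) * y (modulus C * modulus m))"

definition prime_form :: "real \<Rightarrow> (nat \<Rightarrow> real) \<Rightarrow> real" where
  "prime_form R y = (\<Sum>C\<in>rough_moduli D R. (\<Prod>p\<in>C. (real k - 1) / (real p - real k)) *
     ((\<Prod>p\<in>C. real p / (real p - 1)) * prime_inner_sum R y C)\<^sup>2)"

lemma selberg_form_root: "selberg_form R y (\<lambda>C. \<Prod>p\<in>C. real k / real p) = root_form R y"
proof -
  have not_1: "1 \<notin> C" "insert 1 C \<notin> rough_moduli D R" if "C \<in> rough_moduli D R" for C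
    using rough_moduliD(2)[OF that] rough_moduliD(2)[of "insert 1 C" D R 1] not_prime_1 by blast+
  show ?thesis
    unfolding root_form_def
  proof (subst selberg_form_prod, goal_cases density diagonal)
    case diagonal
    show ?case
      by (intro sum.cong refl, subst diagonal_term_root[where q = 1]) (use not_1 in auto)
  qed (use k_ge_2 in simp)
qed

lemma prod_insert_reset:
  fixes f :: "'b \<Rightarrow> 'c::comm_monoid_mult"
  assumes "finite C"
  shows "(\<Prod>p\<in>insert q C. f p) = f q * (\<Prod>p\<in>C. if p = q then 1 else f p)"
proof -
  have "(\<Prod>p\<in>C. if p = q then 1 else f p) = (\<Prod>p\<in>C - {q}. if p = q then 1 else f p)"
    using assms by (cases "q \<in> C") (auto simp: prod.remove)
  also have "\<dots> = (\<Prod>p\<in>C - {q}. f p)" by (intro prod.cong) auto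
  finally show ?thesis using assms by (simp add: prod.insert_remove)
qed

lemma selberg_form_root_insert:
  assumes q: "D < q"
  shows "selberg_form R y (\<lambda>C. \<Prod>p\<in>insert q C. real k / real p) = real k / real q * root_form_at q R y"
proof -
  have qk: "0 < real q - real k" "real k \<noteq> 0" using rough_prime_bounds[OF q] k_ge_2 by auto
  \<comment> \<open>Resetting the local density at q to 1 turns the restricted form into an instance of the general one.\<close>
  define g where "g p = (if p = q then 1 else real k / real p)" for p
  have "selberg_form R y (\<lambda>C. \<Prod>p\<in>insert q C. real k / real p) = real k / real q * selberg_form R y (\<lambda>C. \<Prod>p\<in>C. g p)"
    unfolding selberg_form_def sum_distrib_left by (intro sum.cong refl, subst prod_insert_reset) (auto dest: rough_moduliD simp: g_def)
  also have "selberg_form R y (\<lambda>C. \<Prod>p\<in>C. g p) = (\<Sum>C\<in>rough_moduli D R. if q \<notin> C then root_weight C *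
      (y (modulus C) - (if insert q C \<in> rough_moduli D R then y (q * modulus C) else 0))\<^sup>2 else 0)"
  proof (subst selberg_form_prod, goal_cases density diagonal)
    case diagonal
    show ?case
    proof (intro sum.cong refl)
      fix C assume C: "C \<in> rough_moduli D R"
      let ?\<psi> = "\<lambda>p. g p * real p / real k"
      let ?T = "(\<Prod>p\<in>C. (1 / g p - 1) * (?\<psi> p)\<^sup>2) *
        (\<Sum>B | B \<in> rough_moduli D R \<and> C \<subseteq> B. root_weight B * y (modulus B) * (\<Prod>p\<in>B - C. 1 - ?\<psi> p))\<^sup>2"
      let ?y = "y (modulus C) - (if insert q C \<in> rough_moduli D R then y (q * modulus C) else 0)"
      show "?T = (if q \<notin> C then root_weight C * ?y\<^sup>2 else 0)"
      proof (cases "q \<in> C")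
        case True
        then have "(\<Prod>p\<in>C. (1 / g p - 1) * (?\<psi> p)\<^sup>2) = 0"
          using rough_moduliD(1)[OF C] by (intro prod_zero) (auto simp: g_def)
        then show ?thesis using True by simp
      next
        case False
        have "real k / (real q - real k) * (1 - ?\<psi> q) = - 1" using qk by (simp add: g_def field_simps)
        then show ?thesis
          using False by (subst diagonal_term_root[OF C False]) (auto simp: g_def)
      qed
    qed
  qed (use k_ge_2 in \<open>auto simp: g_def\<close>)
  also have "\<dots> = root_form_at q R y"
    unfolding root_form_at_def by (simp add: sum.inter_filter)
  finally show ?thesis .
qed

lemma sum_supersets_prime:
  assumes C: "C \<in> rough_moduli D R"
  defines "\<psi> \<equiv> \<lambda>p. (real k - 1) / (real p - 1) * real p / real k"
  shows "(\<Sum>B | B \<in> rough_moduli D R \<and> C \<subseteq> B. root_weight B * y (modulus B) * (\<Prod>p\<in>B - C. 1 - \<psi> p))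
    = root_weight C * prime_inner_sum R y C"
proof -
  let ?M = "{m. m \<in> rough_moduli D (R / modulus C) \<and> m \<inter> C = {}}"
  have local_factor: "root_weight m * (\<Prod>p\<in>m. 1 - \<psi> p) = (\<Prod>p\<in>m. 1 / (real p - 1))"
    if m: "m \<in> rough_moduli D x" for m x
    unfolding root_weight_def prod.distrib[symmetric]
  proof (intro prod.cong refl)
    fix p assume "p \<in> m"
    note p = rough_prime_bounds[OF rough_moduliD(3)[OF m this]]
    have "1 - \<psi> p = (real p - real k) / ((real p - 1) * real k)"
      unfolding \<psi>_def using p k_ge_2 by (simp add: field_simps)
    then show "real k / (real p - real k) * (1 - \<psi> p) = 1 / (real p - 1)" using p k_ge_2 by simp
  qed
  have "(\<Sum>B | B \<in> rough_moduli D R \<and> C \<subseteq> B. root_weight B * y (modulus B) * (\<Prod>p\<in>B - C. 1 - \<psi> p))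
     = (\<Sum>m\<in>?M. root_weight C * ((\<Prod>p\<in>m. 1 / (real p - 1)) * y (modulus C * modulus m)))"
  proof (rule sum.reindex_bij_witness[where i = "\<lambda>m. C \<union> m" and j = "\<lambda>B. B - C"])
    fix B assume "B \<in> {B. B \<in> rough_moduli D R \<and> C \<subseteq> B}"
    then have B: "B \<in> rough_moduli D R" "C \<subseteq> B" by auto
    then have "C \<union> (B - C) \<in> rough_moduli D R" by (simp add: Un_absorb1)
    then show BC: "B - C \<in> ?M" using disjoint_Un_in_rough_moduli_iff[OF C, of "B - C"] by auto
    note split = modulus_subset_Diff[OF rough_moduliD(1)[OF B(1)] B(2)]
      root_weight_subset_Diff[OF rough_moduliD(1)[OF B(1)] B(2)]
    show "root_weight C * ((\<Prod>p\<in>B - C. 1 / (real p - 1)) * y (modulus C * modulus (B - C)))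
        = root_weight B * y (modulus B) * (\<Prod>p\<in>B - C. 1 - \<psi> p)"
      using local_factor[of "B - C" "R / modulus C"] BC unfolding split by (auto simp: mult_ac)
  next
    fix m assume m: "m \<in> ?M"
    then show "C \<union> m \<in> {B. B \<in> rough_moduli D R \<and> C \<subseteq> B}"
      using disjoint_Un_in_rough_moduli_iff[OF C, of m] by auto
  qed auto
  then show ?thesis unfolding prime_inner_sum_def by (simp add: sum_distrib_left)
qed

lemma prime_local_factor:
  fixes p k' :: real
  assumes "k' \<noteq> 0" "k' \<noteq> 1"
  shows "(1 / ((k' - 1) / (p - 1)) - 1) * ((k' - 1) / (p - 1) * p / k')\<^sup>2 * (k' / (p - k'))\<^sup>2
    = (k' - 1) / (p - k') * (p / (p - 1))\<^sup>2"
proof -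
  have "1 / ((k' - 1) / (p - 1)) - 1 = (p - k') / (k' - 1)" using assms by (simp add: field_simps)
  moreover have "(k' - 1) / (p - 1) * p / k' * (k' / (p - k')) = (k' - 1) / (p - k') * (p / (p - 1))"
    using assms by simp
  ultimately have "(1 / ((k' - 1) / (p - 1)) - 1) * ((k' - 1) / (p - 1) * p / k')\<^sup>2 * (k' / (p - k'))\<^sup>2
      = (p - k') / (k' - 1) * ((k' - 1) / (p - k') * (p / (p - 1)))\<^sup>2"
    by (metis mult.assoc power_mult_distrib)
  also have "\<dots> = (k' - 1) / (p - k') * (p / (p - 1))\<^sup>2"
    using assms by (simp add: power2_eq_square mult_ac)
  finally show ?thesis .
qed

lemma selberg_form_prime: "selberg_form R y (\<lambda>C. \<Prod>p\<in>C. (real k - 1) / (real p - 1)) = prime_form R y"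
proof -
  have k_nonzero: "real k \<noteq> 0" "real k \<noteq> 1" using k_ge_2 by auto
  let ?\<psi> = "\<lambda>p. (real k - 1) / (real p - 1) * real p / real k"
  have "selberg_form R y (\<lambda>C. \<Prod>p\<in>C. (real k - 1) / (real p - 1))
    = (\<Sum>C\<in>rough_moduli D R. (\<Prod>p\<in>C. (1 / ((real k - 1) / (real p - 1)) - 1) * (?\<psi> p)\<^sup>2) *
        (root_weight C * prime_inner_sum R y C)\<^sup>2)"
  proof (subst selberg_form_prod)
    show "(real k - 1) / (real p - 1) \<noteq> 0" if "D < p" for p
      using k_nonzero rough_prime_bounds[OF that] by simp
  qed (intro sum.cong refl, simp only: sum_supersets_prime)
  also have "\<dots> = prime_form R y"
    unfolding prime_form_def
  proof (intro sum.cong refl)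
    fix C assume C: "C \<in> rough_moduli D R"
    have "(\<Prod>p\<in>C. (1 / ((real k - 1) / (real p - 1)) - 1) * (?\<psi> p)\<^sup>2) * (root_weight C)\<^sup>2
       = (\<Prod>p\<in>C. (real k - 1) / (real p - real k)) * (\<Prod>p\<in>C. real p / (real p - 1))\<^sup>2"
      unfolding root_weight_def prod_power_distrib prod.distrib[symmetric]
      by (intro prod.cong refl prime_local_factor k_nonzero)
    then show "(\<Prod>p\<in>C. (1 / ((real k - 1) / (real p - 1)) - 1) * (?\<psi> p)\<^sup>2) * (root_weight C * prime_inner_sum R y C)\<^sup>2
       = (\<Prod>p\<in>C. (real k - 1) / (real p - real k)) * ((\<Prod>p\<in>C. real p / (real p - 1)) * prime_inner_sum R y C)\<^sup>2"
      by (simp only: power_mult_distrib mult.assoc[symmetric])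
  qed
  finally show ?thesis .
qed

end

section \<open>Discrepancies in arithmetic progressions\<close>

definition prime_discrepancy :: "nat \<Rightarrow> nat \<Rightarrow> real" where
  "prime_discrepancy N q = Max ((\<lambda>a. \<bar>(\<Sum>p | prime p \<and> p \<le> N \<and> [p = a] (mod q). ln (real p))
                    - real N / real (totient q)\<bar>) ` {a. a < q \<and> coprime a q})"

definition liouville_discrepancy :: "nat \<Rightarrow> nat \<Rightarrow> real" where
  "liouville_discrepancy N q = Max ((\<lambda>(y, a). \<bar>\<Sum>n | 1 \<le> n \<and> n \<le> y \<and> [n = a] (mod q). liouville n\<bar>)
               ` ({..N} \<times> {..<q}))"

definition level_of_distribution :: "(nat \<Rightarrow> nat \<Rightarrow> real) \<Rightarrow> real \<Rightarrow> bool" where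
  "level_of_distribution \<Delta> \<theta> \<longleftrightarrow> (\<forall>\<epsilon>>0. \<forall>A>0. \<exists>K. \<forall>N::nat. N \<ge> 2 \<longrightarrow>
    (\<Sum>q\<in>moduli N (\<theta> - \<epsilon>). \<Delta> N q) \<le> K * real N / ln (real N) powr A)"

lemma condA_iff_level_of_distribution: "condA \<theta> \<longleftrightarrow> level_of_distribution prime_discrepancy \<theta>"
  by (simp only: condA_def level_of_distribution_def prime_discrepancy_def)

lemma condB_iff_level_of_distribution: "condB \<theta> \<longleftrightarrow> level_of_distribution liouville_discrepancy \<theta>"
  by (simp only: condB_def level_of_distribution_def liouville_discrepancy_def)

lemma level_of_distributionD:
  assumes "level_of_distribution \<Delta> \<theta>" "t < \<theta>" "0 < a"
  obtains K where "\<And>N::nat. 2 \<le> N \<Longrightarrow> (\<Sum>q\<in>moduli N t. \<Delta> N q) \<le> K * real N / ln (real N) ^ a"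
proof -
  have "0 < \<theta> - t" "0 < real a" using assms by auto
  then obtain K where "\<forall>N\<ge>2. (\<Sum>q\<in>moduli N (\<theta> - (\<theta> - t)). \<Delta> N q) \<le> K * real N / ln (real N) powr real a"
    using assms(1) unfolding level_of_distribution_def by blast
  then show ?thesis by (intro that[of K]) (simp add: powr_realpow)
qed

lemma cong_mod_right_iff: "[n = a mod q] (mod q) \<longleftrightarrow> [n = a] (mod q)" for n a q :: nat
  by (simp add: cong_def)

lemma prime_discrepancy_ge:
  assumes "0 < q" "coprime a q"
  shows "\<bar>(\<Sum>p | prime p \<and> p \<le> N \<and> [p = a] (mod q). ln (real p)) - real N / real (totient q)\<bar> \<le> prime_discrepancy N q"
proof -
  have "\<bar>(\<Sum>p | prime p \<and> p \<le> N \<and> [p = a mod q] (mod q). ln (real p)) - real N / real (totient q)\<bar>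
      \<le> prime_discrepancy N q"
    unfolding prime_discrepancy_def using assms by (intro Max_ge) (auto intro!: image_eqI[of _ _ "a mod q"])
  then show ?thesis by (simp only: cong_mod_right_iff)
qed

lemma prime_discrepancy_nonneg: "0 < q \<Longrightarrow> 0 \<le> prime_discrepancy N q"
  using order_trans[OF abs_ge_zero prime_discrepancy_ge[OF _ coprime_1_left]] .

lemma liouville_discrepancy_ge:
  assumes "y \<le> N" "0 < q"
  shows "\<bar>\<Sum>n | 1 \<le> n \<and> n \<le> y \<and> [n = a] (mod q). liouville n\<bar> \<le> liouville_discrepancy N q"
proof -
  have "\<bar>\<Sum>n | 1 \<le> n \<and> n \<le> y \<and> [n = a mod q] (mod q). liouville n\<bar> \<le> liouville_discrepancy N q"
    unfolding liouville_discrepancy_def using assms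
    by (intro Max_ge) (auto intro!: image_eqI[of _ _ "(y, a mod q)"])
  then show ?thesis by (simp only: cong_mod_right_iff)
qed

lemma liouville_discrepancy_nonneg: "0 < q \<Longrightarrow> 0 \<le> liouville_discrepancy N q"
  using order_trans[OF abs_ge_zero liouville_discrepancy_ge[of 0 N q 0]] by simp

lemma card_progression_le:
  assumes "a < q" "q \<le> M" "y \<le> M" "S \<subseteq> {n. 1 \<le> n \<and> n \<le> y \<and> [n = a] (mod q)}"
  shows "real (card S) \<le> 2 * real M / real q"
proof -
  have "S \<subseteq> {n \<in> {0<..y}. n mod q = a}" using assms by (auto simp: cong_def)
  then have "card S \<le> card {n \<in> {0<..y}. n mod q = a}" by (intro card_mono) auto
  then have "real (card S) \<le> real y / real q + 1" using card_residue_interval[OF assms(1), of 0 y] by simp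
  also have "\<dots> \<le> real M / real q + real M / real q"
    using assms by (intro add_mono divide_right_mono) auto
  finally show ?thesis by simp
qed

lemma prime_discrepancy_le:
  assumes q: "1 \<le> q" "q \<le> M" and M: "3 \<le> M"
  shows "prime_discrepancy M q \<le> 3 * (real M * ln (real M)) / real (totient q)"
proof -
  have lnM: "1 \<le> ln (real M)" using M exp_le by (subst ln_ge_iff) auto
  have nonempty: "{a. a < q \<and> coprime a q} \<noteq> {}"
  proof -
    have "1 mod q \<in> {a. a < q \<and> coprime a q}" using q by (cases "q = 1") auto
    then show ?thesis by blast
  qed
  have "\<bar>(\<Sum>p | prime p \<and> p \<le> M \<and> [p = a] (mod q). ln (real p)) - real M / real (totient q)\<bar>
      \<le> 3 * (real M * ln (real M)) / real (totient q)" if a: "a < q" for a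
  proof -
    let ?S = "{p. prime p \<and> p \<le> M \<and> [p = a] (mod q)}"
    have "(\<Sum>p\<in>?S. ln (real p)) \<le> (\<Sum>p\<in>?S. ln (real M))"
    proof (rule sum_mono)
      fix p assume "p \<in> ?S"
      then have "0 < p" "p \<le> M" by (auto simp: prime_gt_0_nat)
      then show "ln (real p) \<le> ln (real M)" by simp
    qed
    also have "\<dots> = real (card ?S) * ln (real M)" by simp
    also have "\<dots> \<le> 2 * real M / real q * ln (real M)"
      using M q a prime_ge_1_nat by (intro mult_right_mono card_progression_le[of a q M M]) auto
    also have "\<dots> \<le> 2 * real M / real (totient q) * ln (real M)"
      using M q totient_le[of q] by (intro mult_right_mono divide_left_mono) auto
    finally have "(\<Sum>p\<in>?S. ln (real p)) \<le> 2 * (real M * ln (real M) / real (totient q))" by simp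
    moreover have "0 \<le> (\<Sum>p\<in>?S. ln (real p))"
      using prime_gt_0_nat by (intro sum_nonneg) (auto simp: Suc_le_eq)
    moreover have "0 \<le> real M / real (totient q)" by simp
    moreover have "real M / real (totient q) \<le> real M * ln (real M) / real (totient q)"
      using lnM by (intro divide_right_mono) (auto simp: mult_le_cancel_left1)
    ultimately show ?thesis by linarith
  qed
  then show ?thesis unfolding prime_discrepancy_def using nonempty by (subst Max_le_iff) auto
qed

lemma liouville_discrepancy_le:
  assumes q: "1 \<le> q" "q \<le> M" and M: "3 \<le> M"
  shows "liouville_discrepancy M q \<le> 2 * (real M * ln (real M)) / real (totient q)"
proof -
  have lnM: "1 \<le> ln (real M)" using M exp_le by (subst ln_ge_iff) auto
  have "\<bar>\<Sum>n | 1 \<le> n \<and> n \<le> y \<and> [n = a] (mod q). liouville n\<bar> \<le> 2 * (real M * ln (real M)) / real (totient q)"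
    if "y \<le> M" "a < q" for y a
  proof -
    let ?S = "{n. 1 \<le> n \<and> n \<le> y \<and> [n = a] (mod q)}"
    have "\<bar>\<Sum>n\<in>?S. liouville n\<bar> \<le> (\<Sum>n\<in>?S. \<bar>liouville n\<bar>)" by (rule sum_abs)
    also have "\<dots> = real (card ?S)" by (simp add: liouville_def power_abs)
    also have "\<dots> \<le> 2 * real M / real q" by (rule card_progression_le[OF that(2) q(2) that(1)]) simp
    also have "\<dots> \<le> 2 * (real M * ln (real M)) / real (totient q)"
      using lnM q totient_le[of q] by (intro frac_le) (auto simp: mult_le_cancel_left1)
    finally show ?thesis .
  qed
  moreover have "{..<q} \<noteq> {}" using q by (auto simp: lessThan_empty_iff)
  ultimately show ?thesis unfolding liouville_discrepancy_def by (subst Max_le_iff) auto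
qed

lemma sum_progression_shift:
  fixes f :: "nat \<Rightarrow> real"
  assumes "a < q" "N \<le> M"
  shows "(\<Sum>n\<in>{n \<in> {N<..M}. n mod q = a}. f (n + h))
    = (\<Sum>m | 1 \<le> m \<and> m \<le> M + h \<and> [m = a + h] (mod q). f m) - (\<Sum>m | 1 \<le> m \<and> m \<le> N + h \<and> [m = a + h] (mod q). f m)"
proof -
  let ?S = "\<lambda>y. {m. 1 \<le> m \<and> m \<le> y + h \<and> [m = a + h] (mod q)}" and ?T = "{m \<in> {N + h<..M + h}. [m = a + h] (mod q)}"
  have residue: "[n + h = a + h] (mod q) \<longleftrightarrow> n mod q = a" for n
    using assms(1) by (simp add: cong_add_rcancel_nat) (simp add: cong_def)
  have "(\<Sum>n\<in>{n \<in> {N<..M}. n mod q = a}. f (n + h)) = (\<Sum>m\<in>?T. f m)"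
  proof (rule sum.reindex_bij_witness[where i = "\<lambda>m. m - h" and j = "\<lambda>n. n + h"],
      goal_cases left_inverse maps_to right_inverse maps_back summand)
    case (maps_to n) then show ?case using residue[of n] by auto
  next
    case (maps_back m) then show ?case using residue[of "m - h"] by auto
  qed auto
  moreover have "?S M = ?S N \<union> ?T" using assms(2) by auto
  moreover have "sum f (?S N \<union> ?T) = sum f (?S N) + sum f ?T" by (intro sum.union_disjoint) auto
  ultimately show ?thesis by simp
qed

lemma ln_prime_progression_bound:
  assumes "a < q" "N \<le> M" "coprime (a + h) q"
  shows "\<bar>(\<Sum>n\<in>{n \<in> {N<..M}. n mod q = a}. ln_prime (n + h)) - (real M - real N) / real (totient q)\<bar>
    \<le> prime_discrepancy (M + h) q + prime_discrepancy (N + h) q"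
proof -
  have "0 < q" using assms(1) by simp
  have "(real M - real N) / real (totient q) = real (M + h) / real (totient q) - real (N + h) / real (totient q)"
    by (simp add: diff_divide_distrib[symmetric])
  then show ?thesis
    using prime_discrepancy_ge[OF \<open>0 < q\<close> assms(3), of "M + h"] prime_discrepancy_ge[OF \<open>0 < q\<close> assms(3), of "N + h"]
    unfolding sum_progression_shift[OF assms(1,2)] sum_ln_prime by linarith
qed

lemma liouville_progression_bound:
  assumes "a < q" "N \<le> M" "M + h \<le> L"
  shows "\<bar>\<Sum>n\<in>{n \<in> {N<..M}. n mod q = a}. liouville (n + h)\<bar> \<le> 2 * liouville_discrepancy L q"
  using liouville_discrepancy_ge[of "M + h" L q "a + h"] liouville_discrepancy_ge[of "N + h" L q "a + h"] assms
  unfolding sum_progression_shift[OF assms(1,2)] by linarith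

lemma mertens_bound_of_level_of_distribution:
  assumes "level_of_distribution prime_discrepancy \<theta>" "0 < \<theta>"
  obtains E where "mertens_bound E"
proof -
  obtain K where K: "\<And>N. 2 \<le> N \<Longrightarrow> (\<Sum>q\<in>moduli N 0. prime_discrepancy N q) \<le> K * real N / (ln (real N))\<^sup>2"
    using level_of_distributionD[OF assms, of 2] by auto
  have "\<bar>(\<Sum>p | prime p \<and> p \<le> N. ln (real p)) - real N\<bar> \<le> K * real N / (ln (real N))\<^sup>2" if N: "2 \<le> N" for N
  proof -
    have "moduli N 0 = {1}" using N by (auto simp: moduli_def)
    then have "prime_discrepancy N 1 \<le> K * real N / (ln (real N))\<^sup>2" using K[OF N] by simp
    then show ?thesis using prime_discrepancy_ge[of 1 0 N] by simp
  qed
  then show ?thesis using that mertens_bound_of_prime_number_theorem by blast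
qed

section \<open>Divisor-weighted sums of discrepancies\<close>

text \<open>The inequality \<open>u \<le> T + u\<^sup>2 / T\<close> takes the place of Cauchy--Schwarz in removing the divisor-type weights.\<close>

lemma sum_power_card_weight_le:
  fixes f :: "nat set \<Rightarrow> real"
  assumes x: "1 \<le> x" and T: "0 < T" and M: "0 \<le> M"
    and f: "\<And>C. C \<in> rough_moduli D x \<Longrightarrow> 0 \<le> f C" "\<And>C. C \<in> rough_moduli D x \<Longrightarrow> f C \<le> M * 2 ^ card C / real (modulus C)"
  shows "(\<Sum>C\<in>rough_moduli D x. real K ^ card C * f C)
    \<le> T * (\<Sum>C\<in>rough_moduli D x. f C) + M / T * (1 + ln x) ^ (2 * K\<^sup>2)"
proof -
  have weight_le: "u \<le> T + u\<^sup>2 / T" if "0 \<le> u" for u :: real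
  proof (cases "u \<le> T")
    case True then show ?thesis using T by (simp add: add_increasing2)
  next
    case False
    then have "u * T \<le> u * u" using that by (intro mult_left_mono) auto
    then have "u \<le> u\<^sup>2 / T" using T by (simp add: field_simps power2_eq_square)
    then show ?thesis using T by simp
  qed
  have "(\<Sum>C\<in>rough_moduli D x. real K ^ card C * f C)
     \<le> (\<Sum>C\<in>rough_moduli D x. T * f C + M / T * (real (2 * K\<^sup>2) ^ card C / real (modulus C)))"
  proof (intro sum_mono)
    fix C assume C: "C \<in> rough_moduli D x"
    let ?u = "real K ^ card C"
    have "?u * f C \<le> (T + ?u\<^sup>2 / T) * f C" using f(1)[OF C] weight_le by (intro mult_right_mono) auto
    also have "\<dots> = T * f C + ?u\<^sup>2 / T * f C" by (simp add: distrib_right)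
    also have "?u\<^sup>2 / T * f C \<le> ?u\<^sup>2 / T * (M * 2 ^ card C / real (modulus C))"
      using f(2)[OF C] T by (intro mult_left_mono) auto
    also have "\<dots> = M / T * (real (2 * K\<^sup>2) ^ card C / real (modulus C))"
      by (simp add: power_mult_distrib power2_eq_square)
    finally show "?u * f C \<le> T * f C + M / T * (real (2 * K\<^sup>2) ^ card C / real (modulus C))" by simp
  qed
  also have "\<dots> = T * (\<Sum>C\<in>rough_moduli D x. f C)
      + M / T * (\<Sum>C\<in>rough_moduli D x. real (2 * K\<^sup>2) ^ card C / real (modulus C))"
    by (simp only: sum.distrib sum_distrib_left)
  also have "\<dots> \<le> T * (\<Sum>C\<in>rough_moduli D x. f C) + M / T * (1 + ln x) ^ (2 * K\<^sup>2)"
    using M T by (intro add_left_mono mult_left_mono sum_power_card_div_modulus_le x) auto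
  finally show ?thesis .
qed

lemma rough_modulus_in_moduli:
  assumes "C \<in> rough_moduli D x" "0 < W" "real W * x \<le> real M powr t"
  shows "W * modulus C \<in> moduli M t"
proof -
  have "real W * real (modulus C) \<le> real W * x"
    using rough_moduliD(4)[OF assms(1)] by (intro mult_left_mono) auto
  also note assms(3)
  finally show ?thesis
    using assms(2) rough_modulus_pos[OF assms(1)] by (auto simp: moduli_def Suc_le_eq)
qed

lemma sum_rough_moduli_le_sum_moduli:
  fixes f :: "nat \<Rightarrow> real"
  assumes "\<And>q. q \<in> moduli M t \<Longrightarrow> 0 \<le> f q" "0 < W" "real W * x \<le> real M powr t"
  shows "(\<Sum>C\<in>rough_moduli D x. f (W * modulus C)) \<le> (\<Sum>q\<in>moduli M t. f q)"
proof -
  have "inj_on modulus (rough_moduli D x)"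
    by (rule inj_on_subset[OF inj_on_modulus]) (auto dest: rough_moduliD)
  then have "inj_on (\<lambda>C. W * modulus C) (rough_moduli D x)"
    using assms(2) by (auto simp: inj_on_def)
  then have "(\<Sum>C\<in>rough_moduli D x. f (W * modulus C)) = (\<Sum>q\<in>(\<lambda>C. W * modulus C) ` rough_moduli D x. f q)"
    by (simp add: sum.reindex)
  also have "\<dots> \<le> (\<Sum>q\<in>moduli M t. f q)"
    using assms rough_modulus_in_moduli[OF _ assms(2,3)]
    by (intro sum_mono2) (auto simp: moduli_def intro: finite_nat_le_real)
  finally show ?thesis .
qed

lemma weighted_discrepancy_sum_le:
  fixes \<Delta> :: "nat \<Rightarrow> real" and B x t L :: real
  assumes nonneg: "\<And>q. 1 \<le> q \<Longrightarrow> 0 \<le> \<Delta> q"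
    and trivial: "\<And>q. 1 \<le> q \<Longrightarrow> q \<le> M \<Longrightarrow> \<Delta> q \<le> B * (real M * ln (real M)) / real (totient q)"
    and x: "1 \<le> x" "real (primorial D) * x \<le> real M powr t" "t \<le> 1" and M: "1 \<le> M" and B: "0 \<le> B" and L: "0 < L"
  shows "(\<Sum>C\<in>rough_moduli D x. real K ^ card C * \<Delta> (primorial D * modulus C))
    \<le> L * (\<Sum>q\<in>moduli M t. \<Delta> q) + B * (real M * ln (real M)) / L * (1 + ln x) ^ (2 * K\<^sup>2)"
proof -
  let ?q = "\<lambda>C. primorial D * modulus C" and ?B = "B * (real M * ln (real M))"
  have q: "1 \<le> ?q C" "?q C \<le> M" if "C \<in> rough_moduli D x" for C
  proof -
    have "?q C \<in> moduli M t" by (rule rough_modulus_in_moduli[OF that primorial_pos x(2)])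
    moreover have "real M powr t \<le> real M powr 1" using x(3) M by (intro powr_mono) auto
    ultimately have "1 \<le> ?q C" "real (?q C) \<le> real M" using M by (auto simp: moduli_def)
    then show "1 \<le> ?q C" "?q C \<le> M" by (simp_all only: of_nat_le_iff)
  qed
  have B': "0 \<le> ?B" using B M by simp
  have "(\<Sum>C\<in>rough_moduli D x. real K ^ card C * \<Delta> (?q C))
      \<le> L * (\<Sum>C\<in>rough_moduli D x. \<Delta> (?q C)) + ?B / L * (1 + ln x) ^ (2 * K\<^sup>2)"
  proof (rule sum_power_card_weight_le[OF x(1) L B'])
    fix C assume C: "C \<in> rough_moduli D x"
    show "0 \<le> \<Delta> (?q C)" by (rule nonneg[OF q(1)[OF C]])
    have "\<Delta> (?q C) \<le> ?B * (1 / real (totient (?q C)))" using trivial[OF q[OF C]] by simp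
    also have "\<dots> \<le> ?B * (2 ^ card C / real (modulus C))"
      by (rule mult_left_mono[OF inverse_totient_primorial_mult_modulus_le[OF C] B'])
    finally show "\<Delta> (?q C) \<le> ?B * 2 ^ card C / real (modulus C)" by simp
  qed
  also have "(\<Sum>C\<in>rough_moduli D x. \<Delta> (?q C)) \<le> (\<Sum>q\<in>moduli M t. \<Delta> q)"
    using nonneg by (intro sum_rough_moduli_le_sum_moduli x(2) primorial_pos) (auto simp: moduli_def)
  finally show ?thesis using L by simp
qed

lemma discrepancy_log_balance:
  fixes l B Ka N M lM X :: real and P m :: nat
  assumes l: "2 \<le> l" "l \<le> lM" "lM \<le> 2 * l" and "0 \<le> M" "M \<le> 3 * N" and B: "0 \<le> B" and X: "0 \<le> X" "X \<le> 2 * l"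
  defines "b \<equiv> P + 2 + m"
  defines "a \<equiv> b + m + 1"
  shows "l ^ b * (Ka * M / lM ^ a) + B * (M * lM) / l ^ b * X ^ P \<le> (3 * \<bar>Ka\<bar> + 6 * B * 2 ^ P) * N / l ^ (m + 1)"
proof -
  have "l ^ b * (Ka * M / lM ^ a) + B * (M * lM) / l ^ b * X ^ P
      \<le> l ^ b * (\<bar>Ka\<bar> * (3 * N) / l ^ a) + B * (3 * N * (2 * l)) / l ^ b * (2 * l) ^ P"
    using assms by (intro add_mono mult_mono divide_right_mono mult_left_mono frac_le power_mono) auto
  also have "l ^ b * (\<bar>Ka\<bar> * (3 * N) / l ^ a) = 3 * \<bar>Ka\<bar> * N / l ^ (m + 1)"
    using l unfolding a_def by (simp add: power_add)
  also have "B * (3 * N * (2 * l)) / l ^ b * (2 * l) ^ P = 6 * B * 2 ^ P * N / l ^ (m + 1)"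
    using l unfolding b_def by (simp add: power_add power_mult_distrib)
  finally show ?thesis by (simp add: add_divide_distrib[symmetric] distrib_right)
qed

lemma ln_bounds_of_le_3_mult:
  fixes N M :: nat
  assumes "3 \<le> N" "N \<le> M" "M \<le> 3 * N"
  shows "ln (real N) \<le> ln (real M)" "ln (real M) \<le> 2 * ln (real N)"
proof -
  show "ln (real N) \<le> ln (real M)" using assms by simp
  have "M \<le> N * N" using assms mult_le_mono1[of 3 N N] by linarith
  then have "real M \<le> real N * real N" by (simp flip: of_nat_mult)
  then have "ln (real M) \<le> ln (real N * real N)" using assms by (subst ln_le_cancel_iff) auto
  then show "ln (real M) \<le> 2 * ln (real N)" using assms by (simp add: ln_mult)
qed

lemma one_plus_ln_powr_bounds:
  fixes e y :: real
  assumes "0 < y" "1 \<le> ln y" "0 \<le> e" "e \<le> 1"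
  shows "0 \<le> 1 + ln (y powr e)" "1 + ln (y powr e) \<le> 2 * ln y"
proof -
  have "0 \<le> e * ln y" "e * ln y \<le> 1 * ln y"
    using assms mult_right_mono[of e 1 "ln y"] mult_nonneg_nonneg[of e "ln y"] by linarith+
  then show "0 \<le> 1 + ln (y powr e)" "1 + ln (y powr e) \<le> 2 * ln y" using assms by (auto simp: ln_powr)
qed

lemma weighted_discrepancy_small:
  fixes \<Delta> :: "nat \<Rightarrow> nat \<Rightarrow> real"
  assumes level: "level_of_distribution \<Delta> \<theta>"
    and nonneg: "\<And>M q. 0 < q \<Longrightarrow> 0 \<le> \<Delta> M q"
    and trivial: "\<And>M q. 1 \<le> q \<Longrightarrow> q \<le> M \<Longrightarrow> 3 \<le> M \<Longrightarrow> \<Delta> M q \<le> B * (real M * ln (real M)) / real (totient q)"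
    and e: "0 < e" "e < \<theta>" "e < 1" and B: "0 \<le> B"
  shows "\<forall>\<^sub>F N in sequentially. \<forall>M. N \<le> M \<and> M \<le> 3 * N \<longrightarrow>
     (\<Sum>C\<in>rough_moduli D (real N powr e). real K ^ card C * \<Delta> M (primorial D * modulus C)) \<le> real N / ln (real N) ^ m"
proof -
  define t where "t = (e + min \<theta> 1) / 2"
  have t: "e < t" "t < \<theta>" "t \<le> 1" using e by (auto simp: t_def min_def)
  define b where "b = 2 * K\<^sup>2 + 2 + m"
  obtain Ka where Ka: "\<And>M. 2 \<le> M \<Longrightarrow> (\<Sum>q\<in>moduli M t. \<Delta> M q) \<le> Ka * real M / ln (real M) ^ (b + m + 1)"
    using level_of_distributionD[OF level t(2), of "b + m + 1"] by auto
  define c where "c = 3 * \<bar>Ka\<bar> + 6 * B * 2 ^ (2 * K\<^sup>2)"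
  have "\<forall>\<^sub>F N in sequentially. real (primorial D) * real N powr e \<le> real N powr t"
    using t e by real_asymp
  moreover have "\<forall>\<^sub>F N in sequentially. max c 2 \<le> ln (real N)" by real_asymp
  ultimately show ?thesis using eventually_ge_at_top[of 3]
  proof eventually_elim
    case (elim N)
    let ?x = "real N powr e" and ?l = "ln (real N)"
    have l: "c \<le> ?l" "2 \<le> ?l" using elim by auto
    have ln_x_bounds: "0 \<le> 1 + ln ?x" "1 + ln ?x \<le> 2 * ?l"
      using e l elim one_plus_ln_powr_bounds[of "real N" e] by auto
    show ?case
    proof (intro allI impI)
      fix M assume M: "N \<le> M \<and> M \<le> 3 * N"
      then have M_ge_3: "3 \<le> M" using elim by simp
      note lM = ln_bounds_of_le_3_mult[OF elim(3) conjunct1[OF M] conjunct2[OF M]]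
      have "(\<Sum>C\<in>rough_moduli D ?x. real K ^ card C * \<Delta> M (primorial D * modulus C))
         \<le> ?l ^ b * (\<Sum>q\<in>moduli M t. \<Delta> M q) + B * (real M * ln (real M)) / ?l ^ b * (1 + ln ?x) ^ (2 * K\<^sup>2)"
      proof (rule weighted_discrepancy_sum_le)
        have "real N powr t \<le> real M powr t" using M t e by (intro powr_mono2) auto
        then show "real (primorial D) * ?x \<le> real M powr t" using elim by simp
        show "1 \<le> ?x" using elim e by (simp add: ge_one_powr_ge_zero)
      qed (use nonneg trivial M_ge_3 t B l in auto)
      also have "\<dots> \<le> ?l ^ b * (Ka * real M / ln (real M) ^ (b + m + 1)) + B * (real M * ln (real M)) / ?l ^ b * (1 + ln ?x) ^ (2 * K\<^sup>2)"
        using Ka[of M] M_ge_3 l by (intro add_right_mono mult_left_mono) auto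
      also have "\<dots> \<le> c * real N / ?l ^ (m + 1)"
        unfolding c_def b_def using M l lM ln_x_bounds B by (intro discrepancy_log_balance) auto
      also have "\<dots> \<le> ?l * real N / ?l ^ (m + 1)" using l by (intro divide_right_mono mult_right_mono) auto
      also have "\<dots> = real N / ?l ^ m" using l by simp
      finally show "(\<Sum>C\<in>rough_moduli D ?x. real K ^ card C * \<Delta> M (primorial D * modulus C)) \<le> real N / ?l ^ m" .
    qed
  qed
qed

section \<open>Sieve sums over a window\<close>

context tuple_sieve
begin

definition root_residues :: "nat \<Rightarrow> nat set" where
  "root_residues p = {a. a < p \<and> has_root a p}"

definition coprime_root_residues :: "nat \<Rightarrow> nat \<Rightarrow> nat set" where
  "coprime_root_residues h p = {a \<in> root_residues p. \<not> p dvd a + h}"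

lemma root_residues_eq_image:
  assumes "D < p"
  shows "root_residues p = (\<lambda>h. (p - h) mod p) ` H"
    and "h \<in> H \<Longrightarrow> coprime_root_residues h p = (\<lambda>h. (p - h) mod p) ` (H - {h})"
proof -
  have H_less: "h < p" if "h \<in> H" for h using H_le_D[OF that] assms by simp
  have root_iff: "p dvd a + h \<longleftrightarrow> a = (p - h) mod p" if "a < p" "h \<in> H" for a h
    by (rule dvd_add_iff_eq_neg_residue[OF that(1) H_less[OF that(2)]])
  show image: "root_residues p = (\<lambda>h. (p - h) mod p) ` H"
    using root_iff assms by (auto simp: root_residues_def has_root_def)
  assume h: "h \<in> H"
  have "inj_on (\<lambda>h. (p - h) mod p) H"
    by (rule inj_on_subset[OF inj_on_neg_residue]) (use H_less in auto)
  then have "(\<lambda>h. (p - h) mod p) ` (H - {h}) = root_residues p - {(p - h) mod p}"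
    using h unfolding image by (subst inj_on_image_set_diff) auto
  then show "coprime_root_residues h p = (\<lambda>h. (p - h) mod p) ` (H - {h})"
    using root_iff[OF _ h] by (auto simp: coprime_root_residues_def root_residues_def)
qed

lemma card_root_residues:
  assumes "D < p"
  shows "card (root_residues p) = k" and "h \<in> H \<Longrightarrow> card (coprime_root_residues h p) = k - 1"
proof -
  have inj: "inj_on (\<lambda>h. (p - h) mod p) H"
    by (rule inj_on_subset[OF inj_on_neg_residue]) (use H_le_D assms in force)
  then show "card (root_residues p) = k"
    unfolding root_residues_eq_image(1)[OF assms] by (simp add: card_image card_H)
  assume "h \<in> H"
  then show "card (coprime_root_residues h p) = k - 1"
    using inj_on_subset[OF inj, of "H - {h}"] finite_H card_H
    by (simp add: root_residues_eq_image(2)[OF assms] card_image)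
qed

lemma card_res_classes_rough:
  assumes C: "C \<in> rough_moduli D x" and S: "\<And>p. p \<in> C \<Longrightarrow> S p \<subseteq> {..<p} \<and> card (S p) = c"
  shows "card (res_classes W v S C) = c ^ card C"
proof -
  have "card (res_classes W v S C) = (\<Prod>p\<in>C. card (S p))"
  proof (intro card_res_classes v_less)
    fix p assume p: "p \<in> C"
    show "\<not> p dvd W" using rough_moduliD(2,3)[OF C p] by (simp add: prime_dvd_primorial_iff)
    show "S p \<subseteq> {..<p}" using S[OF p] by simp
  qed (use C in \<open>auto dest: rough_moduliD\<close>)
  then show ?thesis using S by simp
qed

lemma card_root_classes:
  assumes C: "C \<in> rough_moduli D x"
  shows "card (res_classes W v root_residues C) = k ^ card C"
    and "h \<in> H \<Longrightarrow> card (res_classes W v (coprime_root_residues h) C) = (k - 1) ^ card C"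
  using card_root_residues rough_moduliD(3)[OF C]
  by (auto intro!: card_res_classes_rough[OF C] simp: root_residues_def coprime_root_residues_def)

lemma sum_window_residues:
  fixes F :: "nat \<Rightarrow> real"
  assumes C: "C \<in> rough_moduli D x"
  shows "(\<Sum>n | n \<in> window N \<and> (\<forall>p\<in>C. n mod p \<in> S p). F n)
    = (\<Sum>a\<in>res_classes W v S C. \<Sum>n\<in>{n \<in> {N<..2 * N}. n mod (W * modulus C) = a}. F n)"
  using sum_over_res_classes[where X = "{N<..2 * N}" and C = C and W = W and v = v and S = S and F = F] primorial_pos rough_moduliD[OF C]
  by (simp add: window_def conj_assoc)

lemma sum_root_window:
  fixes F :: "nat \<Rightarrow> real"
  assumes C: "C \<in> rough_moduli D x"
  shows "(\<Sum>n\<in>root_window N C. F n)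
    = (\<Sum>a\<in>res_classes W v root_residues C. \<Sum>n\<in>{n \<in> {N<..2 * N}. n mod (W * modulus C) = a}. F n)"
proof -
  have "n mod p \<in> root_residues p \<longleftrightarrow> has_root n p" if "p \<in> C" for n p
    using rough_moduliD(2)[OF C that] prime_gt_0_nat[of p] by (simp add: root_residues_def has_root_mod)
  then have "root_window N C = {n. n \<in> window N \<and> (\<forall>p\<in>C. n mod p \<in> root_residues p)}"
    by (auto simp: root_window_def)
  then show ?thesis using sum_window_residues[OF C] by simp
qed

lemma res_classes_less: "a \<in> res_classes W v S C \<Longrightarrow> a < W * modulus C"
  by (simp add: res_classes_def)

lemma card_root_window:
  assumes C: "C \<in> rough_moduli D x"
  shows "\<bar>real (card (root_window N C)) - real N / real W * (\<Prod>p\<in>C. real k / real p)\<bar> \<le> real k ^ card C"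
proof -
  let ?A = "res_classes W v root_residues C" and ?q = "W * modulus C"
  have "real N / real W * (\<Prod>p\<in>C. real k / real p) = (\<Sum>a\<in>?A. real N / real ?q)"
    by (simp add: card_root_classes(1)[OF C] prod_divide_const_modulus)
  moreover have "real (card (root_window N C)) = (\<Sum>a\<in>?A. real (card {n \<in> {N<..2 * N}. n mod ?q = a}))"
    using sum_root_window[OF C, where N = N and F = "\<lambda>_. 1"] by simp
  ultimately have "\<bar>real (card (root_window N C)) - real N / real W * (\<Prod>p\<in>C. real k / real p)\<bar>
     = \<bar>\<Sum>a\<in>?A. real (card {n \<in> {N<..2 * N}. n mod ?q = a}) - real N / real ?q\<bar>"
    by (simp only: sum_subtractf)
  also have "\<dots> \<le> (\<Sum>a\<in>?A. 1)"
    using card_residue_interval[OF res_classes_less, where N = N and M = "2 * N"]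
    by (intro order_trans[OF sum_abs] sum_mono) simp
  also have "\<dots> = real k ^ card C" by (simp add: card_root_classes(1)[OF C])
  finally show ?thesis .
qed

lemma coprime_add_res_class:
  assumes C: "C \<in> rough_moduli D x" and h: "h \<in> H" and a: "a \<in> res_classes W v (coprime_root_residues h) C"
  shows "coprime (a + h) (W * modulus C)"
proof -
  have a_mod: "a mod W = v" and not_dvd: "\<And>p. p \<in> C \<Longrightarrow> \<not> p dvd a + h"
    using a by (auto simp: res_classes_def coprime_root_residues_def dvd_mod_add_iff)
  have "[a + h = v + h] (mod W)" using a_mod v_less by (auto simp: cong_def mod_add_left_eq)
  then have "coprime (a + h) W" using v_coprime[OF h] cong_imp_coprime[OF cong_sym] by blast
  moreover have "coprime (a + h) p" if "p \<in> C" for p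
    using prime_imp_coprime[OF rough_moduliD(2)[OF C that] not_dvd[OF that]] by (simp only: coprime_commute)
  ultimately show ?thesis by (simp add: coprime_modulus_iff rough_moduliD(1)[OF C])
qed

lemma sum_ln_prime_root_window:
  assumes C: "C \<in> rough_moduli D x" and CN: "\<And>p. p \<in> C \<Longrightarrow> p \<le> N"
  shows "(\<Sum>n\<in>root_window N C. ln_prime (n + h)) = (\<Sum>a\<in>res_classes W v (coprime_root_residues h) C.
      \<Sum>n\<in>{n \<in> {N<..2 * N}. n mod (W * modulus C) = a}. ln_prime (n + h))"
proof -
  let ?Y = "{n. n \<in> window N \<and> (\<forall>p\<in>C. n mod p \<in> coprime_root_residues h p)}"
  have residue: "n mod p \<in> coprime_root_residues h p \<longleftrightarrow> has_root n p \<and> \<not> p dvd n + h" if "p \<in> C" for n p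
    using rough_moduliD(2)[OF C that] prime_gt_0_nat[of p]
    by (simp add: coprime_root_residues_def root_residues_def has_root_mod dvd_mod_add_iff)
  have "(\<Sum>n\<in>root_window N C. ln_prime (n + h)) = (\<Sum>n\<in>?Y. ln_prime (n + h))"
  proof (rule sum.mono_neutral_right)
    show "?Y \<subseteq> root_window N C" using residue by (auto simp: root_window_def)
    show "\<forall>n\<in>root_window N C - ?Y. ln_prime (n + h) = 0"
    proof
      fix n assume "n \<in> root_window N C - ?Y"
      then obtain p where p: "p \<in> C" "p dvd n + h" and n: "N < n"
        using residue by (auto simp: root_window_def window_def)
      have "\<not> prime (n + h)"
      proof
        assume "prime (n + h)"
        then have "p = n + h" using p rough_moduliD(2)[OF C p(1)] by (simp add: primes_dvd_imp_eq)
        then show False using CN[OF p(1)] n by simp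
      qed
      then show "ln_prime (n + h) = 0" by (simp add: ln_prime_def)
    qed
  qed simp
  then show ?thesis by (simp only: sum_window_residues[OF C])
qed

lemma ln_prime_root_window_bound:
  assumes C: "C \<in> rough_moduli D x" and CN: "\<And>p. p \<in> C \<Longrightarrow> p \<le> N" and h: "h \<in> H"
  shows "\<bar>(\<Sum>n\<in>root_window N C. ln_prime (n + h)) - real N / real (totient W) * (\<Prod>p\<in>C. (real k - 1) / (real p - 1))\<bar>
    \<le> real k ^ card C * (prime_discrepancy (2 * N + h) (W * modulus C) + prime_discrepancy (N + h) (W * modulus C))"
proof -
  let ?A = "res_classes W v (coprime_root_residues h) C" and ?q = "W * modulus C"
  let ?\<Delta> = "prime_discrepancy (2 * N + h) ?q + prime_discrepancy (N + h) ?q"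
  let ?S = "\<lambda>a. \<Sum>n\<in>{n \<in> {N<..2 * N}. n mod ?q = a}. ln_prime (n + h)"
  have "0 < ?q" using primorial_pos rough_modulus_pos[OF C] by simp
  then have \<Delta>: "0 \<le> ?\<Delta>" by (simp add: prime_discrepancy_nonneg)
  have "real N / real (totient W) * (\<Prod>p\<in>C. (real k - 1) / (real p - 1)) = (\<Sum>a\<in>?A. real N / real (totient ?q))"
    using k_ge_2 by (simp add: card_root_classes(2)[OF C h] totient_primorial_mult_modulus[OF C] prod_dividef of_nat_diff)
  then have "\<bar>(\<Sum>n\<in>root_window N C. ln_prime (n + h)) - real N / real (totient W) * (\<Prod>p\<in>C. (real k - 1) / (real p - 1))\<bar>
     = \<bar>\<Sum>a\<in>?A. ?S a - real N / real (totient ?q)\<bar>"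
    by (simp only: sum_ln_prime_root_window[OF C CN] sum_subtractf)
  also have "\<dots> \<le> (\<Sum>a\<in>?A. ?\<Delta>)"
  proof (intro order_trans[OF sum_abs] sum_mono)
    fix a assume a: "a \<in> ?A"
    show "\<bar>?S a - real N / real (totient ?q)\<bar> \<le> ?\<Delta>"
      using ln_prime_progression_bound[OF res_classes_less[OF a] _ coprime_add_res_class[OF C h a], of N "2 * N"]
      by simp
  qed
  also have "\<dots> = real (k - 1) ^ card C * ?\<Delta>" by (simp add: card_root_classes(2)[OF C h])
  also have "\<dots> \<le> real k ^ card C * ?\<Delta>" using \<Delta> by (intro mult_right_mono power_mono) auto
  finally show ?thesis .
qed

lemma liouville_root_window_bound:
  assumes C: "C \<in> rough_moduli D x" and h: "h \<le> N"
  shows "\<bar>\<Sum>n\<in>root_window N C. liouville (n + h)\<bar> \<le> real k ^ card C * (2 * liouville_discrepancy (3 * N) (W * modulus C))"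
proof -
  let ?A = "res_classes W v root_residues C" and ?q = "W * modulus C"
  have "\<bar>\<Sum>n\<in>root_window N C. liouville (n + h)\<bar> \<le> (\<Sum>a\<in>?A. 2 * liouville_discrepancy (3 * N) ?q)"
    unfolding sum_root_window[OF C] using h
    by (intro order_trans[OF sum_abs] sum_mono liouville_progression_bound res_classes_less) auto
  also have "\<dots> = real k ^ card C * (2 * liouville_discrepancy (3 * N) ?q)" by (simp add: card_root_classes(1)[OF C])
  finally show ?thesis .
qed

definition coeff_bound :: "real \<Rightarrow> real \<Rightarrow> real" where
  "coeff_bound Y R = Y * (1 + ln R) ^ (2 * k)"

definition divisor_bound :: "real \<Rightarrow> real" where
  "divisor_bound x = x * (1 + ln x) ^ (16 * k)"

lemma divisor_bound_nonneg: "1 \<le> x \<Longrightarrow> 0 \<le> divisor_bound x"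
  by (simp add: divisor_bound_def)

lemma sum_selberg_weight_approx:
  assumes R: "1 \<le> R" and y: "bounded_profile R Y y"
    and error: "\<And>C. C \<in> rough_moduli D (R * R) \<Longrightarrow> \<bar>(\<Sum>n\<in>root_window N C. F n) - X * G C\<bar> \<le> real k ^ card C * err C"
  shows "\<bar>(\<Sum>n\<in>window N. selberg_weight R y n * F n) - X * selberg_form R y G\<bar>
    \<le> (coeff_bound Y R)\<^sup>2 * (\<Sum>C\<in>rough_moduli D (R * R). real (16 * k) ^ card C * err C)"
proof -
  have "0 \<le> coeff_bound Y R"
    unfolding coeff_bound_def using bounded_profile_nonneg[OF y R] R by simp
  then have "\<bar>(\<Sum>n\<in>window N. selberg_weight R y n * F n) - X * selberg_form R y G\<bar>
      \<le> (coeff_bound Y R)\<^sup>2 * (\<Sum>C\<in>rough_moduli D (R * R). 16 ^ card C * (real k ^ card C * err C))"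
    unfolding sum_selberg_weight using abs_selberg_coeff_le[OF R y] error
    by (intro selberg_form_approx) (auto simp: coeff_bound_def)
  then show ?thesis by (simp add: power_mult_distrib mult.assoc)
qed

lemma sum_power_card_le_divisor_bound:
  assumes "1 \<le> R"
  shows "(\<Sum>C\<in>rough_moduli D (R * R). real (16 * k) ^ card C) \<le> divisor_bound (R * R)"
  unfolding divisor_bound_def using assms mult_mono[of 1 R 1 R] by (intro sum_power_card_le) auto

lemma selberg_weight_sum_bound:
  assumes R: "1 \<le> R" and y: "bounded_profile R Y y"
  shows "\<bar>(\<Sum>n\<in>window N. selberg_weight R y n) - real N / real W * root_form R y\<bar>
     \<le> (coeff_bound Y R)\<^sup>2 * divisor_bound (R * R)"
proof -
  have "\<bar>(\<Sum>n\<in>window N. selberg_weight R y n * 1) - real N / real W * selberg_form R y (\<lambda>C. \<Prod>p\<in>C. real k / real p)\<bar>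
     \<le> (coeff_bound Y R)\<^sup>2 * (\<Sum>C\<in>rough_moduli D (R * R). real (16 * k) ^ card C * 1)"
    using card_root_window by (intro sum_selberg_weight_approx[OF R y]) auto
  also have "\<dots> \<le> (coeff_bound Y R)\<^sup>2 * divisor_bound (R * R)"
    using sum_power_card_le_divisor_bound[OF R] by (intro mult_left_mono) auto
  finally show ?thesis by (simp add: selberg_form_root)
qed

lemma selberg_weight_root_sum_bound:
  assumes R: "1 \<le> R" and y: "bounded_profile R Y y" and q: "prime q" "D < q"
  shows "\<bar>(\<Sum>n | n \<in> window N \<and> has_root n q. selberg_weight R y n) - real N / real W * (real k / real q * root_form_at q R y)\<bar>
     \<le> (coeff_bound Y R)\<^sup>2 * (real k * divisor_bound (R * R))"
proof -
  let ?F = "\<lambda>n. if has_root n q then 1 else 0 :: real"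
  have count: "\<bar>(\<Sum>n\<in>root_window N C. ?F n) - real N / real W * (\<Prod>p\<in>insert q C. real k / real p)\<bar>
     \<le> real k ^ card C * real k" if C: "C \<in> rough_moduli D (R * R)" for C
  proof -
    have insert: "insert q C \<in> rough_moduli D (real (modulus (insert q C)))"
      using q rough_moduliD[OF C] by (auto simp: rough_moduli_def)
    have "{n \<in> root_window N C. has_root n q} = root_window N (insert q C)"
      by (auto simp: root_window_def)
    then have "(\<Sum>n\<in>root_window N C. ?F n) = real (card (root_window N (insert q C)))"
      by (simp add: sum.inter_filter[symmetric])
    then have "\<bar>(\<Sum>n\<in>root_window N C. ?F n) - real N / real W * (\<Prod>p\<in>insert q C. real k / real p)\<bar>
       \<le> real k ^ card (insert q C)"
      using card_root_window[OF insert, of N] by simp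
    also have "\<dots> \<le> real k ^ Suc (card C)"
      using k_ge_2 rough_moduliD(1)[OF C] by (intro power_increasing) (auto simp: card_insert_if)
    finally show ?thesis by (simp add: mult.commute)
  qed
  have "\<bar>(\<Sum>n\<in>window N. selberg_weight R y n * ?F n)
      - real N / real W * selberg_form R y (\<lambda>C. \<Prod>p\<in>insert q C. real k / real p)\<bar>
     \<le> (coeff_bound Y R)\<^sup>2 * (\<Sum>C\<in>rough_moduli D (R * R). real (16 * k) ^ card C * real k)"
    using count by (intro sum_selberg_weight_approx[OF R y]) auto
  also have "\<dots> \<le> (coeff_bound Y R)\<^sup>2 * (real k * divisor_bound (R * R))"
    unfolding sum_distrib_right[symmetric] using sum_power_card_le_divisor_bound[OF R]
    by (intro mult_left_mono) (auto simp: mult.commute mult_left_mono)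
  also have "(\<Sum>n\<in>window N. selberg_weight R y n * ?F n) = (\<Sum>n | n \<in> window N \<and> has_root n q. selberg_weight R y n)"
    by (simp add: sum.inter_filter if_distrib[of "\<lambda>x. _ * x"] cong: if_cong)
  finally show ?thesis by (simp only: selberg_form_root_insert[OF q(2)])
qed

lemma selberg_weight_prime_sum_bound:
  assumes R: "1 \<le> R" and y: "bounded_profile R Y y" and h: "h \<in> H" and RN: "R * R \<le> real N"
  shows "\<bar>(\<Sum>n\<in>window N. selberg_weight R y n * ln_prime (n + h)) - real N / real (totient W) * prime_form R y\<bar>
     \<le> (coeff_bound Y R)\<^sup>2 * (\<Sum>C\<in>rough_moduli D (R * R). real (16 * k) ^ card C *
         (prime_discrepancy (2 * N + h) (W * modulus C) + prime_discrepancy (N + h) (W * modulus C)))"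
  unfolding selberg_form_prime[symmetric]
proof (rule sum_selberg_weight_approx[OF R y ln_prime_root_window_bound[OF _ _ h]])
  fix C p assume "C \<in> rough_moduli D (R * R)" "p \<in> C"
  then have "real p \<le> R * R" by (rule rough_moduli_element_le)
  then show "p \<le> N" using RN by linarith
qed

lemma selberg_weight_liouville_sum_bound:
  assumes R: "1 \<le> R" and y: "bounded_profile R Y y" and h: "h \<le> N"
  shows "\<bar>\<Sum>n\<in>window N. selberg_weight R y n * liouville (n + h)\<bar>
     \<le> (coeff_bound Y R)\<^sup>2 * (\<Sum>C\<in>rough_moduli D (R * R). real (16 * k) ^ card C *
         (2 * liouville_discrepancy (3 * N) (W * modulus C)))"
  using sum_selberg_weight_approx[OF R y, where F = "\<lambda>n. liouville (n + h)" and X = 0 and N = N]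
    liouville_root_window_bound[OF _ h] by simp

end

section \<open>Main terms\<close>

definition linear_profile :: "real \<Rightarrow> real \<Rightarrow> nat \<Rightarrow> real" where
  "linear_profile b R n = 1 + b * (ln (R / real n) / ln R)"

lemma bounded_profile_linear_profile:
  assumes "1 < R" "0 \<le> b"
  shows "bounded_profile R (1 + b) (linear_profile b R)"
  unfolding bounded_profile_def
proof (intro allI impI)
  fix n assume n: "1 \<le> n \<and> real n \<le> R"
  have "1 \<le> R / real n" "R / real n \<le> R" using assms n by (auto simp: field_simps)
  then have "0 \<le> ln (R / real n) / ln R" "ln (R / real n) / ln R \<le> 1" using assms by auto
  then have "0 \<le> b * (ln (R / real n) / ln R)" "b * (ln (R / real n) / ln R) \<le> b * 1"
    using assms by (intro mult_nonneg_nonneg mult_left_mono; simp)+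
  then show "0 \<le> linear_profile b R n \<and> linear_profile b R n \<le> 1 + b"
    unfolding linear_profile_def by linarith
qed

lemma linear_profile_mult:
  "linear_profile b R (m * n) = 1 + b / ln R * ln (R / real m / real n)"
  unfolding linear_profile_def by simp

lemma harmonic_sum_linear_ge:
  assumes x: "1 \<le> x" and \<beta>: "0 \<le> \<beta>"
  shows "ln x + \<beta> / 2 * (ln x)\<^sup>2 \<le> (\<Sum>n | 1 \<le> n \<and> real n \<le> x. (1 + \<beta> * ln (x / real n)) / real n)"
proof -
  have "ln x ^ (0 + 1) / real (0 + 1) + \<beta> * (ln x ^ (1 + 1) / real (1 + 1))
     \<le> (\<Sum>n | 1 \<le> n \<and> real n \<le> x. ln (x / real n) ^ 0 / real n) + \<beta> * (\<Sum>n | 1 \<le> n \<and> real n \<le> x. ln (x / real n) ^ 1 / real n)"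
    using \<beta> by (intro add_mono mult_left_mono log_power_sum_bounds(1)[OF x])
  also have "\<dots> = (\<Sum>n | 1 \<le> n \<and> real n \<le> x. (1 + \<beta> * ln (x / real n)) / real n)"
    unfolding sum_distrib_left sum.distrib[symmetric] by (intro sum.cong refl) (simp add: add_divide_distrib)
  finally show ?thesis by (simp add: power2_eq_square)
qed

definition totient_ratio :: "nat \<Rightarrow> real" where
  "totient_ratio n = real (totient n) / real n"

lemma totient_ratio_primorial_pos: "0 < totient_ratio (primorial D)"
  unfolding totient_ratio_def using primorial_pos totient_primorial_pos by simp

lemma prod_primes_eq_inverse_totient_ratio:
  "(\<Prod>p\<in>{p. prime p \<and> p \<le> D}. real p / (real p - 1)) = 1 / totient_ratio (primorial D)"
  unfolding totient_ratio_def primorial_def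
  by (subst totient_modulus) (auto simp: prod_dividef modulus_def)

context tuple_sieve
begin

abbreviation \<Phi> :: real where "\<Phi> \<equiv> totient_ratio W"

abbreviation root_moment :: "nat \<Rightarrow> real \<Rightarrow> real" where
  "root_moment \<equiv> sieve_moment D (\<lambda>p. real k / (real p - real k))"

abbreviation prime_moment :: "nat \<Rightarrow> real \<Rightarrow> real" where
  "prime_moment \<equiv> sieve_moment D (\<lambda>p. (real k - 1) / (real p - real k))"

definition shift_loss :: real where
  "shift_loss = exp (2 * real k / real D)"

lemma shift_loss_pos: "0 < shift_loss"
  by (simp add: shift_loss_def)

lemma density_nonneg:
  assumes "D < p"
  shows "0 \<le> real k / (real p - real k)" "0 \<le> (real k - 1) / (real p - real k)" "0 \<le> 1 / (real p - real k)"
  using rough_prime_bounds[OF assms] k_ge_2 by auto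

lemma moments_nonneg: "0 \<le> root_moment j x" "0 \<le> prime_moment j x"
  using density_nonneg by (auto intro: sieve_moment_nonneg)

lemma moments_0_ge_1:
  assumes "1 \<le> x"
  shows "1 \<le> root_moment 0 x" "1 \<le> prime_moment 0 x"
  using assms density_nonneg by (auto intro: sieve_moment_0_ge_1)

lemma root_form_linear_profile:
  assumes "1 < R"
  shows "root_form R (linear_profile b R)
    = root_moment 0 R + 2 * b * (root_moment 1 R / ln R) + b\<^sup>2 * (root_moment 2 R / (ln R)\<^sup>2)"
proof -
  let ?L = "\<lambda>C. ln (R / modulus C)"
  have "ln R \<noteq> 0" using assms by simp
  then have "root_form R (linear_profile b R)
     = (\<Sum>C\<in>rough_moduli D R. root_weight C + 2 * b / ln R * (root_weight C * ?L C) + b\<^sup>2 / (ln R)\<^sup>2 * (root_weight C * ?L C ^ 2))"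
    unfolding root_form_def
    by (intro sum.cong refl) (simp add: linear_profile_def power2_eq_square algebra_simps)
  then show ?thesis unfolding sieve_moment_def root_weight_def by (simp only: sum.distrib sum_distrib_left[symmetric]) simp
qed

lemma sum_root_weight_convolution_le:
  fixes F :: "nat \<Rightarrow> real"
  assumes F: "\<And>n. 0 \<le> F n"
    and U: "\<And>A. A \<in> rough_moduli D R \<Longrightarrow>
      (\<Sum>B\<in>rough_moduli D (R / modulus A). (\<Prod>p\<in>B. 1 / (real p - real k)) * F (modulus A * modulus B)) \<le> U (R / modulus A)"
  shows "(\<Sum>C\<in>rough_moduli D R. root_weight C * F (modulus C))
    \<le> (\<Sum>A\<in>rough_moduli D R. (\<Prod>p\<in>A. (real k - 1) / (real p - real k)) * U (R / modulus A))"
proof -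
  have "real k / (real p - real k) = (real k - 1) / (real p - real k) + 1 / (real p - real k)" for p :: nat
    by (simp add: add_divide_distrib[symmetric])
  then show ?thesis
    unfolding root_weight_def using F U density_nonneg
    by (simp only:) (intro sum_prod_add_le; simp)
qed

lemma root_moment_0_le:
  "root_moment 0 R \<le> shift_loss * (\<Phi> * prime_moment 1 R + (1 + 2 * real W) * prime_moment 0 R)"
proof -
  define U where "U x = shift_loss * (\<Phi> * ln x + (1 + 2 * real W))" for x
  have inner: "(\<Sum>B\<in>rough_moduli D x. (\<Prod>p\<in>B. 1 / (real p - real k)) * 1) \<le> U x" if x: "1 \<le> x" for x
    unfolding U_def shift_loss_def
  proof (rule sum_prod_inverse_shift_le[OF D_ge D_pos])
    fix A assume A: "A \<in> rough_moduli D x"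
    have quotient: "1 \<le> x / modulus A" "x / modulus A \<le> x"
      using rough_moduli_quotient_ge_1[OF A] rough_modulus_ge_1[OF A] x by (auto simp: divide_le_eq mult_le_cancel_left1)
    have "(\<Sum>B\<in>rough_moduli D (x / modulus A). 1 / real (modulus B))
        \<le> (\<Sum>n | (1 \<le> n \<and> coprime n W) \<and> real n \<le> x / modulus A. 1 / real n)"
      by (rule sum_modulus_le_sum_nat[OF order_refl])
        (use coprime_primorial_rough_modulus rough_modulus_pos in \<open>auto dest: rough_moduliD simp: Suc_le_eq coprime_commute\<close>)
    also have "\<dots> \<le> \<Phi> * ln (x / modulus A) + (1 + 2 * real W)"
      unfolding totient_ratio_def by (rule coprime_harmonic_sum_le[OF primorial_pos quotient(1)])
    also have "\<dots> \<le> \<Phi> * ln x + (1 + 2 * real W)"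
      using quotient totient_ratio_primorial_pos[of D] by (intro add_right_mono mult_left_mono) auto
    finally show "(\<Sum>B\<in>rough_moduli D (x / modulus A). 1 / real (modulus B) * 1) \<le> \<Phi> * ln x + (1 + 2 * real W)"
      by simp
  qed (use x totient_ratio_primorial_pos[of D] in auto)
  have "root_moment 0 R = (\<Sum>C\<in>rough_moduli D R. root_weight C * 1)" by (simp add: sieve_moment_def root_weight_def)
  also have "\<dots> \<le> (\<Sum>A\<in>rough_moduli D R. (\<Prod>p\<in>A. (real k - 1) / (real p - real k)) * U (R / modulus A))"
    by (rule sum_root_weight_convolution_le) (use inner rough_moduli_quotient_ge_1 in auto)
  also have "\<dots> = shift_loss * (\<Phi> * prime_moment 1 R + (1 + 2 * real W) * prime_moment 0 R)"
    unfolding U_def sieve_moment_def by (simp add: sum.distrib sum_distrib_left algebra_simps)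
  finally show ?thesis .
qed

lemma sum_root_weight_tail_le:
  assumes q: "1 \<le> real q"
  shows "(\<Sum>C | C \<in> rough_moduli D R \<and> R < real q * real (modulus C). root_weight C)
    \<le> shift_loss * (1 + ln (real q)) * prime_moment 0 R"
proof -
  define F :: "nat \<Rightarrow> real" where "F n = (if R < real q * real n then 1 else 0)" for n
  have inner: "(\<Sum>B\<in>rough_moduli D (R / modulus A). (\<Prod>p\<in>B. 1 / (real p - real k)) * F (modulus A * modulus B))
      \<le> shift_loss * (1 + ln (real q))" if A: "A \<in> rough_moduli D R" for A
    unfolding shift_loss_def
  proof (rule sum_prod_inverse_shift_le[OF D_ge D_pos, where F = "\<lambda>n. F (modulus A * n)"])
    fix A' assume A': "A' \<in> rough_moduli D (R / modulus A)"
    define z where "z = R / modulus A / modulus A'"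
    have "F (modulus A * (modulus A' * n)) = (if z < real q * real n then 1 else 0)" for n
      unfolding F_def z_def using rough_modulus_ge_1[OF A] rough_modulus_ge_1[OF A'] by (simp add: field_simps)
    then have "(\<Sum>B\<in>rough_moduli D z. 1 / real (modulus B) * F (modulus A * (modulus A' * modulus B)))
       = (\<Sum>B\<in>rough_moduli D z. if z < real q * real (modulus B) then 1 / real (modulus B) else 0)"
      by (intro sum.cong) auto
    also have "\<dots> = (\<Sum>B | B \<in> rough_moduli D z \<and> z < real q * real (modulus B). 1 / real (modulus B))"
      by (rule sum.inter_filter[symmetric]) simp
    also have "\<dots> \<le> (\<Sum>n | (1 \<le> n \<and> z < real q * real n) \<and> real n \<le> z. 1 / real n)"
      by (rule sum_modulus_le_sum_nat[where D = D and x = z])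
         (use rough_modulus_pos in \<open>auto dest: rough_moduliD simp: Suc_le_eq\<close>)
    also have "\<dots> \<le> 1 + ln (real q)"
      unfolding z_def by (rule harmonic_tail_le[OF rough_moduli_quotient_ge_1[OF A'] q])
    finally show "(\<Sum>B\<in>rough_moduli D (R / modulus A / modulus A'). 1 / real (modulus B) *
        F (modulus A * (modulus A' * modulus B))) \<le> 1 + ln (real q)"
      unfolding z_def .
  qed (use q in \<open>auto simp: F_def\<close>)
  have "(\<Sum>C | C \<in> rough_moduli D R \<and> R < real q * real (modulus C). root_weight C)
      = (\<Sum>C\<in>rough_moduli D R. root_weight C * F (modulus C))"
    unfolding F_def by (subst sum.inter_filter) (auto intro: sum.cong)
  also have "\<dots> \<le> (\<Sum>A\<in>rough_moduli D R. (\<Prod>p\<in>A. (real k - 1) / (real p - real k)) * (shift_loss * (1 + ln (real q))))"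
    by (rule sum_root_weight_convolution_le) (use inner in \<open>auto simp: F_def\<close>)
  also have "\<dots> = shift_loss * (1 + ln (real q)) * prime_moment 0 R"
    unfolding sieve_moment_def by (simp add: sum_distrib_left mult_ac)
  finally show ?thesis .
qed

lemma prime_inner_sum_ge:
  assumes R: "1 < R" and b: "0 \<le> b" and C: "C \<in> rough_moduli D R"
  shows "\<Phi> * (ln (R / modulus C) + b / (2 * ln R) * (ln (R / modulus C))\<^sup>2)
    \<le> (\<Prod>p\<in>C. real p / (real p - 1)) * prime_inner_sum R (linear_profile b R) C"
proof -
  define x where "x = R / modulus C"
  define F where "F n = linear_profile b R (modulus C * n)" for n
  have x: "1 \<le> x" unfolding x_def by (rule rough_moduli_quotient_ge_1[OF C])
  have \<beta>: "0 \<le> b / ln R" using R b by simp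
  have F: "F n = 1 + b / ln R * ln (x / real n)" for n
    unfolding F_def x_def by (rule linear_profile_mult)
  let ?P = "{p. prime p \<and> p \<le> D}"
  have "ln x + b / (2 * ln R) * (ln x)\<^sup>2 \<le> (\<Sum>n | 1 \<le> n \<and> real n \<le> x. F n / real n)"
    using harmonic_sum_linear_ge[OF x \<beta>] unfolding F by (simp add: mult.commute)
  also have "\<dots> \<le> (\<Prod>p\<in>?P \<union> C. real p / (real p - 1)) * prime_inner_sum R (linear_profile b R) C"
    unfolding prime_inner_sum_def x_def[symmetric] F_def[symmetric]
  proof (rule antimono_harmonic_sum_le)
    fix n :: nat assume n: "1 \<le> n" "real n \<le> x"
    then have "0 \<le> ln (x / real n)" by (simp add: field_simps)
    then show "0 \<le> F n" unfolding F using \<beta> by (intro add_nonneg_nonneg mult_nonneg_nonneg) auto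
  next
    fix m n :: nat assume mn: "1 \<le> m" "m \<le> n" "real n \<le> x"
    have "x / real n \<le> x / real m" using mn x by (intro divide_left_mono) auto
    then have "ln (x / real n) \<le> ln (x / real m)" using mn x by (subst ln_le_cancel_iff) auto
    then show "F n \<le> F m" unfolding F using \<beta> by (intro add_left_mono mult_left_mono)
  qed (use C in \<open>auto dest: rough_moduliD\<close>)
  also have "(\<Prod>p\<in>?P \<union> C. real p / (real p - 1)) = 1 / \<Phi> * (\<Prod>p\<in>C. real p / (real p - 1))"
    unfolding prod_primes_eq_inverse_totient_ratio[symmetric] using rough_moduliD(1)[OF C]
    by (intro prod.union_disjoint) (auto dest!: rough_moduliD(3)[OF C])
  finally show ?thesis
    using totient_ratio_primorial_pos[of D] by (simp add: x_def pos_le_divide_eq mult.commute)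
qed

lemma prime_form_ge:
  assumes R: "1 < R" and b: "0 \<le> b"
  shows "\<Phi>\<^sup>2 * (prime_moment 2 R + b * (prime_moment 3 R / ln R) + b\<^sup>2 / 4 * (prime_moment 4 R / (ln R)\<^sup>2))
    \<le> prime_form R (linear_profile b R)"
proof -
  have lnR: "0 < ln R" using R by simp
  let ?u = "\<lambda>C. \<Prod>p\<in>C. (real k - 1) / (real p - real k)"
  have "?u C * (\<Phi> * (t + b / (2 * ln R) * t\<^sup>2))\<^sup>2
     = \<Phi>\<^sup>2 * (?u C * t ^ 2) + \<Phi>\<^sup>2 * (b / ln R) * (?u C * t ^ 3) + \<Phi>\<^sup>2 * (b\<^sup>2 / 4 / (ln R)\<^sup>2) * (?u C * t ^ 4)" for C t
    using lnR by (simp add: power2_eq_square power3_eq_cube power4_eq_xxxx field_simps)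
  then have "\<Phi>\<^sup>2 * (prime_moment 2 R + b * (prime_moment 3 R / ln R) + b\<^sup>2 / 4 * (prime_moment 4 R / (ln R)\<^sup>2))
     = (\<Sum>C\<in>rough_moduli D R. ?u C * (\<Phi> * (ln (R / modulus C) + b / (2 * ln R) * (ln (R / modulus C))\<^sup>2))\<^sup>2)"
    unfolding sieve_moment_def by (simp only: sum.distrib sum_distrib_left[symmetric]) (simp add: algebra_simps)
  also have "\<dots> \<le> prime_form R (linear_profile b R)"
    unfolding prime_form_def
  proof (intro sum_mono mult_left_mono power_mono prime_inner_sum_ge R b)
    fix C assume C: "C \<in> rough_moduli D R"
    show "0 \<le> ?u C" by (rule prod_rough_nonneg[OF _ C]) (use density_nonneg in auto)
    show "0 \<le> \<Phi> * (ln (R / modulus C) + b / (2 * ln R) * (ln (R / modulus C))\<^sup>2)"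
      using totient_ratio_primorial_pos[of D] rough_moduli_quotient_ge_1[OF C] b lnR
      by (intro mult_nonneg_nonneg add_nonneg_nonneg) auto
  qed
  finally show ?thesis .
qed

lemma linear_profile_difference_le:
  assumes R: "1 < R" and b: "0 \<le> b" and C: "C \<in> rough_moduli D R" "q \<notin> C" and q: "prime q" "D < q"
  shows "(linear_profile b R (modulus C) - (if insert q C \<in> rough_moduli D R then linear_profile b R (q * modulus C) else 0))\<^sup>2
    \<le> b\<^sup>2 * (ln (real q) / ln R)\<^sup>2 + (if R < real q * real (modulus C) then (1 + b)\<^sup>2 else 0)"
proof (cases "insert q C \<in> rough_moduli D R")
  case True
  have "ln (R / real (q * modulus C)) = ln (R / real (modulus C)) - ln (real q)"
    using rough_modulus_pos[OF C(1)] prime_gt_0_nat[OF q(1)] R by (simp add: ln_div ln_mult)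
  then have "linear_profile b R (modulus C) - linear_profile b R (q * modulus C) = b * (ln (real q) / ln R)"
    unfolding linear_profile_def by (simp only: diff_divide_distrib right_diff_distrib)
  then have "(linear_profile b R (modulus C) - linear_profile b R (q * modulus C))\<^sup>2 = b\<^sup>2 * (ln (real q) / ln R)\<^sup>2"
    by (simp only: power_mult_distrib)
  then show ?thesis using True by simp
next
  case False
  then have "R < real q * real (modulus C)"
    using insert_in_rough_moduli_iff[OF C(1) q C(2)] by simp
  moreover have "(linear_profile b R (modulus C))\<^sup>2 \<le> (1 + b)\<^sup>2"
    using bounded_profile_modulus[OF bounded_profile_linear_profile[OF R b] C(1)] by (intro power_mono)
  ultimately show ?thesis using False by (simp add: add_increasing)
qed

lemma root_form_at_le:
  assumes R: "1 < R" and b: "0 \<le> b" and q: "prime q" "D < q" "real q \<le> R"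
  shows "root_form_at q R (linear_profile b R)
    \<le> ln (real q) * (b\<^sup>2 * (root_moment 0 R / ln R) + 2 * (1 + b)\<^sup>2 * shift_loss * prime_moment 0 R)"
proof -
  let ?t = "ln (real q) / ln R" and ?tail = "\<lambda>C. R < real q * real (modulus C)"
  have q_gt_4: "4 < real q" using q D_ge k_ge_2 by simp
  then have ln_q: "1 \<le> ln (real q)" using exp_le by (subst ln_ge_iff) auto
  have "root_form_at q R (linear_profile b R)
     \<le> (\<Sum>C | C \<in> rough_moduli D R \<and> q \<notin> C. root_weight C * (b\<^sup>2 * ?t\<^sup>2 + (if ?tail C then (1 + b)\<^sup>2 else 0)))"
    unfolding root_form_at_def using q
    by (intro sum_mono mult_left_mono linear_profile_difference_le R b) (auto intro: root_weight_nonneg)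
  also have "\<dots> \<le> (\<Sum>C\<in>rough_moduli D R. root_weight C * (b\<^sup>2 * ?t\<^sup>2 + (if ?tail C then (1 + b)\<^sup>2 else 0)))"
    by (intro sum_mono2) (auto intro!: add_nonneg_nonneg mult_nonneg_nonneg intro: root_weight_nonneg)
  also have "\<dots> = b\<^sup>2 * ?t\<^sup>2 * root_moment 0 R + (1 + b)\<^sup>2 * (\<Sum>C | C \<in> rough_moduli D R \<and> ?tail C. root_weight C)"
  proof -
    have "root_weight C * (b\<^sup>2 * ?t\<^sup>2 + (if ?tail C then (1 + b)\<^sup>2 else 0))
        = b\<^sup>2 * ?t\<^sup>2 * root_weight C + (1 + b)\<^sup>2 * (if ?tail C then root_weight C else 0)" for C
      by (simp add: distrib_left mult_ac)
    then show ?thesis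
      unfolding sieve_moment_def root_weight_def[symmetric]
      by (simp add: sum.distrib sum_distrib_left[symmetric] sum.inter_filter)
  qed
  also have "\<dots> \<le> b\<^sup>2 * ?t * root_moment 0 R + (1 + b)\<^sup>2 * (shift_loss * (2 * ln (real q)) * prime_moment 0 R)"
  proof (intro add_mono mult_right_mono mult_left_mono)
    have "0 \<le> ?t" "?t \<le> 1" using R ln_q q q_gt_4 by auto
    then show "?t\<^sup>2 \<le> ?t" using power_decreasing[of 1 2 ?t] by simp
    have "(\<Sum>C | C \<in> rough_moduli D R \<and> ?tail C. root_weight C) \<le> shift_loss * (1 + ln (real q)) * prime_moment 0 R"
      using q_gt_4 by (intro sum_root_weight_tail_le) auto
    also have "\<dots> \<le> shift_loss * (2 * ln (real q)) * prime_moment 0 R"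
      using ln_q shift_loss_pos moments_nonneg by (intro mult_right_mono mult_left_mono) auto
    finally show "(\<Sum>C | C \<in> rough_moduli D R \<and> ?tail C. root_weight C) \<le> shift_loss * (2 * ln (real q)) * prime_moment 0 R" .
  qed (use moments_nonneg in auto)
  also have "\<dots> = ln (real q) * (b\<^sup>2 * (root_moment 0 R / ln R) + 2 * (1 + b)\<^sup>2 * shift_loss * prime_moment 0 R)"
    by (simp add: algebra_simps)
  finally show ?thesis .
qed

end

section \<open>The parity inequality\<close>

lemma liouville_cases: "liouville n = 1 \<or> liouville n = -1"
  unfolding liouville_def by (cases "even (bigOmega n)") auto

lemma liouville_prime: "prime p \<Longrightarrow> liouville p = -1"
  by (simp add: liouville_def bigOmega_def prime_factorization_prime)

context tuple_sieve
begin

definition rough_tuple :: "nat \<Rightarrow> real \<Rightarrow> bool" where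
  "rough_tuple n z \<longleftrightarrow> (\<forall>q. prime q \<and> D < q \<and> real q \<le> z \<longrightarrow> \<not> has_root n q)"

definition prime_odd_pair :: "nat \<Rightarrow> bool" where
  "prime_odd_pair n \<longleftrightarrow> (\<exists>h\<in>H. \<exists>h'\<in>H. h \<noteq> h' \<and> prime (n + h) \<and> liouville (n + h') = -1)"

lemma sum_liouville_ge: "- real k \<le> (\<Sum>h\<in>H. liouville (n + h))"
proof -
  have "(\<Sum>h\<in>H. - 1) \<le> (\<Sum>h\<in>H. liouville (n + h))"
  proof (rule sum_mono)
    fix h show "- 1 \<le> liouville (n + h)" using liouville_cases[of "n + h"] by auto
  qed
  then show ?thesis using card_H by simp
qed

lemma parity_crude:
  assumes c: "0 \<le> c" "\<And>h. h \<in> H \<Longrightarrow> ln_prime (n + h) \<le> c"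
  shows "(real k - 1) * (\<Sum>h\<in>H. ln_prime (n + h)) \<le> c * (real k / 2 + 1 / 2 * (\<Sum>h\<in>H. liouville (n + h)) + (real k)\<^sup>2)"
proof -
  have "(\<Sum>h\<in>H. ln_prime (n + h)) \<le> (\<Sum>h\<in>H. c)" using c(2) by (rule sum_mono)
  then have "(real k - 1) * (\<Sum>h\<in>H. ln_prime (n + h)) \<le> (real k - 1) * (real k * c)"
    using card_H k_ge_2 by (intro mult_left_mono) auto
  also have "\<dots> = c * ((real k - 1) * real k)" by simp
  also have "\<dots> \<le> c * (real k / 2 + 1 / 2 * (\<Sum>h\<in>H. liouville (n + h)) + (real k)\<^sup>2)"
    using sum_liouville_ge[of n] c(1) by (intro mult_left_mono) (auto simp: power2_eq_square algebra_simps)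
  finally show ?thesis .
qed

lemma parity_without_pair:
  assumes c: "0 \<le> c" "\<And>h. h \<in> H \<Longrightarrow> ln_prime (n + h) \<le> c" and no_pair: "\<not> prime_odd_pair n"
  shows "(real k - 1) * (\<Sum>h\<in>H. ln_prime (n + h)) \<le> c * (real k / 2 + 1 / 2 * (\<Sum>h\<in>H. liouville (n + h)))"
proof (cases "\<exists>h\<in>H. prime (n + h)")
  case False
  then have "(\<Sum>h\<in>H. ln_prime (n + h)) = 0" by (intro sum.neutral) (auto simp: ln_prime_def)
  then show ?thesis using sum_liouville_ge[of n] c(1) by (auto intro!: mult_nonneg_nonneg)
next
  case True
  then obtain h where h: "h \<in> H" "prime (n + h)" by auto
  have others: "liouville (n + h') = 1" if "h' \<in> H - {h}" for h'
    using no_pair h that liouville_cases[of "n + h'"] unfolding prime_odd_pair_def by auto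
  then have "ln_prime (n + h') = 0" if "h' \<in> H - {h}" for h'
    using that liouville_prime[of "n + h'"] by (auto simp: ln_prime_def)
  then have sum_ln_prime: "(\<Sum>h\<in>H. ln_prime (n + h)) = ln_prime (n + h)"
    using h finite_H by (simp add: sum.remove[of H h])
  have "(\<Sum>h'\<in>H - {h}. liouville (n + h')) = (\<Sum>h'\<in>H - {h}. 1)" using others by (intro sum.cong) auto
  then have sum_liouville: "(\<Sum>h\<in>H. liouville (n + h)) = real k - 2"
    using h finite_H card_H k_ge_2 by (simp add: sum.remove[of H h] of_nat_diff liouville_prime)
  have "(real k - 1) * ln_prime (n + h) \<le> (real k - 1) * c"
    using c(2)[OF h(1)] k_ge_2 by (intro mult_left_mono) auto
  then show ?thesis unfolding sum_ln_prime sum_liouville by (simp add: field_simps)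
qed

lemma ln_prime_window_le:
  assumes "n \<in> window N" "h \<le> N"
  shows "ln_prime (n + h) \<le> ln (3 * real N)"
proof -
  have "0 < real (n + h)" "real (n + h) \<le> 3 * real N" "1 \<le> real N"
    using assms by (auto simp: window_def)
  then have "ln (real (n + h)) \<le> ln (3 * real N)" "0 \<le> ln (3 * real N)"
    by (simp_all add: ln_ge_zero del: of_nat_add)
  then show ?thesis by (simp add: ln_prime_def)
qed

lemma parity_pointwise:
  assumes n: "n \<in> window N" and HN: "\<And>h. h \<in> H \<Longrightarrow> h \<le> N" and no_pair: "\<not> (rough_tuple n z \<and> prime_odd_pair n)"
  shows "(real k - 1) * (\<Sum>h\<in>H. ln_prime (n + h))
    \<le> ln (3 * real N) * (real k / 2 + 1 / 2 * (\<Sum>h\<in>H. liouville (n + h)) + (real k)\<^sup>2 * (if rough_tuple n z then 0 else 1))"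
proof -
  have "0 \<le> ln (3 * real N)" using n by (auto simp: window_def)
  then show ?thesis
    using parity_crude[of "ln (3 * real N)" n] parity_without_pair[of "ln (3 * real N)" n]
      ln_prime_window_le[OF n HN] no_pair by (cases "rough_tuple n z") auto
qed

definition sieving_primes :: "real \<Rightarrow> nat set" where
  "sieving_primes z = {q. (prime q \<and> D < q) \<and> real q \<le> z}"

lemma finite_sieving_primes [simp]: "finite (sieving_primes z)"
  unfolding sieving_primes_def by (rule finite_nat_le_real)

lemma card_sieving_primes_le: "0 \<le> z \<Longrightarrow> real (card (sieving_primes z)) \<le> z"
proof -
  assume z: "0 \<le> z"
  have "sieving_primes z \<subseteq> {1..nat \<lfloor>z\<rfloor>}"
    using prime_ge_1_nat by (auto simp: sieving_primes_def le_nat_floor)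
  then have "card (sieving_primes z) \<le> nat \<lfloor>z\<rfloor>" using card_mono[of "{1..nat \<lfloor>z\<rfloor>}"] by simp
  then show ?thesis using z by linarith
qed

lemma sum_not_rough_le:
  "(\<Sum>n\<in>window N. if rough_tuple n z then 0 else selberg_weight R y n)
    \<le> (\<Sum>q\<in>sieving_primes z. \<Sum>n | n \<in> window N \<and> has_root n q. selberg_weight R y n)"
proof -
  let ?t = "\<lambda>n q. if has_root n q then selberg_weight R y n else 0"
  have "(\<Sum>n\<in>window N. if rough_tuple n z then 0 else selberg_weight R y n) \<le> (\<Sum>n\<in>window N. \<Sum>q\<in>sieving_primes z. ?t n q)"
  proof (rule sum_mono)
    fix n
    show "(if rough_tuple n z then 0 else selberg_weight R y n) \<le> (\<Sum>q\<in>sieving_primes z. ?t n q)"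
    proof (cases "rough_tuple n z")
      case True then show ?thesis using selberg_weight_nonneg by (auto intro: sum_nonneg)
    next
      case False
      then obtain q where q: "q \<in> sieving_primes z" "has_root n q"
        unfolding rough_tuple_def sieving_primes_def by auto
      have "?t n q \<le> (\<Sum>q\<in>sieving_primes z. ?t n q)"
        using q selberg_weight_nonneg by (intro member_le_sum) auto
      then show ?thesis using q False by simp
    qed
  qed
  also have "\<dots> = (\<Sum>q\<in>sieving_primes z. \<Sum>n | n \<in> window N \<and> has_root n q. selberg_weight R y n)"
    by (subst sum.swap, rule sum.cong[OF refl]) (simp add: sum.inter_filter)
  finally show ?thesis .
qed

lemma parity_inequality:
  assumes HN: "\<And>h. h \<in> H \<Longrightarrow> h \<le> N" and N: "1 \<le> N"
    and no_pair: "\<And>n. n \<in> window N \<Longrightarrow> \<not> (rough_tuple n z \<and> prime_odd_pair n)"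
  shows "(real k - 1) * (\<Sum>h\<in>H. \<Sum>n\<in>window N. selberg_weight R y n * ln_prime (n + h))
    \<le> ln (3 * real N) * (real k / 2 * (\<Sum>n\<in>window N. selberg_weight R y n)
       + 1 / 2 * (\<Sum>h\<in>H. \<bar>\<Sum>n\<in>window N. selberg_weight R y n * liouville (n + h)\<bar>)
       + (real k)\<^sup>2 * (\<Sum>q\<in>sieving_primes z. \<Sum>n | n \<in> window N \<and> has_root n q. selberg_weight R y n))"
proof -
  let ?w = "selberg_weight R y" and ?r = "\<lambda>n. if rough_tuple n z then 0 else 1 :: real"
  have "(real k - 1) * (\<Sum>h\<in>H. \<Sum>n\<in>window N. ?w n * ln_prime (n + h))
     = (\<Sum>n\<in>window N. ?w n * ((real k - 1) * (\<Sum>h\<in>H. ln_prime (n + h))))"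
    by (subst sum.swap) (simp add: sum_distrib_left mult_ac)
  also have "\<dots> \<le> (\<Sum>n\<in>window N. ?w n * (ln (3 * real N) *
      (real k / 2 + 1 / 2 * (\<Sum>h\<in>H. liouville (n + h)) + (real k)\<^sup>2 * ?r n)))"
    using parity_pointwise[OF _ HN no_pair] by (intro sum_mono mult_left_mono selberg_weight_nonneg)
  also have "\<dots> = ln (3 * real N) * (\<Sum>n\<in>window N. real k / 2 * ?w n
      + 1 / 2 * (?w n * (\<Sum>h\<in>H. liouville (n + h))) + (real k)\<^sup>2 * (if rough_tuple n z then 0 else ?w n))"
    unfolding sum_distrib_left[of "ln (3 * real N)"] by (intro sum.cong refl) (simp add: algebra_simps)
  also have "\<dots> = ln (3 * real N) * (real k / 2 * (\<Sum>n\<in>window N. ?w n)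
      + 1 / 2 * (\<Sum>h\<in>H. \<Sum>n\<in>window N. ?w n * liouville (n + h))
      + (real k)\<^sup>2 * (\<Sum>n\<in>window N. if rough_tuple n z then 0 else ?w n))"
  proof -
    have "(\<Sum>n\<in>window N. ?w n * (\<Sum>h\<in>H. liouville (n + h))) = (\<Sum>h\<in>H. \<Sum>n\<in>window N. ?w n * liouville (n + h))"
      unfolding sum_distrib_left by (rule sum.swap)
    then show ?thesis by (simp only: sum.distrib sum_distrib_left[symmetric])
  qed
  also have "\<dots> \<le> ln (3 * real N) * (real k / 2 * (\<Sum>n\<in>window N. ?w n)
       + 1 / 2 * (\<Sum>h\<in>H. \<bar>\<Sum>n\<in>window N. ?w n * liouville (n + h)\<bar>)
       + (real k)\<^sup>2 * (\<Sum>q\<in>sieving_primes z. \<Sum>n | n \<in> window N \<and> has_root n q. ?w n))"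
    using N by (intro mult_left_mono add_mono order_refl sum_not_rough_le sum_mono) auto
  finally show ?thesis .
qed

end

section \<open>Asymptotic evaluation\<close>

lemma eventually_polylog_le_powr:
  fixes A \<delta> :: real
  assumes "0 < \<delta>"
  shows "\<forall>\<^sub>F N in sequentially. A * (1 + ln (real N)) ^ m \<le> real N powr \<delta>"
proof -
  have "(\<lambda>N. (1 + ln (real N)) ^ m) \<in> O(\<lambda>N. ln (real N) ^ m)"
    by (rule landau_o.big_power) real_asymp
  also have "(\<lambda>N. ln (real N) ^ m) \<in> o(\<lambda>N. real N powr \<delta>)" using assms by real_asymp
  finally have "(\<lambda>N. A * (1 + ln (real N)) ^ m) \<in> o(\<lambda>N. real N powr \<delta>)" by (cases "A = 0") auto
  from landau_o.smallD[OF this zero_less_one] show ?thesis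
    by eventually_elim auto
qed

locale tuple_sieve_limit = tuple_sieve +
  fixes \<theta> \<tau> b :: real
  assumes prime_level: "level_of_distribution prime_discrepancy \<theta>"
    and liouville_level: "level_of_distribution liouville_discrepancy \<theta>"
    and \<tau>: "0 < \<tau>" "\<tau> < \<theta>" "\<tau> < 1" and b_nonneg: "0 \<le> b"
begin

definition R :: "nat \<Rightarrow> real" where
  "R N = real N powr (\<tau> / 2)"

abbreviation weight :: "nat \<Rightarrow> nat \<Rightarrow> real" where
  "weight N \<equiv> selberg_weight (R N) (linear_profile b (R N))"

definition scale :: "nat \<Rightarrow> real" where
  "scale N = real N * \<Phi> / real W * prime_moment 0 (R N) * (ln (R N))\<^sup>2"

lemma R_nonneg: "0 \<le> R N"
  by (simp add: R_def)

lemma R_square: "R N * R N = real N powr \<tau>"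
  unfolding R_def by (simp add: powr_add[symmetric])

lemma R_square_le: "1 \<le> N \<Longrightarrow> R N * R N \<le> real N"
  using \<tau> powr_mono[of \<tau> 1 "real N"] by (simp add: R_square)

lemma ln_R: "1 \<le> N \<Longrightarrow> ln (R N) = \<tau> / 2 * ln (real N)"
  unfolding R_def by (simp add: ln_powr)

lemma R_gt_1: "2 \<le> N \<Longrightarrow> 1 < R N"
  using \<tau> powr_less_mono[of 0 "\<tau> / 2" "real N"] by (simp add: R_def)

lemma R_square_ge_1: "2 \<le> N \<Longrightarrow> 1 \<le> R N * R N"
  using mult_mono[of 1 "R N" 1 "R N"] R_gt_1[of N] by simp

lemma bounded_profile_R: "2 \<le> N \<Longrightarrow> bounded_profile (R N) (1 + b) (linear_profile b (R N))"
  using R_gt_1 b_nonneg by (intro bounded_profile_linear_profile)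

lemma R_at_top: "filterlim R at_top sequentially"
  unfolding R_def using \<tau> by real_asymp

lemma ln_R_limits:
  "((\<lambda>N. 1 / ln (R N)) \<longlongrightarrow> 0) sequentially"
  "((\<lambda>N. ln (3 * real N) / ln (R N)) \<longlongrightarrow> 2 / \<tau>) sequentially"
  "((\<lambda>N. (c * ln (real N) + E) / ln (R N)) \<longlongrightarrow> 2 * c / \<tau>) sequentially"
  "((\<lambda>N. ln (3 * real N) * (1 / (ln (R N))\<^sup>2)) \<longlongrightarrow> 0) sequentially"
  unfolding R_def using \<tau> by real_asymp+

lemma scale_pos: "2 \<le> N \<Longrightarrow> 0 < scale N"
  unfolding scale_def using R_gt_1[of N] moments_0_ge_1[of "R N"] totient_ratio_primorial_pos[of D] primorial_pos[of D]
  by simp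

definition asymp_le :: "(nat \<Rightarrow> real) \<Rightarrow> real \<Rightarrow> bool" where
  "asymp_le F L \<longleftrightarrow> (\<exists>f. (f \<longlongrightarrow> L) sequentially \<and> (\<forall>\<^sub>F N in sequentially. F N \<le> scale N * f N))"

lemma asymp_leI:
  assumes "(f \<longlongrightarrow> L) sequentially"
    and "\<forall>\<^sub>F N in sequentially. F N \<le> scale N * f N + ln (3 * real N) * real N"
  shows "asymp_le F L"
proof -
  define \<nu> where "\<nu> N = ln (3 * real N) * (1 / (ln (R N))\<^sup>2)" for N
  have "((\<lambda>N. f N + real W / \<Phi> * \<nu> N) \<longlongrightarrow> L + real W / \<Phi> * 0) sequentially"
    unfolding \<nu>_def by (intro tendsto_intros assms(1) ln_R_limits)
  moreover have "\<forall>\<^sub>F N in sequentially. F N \<le> scale N * (f N + real W / \<Phi> * \<nu> N)"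
    using assms(2) eventually_ge_at_top[of 2]
  proof eventually_elim
    case (elim N)
    have "scale N * (real W / \<Phi> * \<nu> N) = ln (3 * real N) * real N * prime_moment 0 (R N)"
      unfolding scale_def \<nu>_def
      using R_gt_1[of N] elim totient_ratio_primorial_pos[of D] primorial_pos[of D] by simp
    moreover have "ln (3 * real N) * real N * 1 \<le> ln (3 * real N) * real N * prime_moment 0 (R N)"
      using R_gt_1[of N] elim moments_0_ge_1[of "R N"] by (intro mult_left_mono) auto
    ultimately show ?case using elim(1) by (simp add: distrib_left)
  qed
  ultimately show ?thesis unfolding asymp_le_def by auto
qed

lemma asymp_le_add:
  assumes "asymp_le F L" "asymp_le G M"
  shows "asymp_le (\<lambda>N. F N + G N) (L + M)"
proof -
  obtain f g where fg: "(f \<longlongrightarrow> L) sequentially" "(g \<longlongrightarrow> M) sequentially"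
    and le: "\<forall>\<^sub>F N in sequentially. F N \<le> scale N * f N" "\<forall>\<^sub>F N in sequentially. G N \<le> scale N * g N"
    using assms unfolding asymp_le_def by blast
  have "\<forall>\<^sub>F N in sequentially. F N + G N \<le> scale N * (f N + g N)"
    using le by eventually_elim (simp add: distrib_left)
  then show ?thesis unfolding asymp_le_def using tendsto_add[OF fg] by blast
qed

lemma asymp_le_cmult:
  assumes "asymp_le F L" "0 \<le> c"
  shows "asymp_le (\<lambda>N. c * F N) (c * L)"
proof -
  obtain f where f: "(f \<longlongrightarrow> L) sequentially" "\<forall>\<^sub>F N in sequentially. F N \<le> scale N * f N"
    using assms(1) unfolding asymp_le_def by blast
  have "\<forall>\<^sub>F N in sequentially. c * F N \<le> scale N * (c * f N)"
    using f(2)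
  proof eventually_elim
    case (elim N)
    then show ?case using mult_left_mono[OF elim assms(2)] by (simp only: mult.left_commute)
  qed
  then show ?thesis unfolding asymp_le_def using tendsto_mult_left[OF f(1)] by blast
qed

lemma asymp_le_sum:
  assumes "finite I" "\<And>i. i \<in> I \<Longrightarrow> asymp_le (F i) L"
  shows "asymp_le (\<lambda>N. \<Sum>i\<in>I. F i N) (real (card I) * L)"
  using assms
proof (induction I rule: finite_induct)
  case empty
  have "asymp_le (\<lambda>N. 0) 0" unfolding asymp_le_def by (intro exI[of _ "\<lambda>_. 0"]) simp
  then show ?case by simp
next
  case (insert i I)
  have "asymp_le (\<lambda>N. F i N + (\<Sum>i\<in>I. F i N)) (L + real (card I) * L)"
    using insert by (intro asymp_le_add) auto
  then show ?case using insert.hyps by (simp add: distrib_right add.commute)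
qed

lemma asymp_le_imp_eventually_neg:
  assumes "asymp_le F L" "L < 0"
  shows "\<forall>\<^sub>F N in sequentially. F N < 0"
proof -
  obtain f where f: "(f \<longlongrightarrow> L) sequentially" "\<forall>\<^sub>F N in sequentially. F N \<le> scale N * f N"
    using assms(1) unfolding asymp_le_def by blast
  show ?thesis
    using f(2) order_tendstoD(2)[OF f(1) assms(2)] eventually_ge_at_top[of 2]
  proof eventually_elim
    case (elim N)
    then show ?case using mult_pos_neg[OF scale_pos[of N], of "f N"] by linarith
  qed
qed

definition root_ratio :: "nat \<Rightarrow> nat \<Rightarrow> real" where
  "root_ratio j N = root_moment j (R N) / (root_moment 0 (R N) * ln (R N) ^ j)"

definition prime_ratio :: "nat \<Rightarrow> nat \<Rightarrow> real" where
  "prime_ratio j N = prime_moment j (R N) / (prime_moment 0 (R N) * ln (R N) ^ j)"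

lemma moment_eq_ratio:
  assumes "2 \<le> N"
  shows "root_moment j (R N) = root_ratio j N * root_moment 0 (R N) * ln (R N) ^ j"
    and "prime_moment j (R N) = prime_ratio j N * prime_moment 0 (R N) * ln (R N) ^ j"
  using R_gt_1[OF assms] moments_0_ge_1[of "R N"] by (simp_all add: root_ratio_def prime_ratio_def)

lemma ex_mertens_bound: "\<exists>E. mertens_bound E"
  using mertens_bound_of_level_of_distribution[OF prime_level] \<tau> by auto

lemma ratio_limits:
  "(root_ratio j \<longlongrightarrow> beta_ratio (real k) j) sequentially"
  "(prime_ratio j \<longlongrightarrow> beta_ratio (real k - 1) j) sequentially"
proof -
  have limit: "((\<lambda>N. sieve_moment D g j (R N) / (sieve_moment D g 0 (R N) * ln (R N) ^ j)) \<longlongrightarrow> beta_ratio \<kappa> j) sequentially"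
    if g: "g = (\<lambda>p. \<kappa> / (real p - real k))" and \<kappa>: "0 \<le> \<kappa>" for g and \<kappa> :: real
  proof -
    obtain E Z where "sieve_density D g \<kappa> E Z"
      using ex_mertens_bound sieve_density_shift[OF _ D_ge \<kappa>] unfolding g by blast
    from sieve_density.moment_ratio_limit[OF this] R_at_top show ?thesis by (rule filterlim_compose)
  qed
  show "(root_ratio j \<longlongrightarrow> beta_ratio (real k) j) sequentially"
    unfolding root_ratio_def by (rule limit) auto
  show "(prime_ratio j \<longlongrightarrow> beta_ratio (real k - 1) j) sequentially"
    unfolding prime_ratio_def by (rule limit) (use k_ge_2 in auto)
qed

definition root_prime_ratio :: "nat \<Rightarrow> real" where
  "root_prime_ratio N = shift_loss * (prime_ratio 1 N + (1 + 2 * real W) / \<Phi> * (1 / ln (R N)))"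

lemma root_prime_ratio_limit: "(root_prime_ratio \<longlongrightarrow> shift_loss / real k) sequentially"
proof -
  have "(root_prime_ratio \<longlongrightarrow> shift_loss * (beta_ratio (real k - 1) 1 + (1 + 2 * real W) / \<Phi> * 0)) sequentially"
    unfolding root_prime_ratio_def by (intro tendsto_intros ratio_limits ln_R_limits)
  then show ?thesis by (simp add: beta_ratio_def)
qed

lemma root_moment_0_le_prime_moment_0:
  assumes "2 \<le> N"
  shows "root_moment 0 (R N) \<le> \<Phi> * prime_moment 0 (R N) * ln (R N) * root_prime_ratio N"
proof -
  have "root_moment 0 (R N) \<le> shift_loss * (\<Phi> * prime_moment 1 (R N) + (1 + 2 * real W) * prime_moment 0 (R N))"
    by (rule root_moment_0_le)
  also have "\<dots> = \<Phi> * prime_moment 0 (R N) * ln (R N) * root_prime_ratio N"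
    unfolding moment_eq_ratio(2)[OF assms, of 1] root_prime_ratio_def
    using R_gt_1[OF assms] totient_ratio_primorial_pos[of D] by (simp add: field_simps)
  finally show ?thesis .
qed

lemma one_plus_ln_R_bounds:
  assumes "1 \<le> N"
  shows "0 \<le> 1 + ln (R N)" "1 + ln (R N) \<le> 1 + ln (real N)"
    and "0 \<le> 1 + ln (R N * R N)" "1 + ln (R N * R N) \<le> 1 + ln (real N)"
proof -
  have "0 \<le> ln (real N)" using assms by simp
  then have "0 \<le> \<tau> / 2 * ln (real N)" "\<tau> / 2 * ln (real N) \<le> 1 * ln (real N)"
    "0 \<le> \<tau> * ln (real N)" "\<tau> * ln (real N) \<le> 1 * ln (real N)"
    using \<tau> by (intro mult_nonneg_nonneg mult_right_mono; simp)+
  moreover have "ln (R N * R N) = \<tau> * ln (real N)"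
    unfolding R_square using assms by (simp add: ln_powr)
  ultimately show "0 \<le> 1 + ln (R N)" "1 + ln (R N) \<le> 1 + ln (real N)"
    "0 \<le> 1 + ln (R N * R N)" "1 + ln (R N * R N) \<le> 1 + ln (real N)"
    unfolding ln_R[OF assms] by linarith+
qed

lemma polynomial_error_small:
  assumes c: "\<tau> + c < 1"
  shows "\<forall>\<^sub>F N in sequentially. (coeff_bound (1 + b) (R N))\<^sup>2 * (real k * divisor_bound (R N * R N)) * real N powr c \<le> real N"
proof -
  define A where "A = (1 + b)\<^sup>2 * real k"
  have "0 < 1 - \<tau> - c" using c by simp
  from eventually_polylog_le_powr[OF this, of A "20 * k"] show ?thesis using eventually_ge_at_top[of 1]
  proof eventually_elim
    case (elim N)
    let ?l = "1 + ln (real N)"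
    note ln_bounds = one_plus_ln_R_bounds[OF elim(2)]
    have "(coeff_bound (1 + b) (R N))\<^sup>2 * (real k * divisor_bound (R N * R N)) * real N powr c
        \<le> ((1 + b) * ?l ^ (2 * k))\<^sup>2 * (real k * (R N * R N * ?l ^ (16 * k))) * real N powr c"
      unfolding coeff_bound_def divisor_bound_def using ln_bounds b_nonneg elim(2) R_nonneg
      by (intro mult_mono power_mono mult_nonneg_nonneg zero_le_power order_refl) (auto simp: R_square)
    also have "\<dots> = A * ?l ^ (20 * k) * (R N * R N * real N powr c)"
    proof -
      have "(?l ^ (2 * k))\<^sup>2 * ?l ^ (16 * k) = ?l ^ (20 * k)"
        by (simp add: power_mult[symmetric] power_add[symmetric])
      then show ?thesis unfolding A_def by (simp add: power_mult_distrib mult_ac)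
    qed
    also have "\<dots> \<le> real N powr (1 - \<tau> - c) * (R N * R N * real N powr c)"
      using elim(1) by (intro mult_right_mono) (auto simp: R_square)
    also have "\<dots> = real N" using elim(2) by (simp add: R_square powr_add[symmetric])
    finally show ?case .
  qed
qed

lemma logarithmic_error_small:
  "\<forall>\<^sub>F N in sequentially. \<forall>E. E \<le> 2 * (real N / ln (real N) ^ (4 * k + 1)) \<longrightarrow> (coeff_bound (1 + b) (R N))\<^sup>2 * E \<le> real N"
proof -
  define A where "A = (1 + b)\<^sup>2 * 2 ^ (4 * k) * 2"
  have "\<forall>\<^sub>F N in sequentially. max A 1 \<le> ln (real N)" by real_asymp
  then show ?thesis using eventually_ge_at_top[of 1]
  proof eventually_elim
    case (elim N)
    let ?l = "ln (real N)"
    have l: "A \<le> ?l" "1 \<le> ?l" using elim by auto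
    show ?case
    proof (intro allI impI)
      fix E assume E: "E \<le> 2 * (real N / ?l ^ (4 * k + 1))"
      have "(coeff_bound (1 + b) (R N))\<^sup>2 * E \<le> (coeff_bound (1 + b) (R N))\<^sup>2 * (2 * (real N / ?l ^ (4 * k + 1)))"
        using E by (rule mult_left_mono) simp
      also have "\<dots> \<le> ((1 + b) * (2 * ?l) ^ (2 * k))\<^sup>2 * (2 * (real N / ?l ^ (4 * k + 1)))"
        unfolding coeff_bound_def using one_plus_ln_R_bounds[OF elim(2)] b_nonneg l
        by (intro mult_right_mono power_mono mult_left_mono) auto
      also have "\<dots> = A * (real N / ?l)"
      proof -
        have "((2 * ?l) ^ (2 * k))\<^sup>2 = 2 ^ (4 * k) * ?l ^ (4 * k)"
          by (simp add: power_mult_distrib power_mult[symmetric])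
        then show ?thesis unfolding A_def using l by (simp add: power_mult_distrib)
      qed
      also have "\<dots> \<le> ?l * (real N / ?l)" using l by (intro mult_right_mono) auto
      also have "\<dots> = real N" using l by simp
      finally show "(coeff_bound (1 + b) (R N))\<^sup>2 * E \<le> real N" .
    qed
  qed
qed

lemma prime_discrepancy_error_small:
  "\<forall>\<^sub>F N in sequentially. \<forall>h\<in>H. (coeff_bound (1 + b) (R N))\<^sup>2 * (\<Sum>C\<in>rough_moduli D (R N * R N). real (16 * k) ^ card C *
      (prime_discrepancy (2 * N + h) (W * modulus C) + prime_discrepancy (N + h) (W * modulus C))) \<le> real N"
proof -
  have "\<forall>\<^sub>F N in sequentially. \<forall>M. N \<le> M \<and> M \<le> 3 * N \<longrightarrow> (\<Sum>C\<in>rough_moduli D (real N powr \<tau>).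
      real (16 * k) ^ card C * prime_discrepancy M (W * modulus C)) \<le> real N / ln (real N) ^ (4 * k + 1)"
    by (rule weighted_discrepancy_small[OF prime_level prime_discrepancy_nonneg prime_discrepancy_le \<tau>]) auto
  then show ?thesis using logarithmic_error_small eventually_ge_at_top[of D]
  proof eventually_elim
    case (elim N)
    show ?case
    proof
      fix h assume "h \<in> H"
      then have "h \<le> N" using H_le_D[of h] elim(3) by simp
      then show "(coeff_bound (1 + b) (R N))\<^sup>2 * (\<Sum>C\<in>rough_moduli D (R N * R N). real (16 * k) ^ card C *
          (prime_discrepancy (2 * N + h) (W * modulus C) + prime_discrepancy (N + h) (W * modulus C))) \<le> real N"
        using elim(1)[rule_format, of "2 * N + h"] elim(1)[rule_format, of "N + h"]
        by (intro elim(2)[rule_format]) (simp add: R_square distrib_left sum.distrib)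
    qed
  qed
qed

lemma liouville_discrepancy_error_small:
  "\<forall>\<^sub>F N in sequentially. (coeff_bound (1 + b) (R N))\<^sup>2 * (\<Sum>C\<in>rough_moduli D (R N * R N). real (16 * k) ^ card C *
      (2 * liouville_discrepancy (3 * N) (W * modulus C))) \<le> real N"
proof -
  have "\<forall>\<^sub>F N in sequentially. \<forall>M. N \<le> M \<and> M \<le> 3 * N \<longrightarrow> (\<Sum>C\<in>rough_moduli D (real N powr \<tau>).
      real (16 * k) ^ card C * liouville_discrepancy M (W * modulus C)) \<le> real N / ln (real N) ^ (4 * k + 1)"
    by (rule weighted_discrepancy_small[OF liouville_level liouville_discrepancy_nonneg liouville_discrepancy_le \<tau>]) auto
  then show ?thesis using logarithmic_error_small
  proof eventually_elim
    case (elim N)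
    have "(\<Sum>C\<in>rough_moduli D (R N * R N). real (16 * k) ^ card C * (2 * liouville_discrepancy (3 * N) (W * modulus C)))
       = 2 * (\<Sum>C\<in>rough_moduli D (real N powr \<tau>). real (16 * k) ^ card C * liouville_discrepancy (3 * N) (W * modulus C))"
      by (simp add: R_square sum_distrib_left mult_ac)
    then show ?case using elim(1)[rule_format, of "3 * N"] by (intro elim(2)[rule_format]) simp
  qed
qed

end

definition root_mass :: "real \<Rightarrow> real \<Rightarrow> real" where
  "root_mass \<kappa> b = 1 + 2 * b * beta_ratio \<kappa> 1 + b\<^sup>2 * beta_ratio \<kappa> 2"

definition prime_mass :: "real \<Rightarrow> real \<Rightarrow> real" where
  "prime_mass \<kappa> b = beta_ratio (\<kappa> - 1) 2 + b * beta_ratio (\<kappa> - 1) 3 + b\<^sup>2 / 4 * beta_ratio (\<kappa> - 1) 4"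

context tuple_sieve_limit
begin

lemma asymp_weight_sum:
  "asymp_le (\<lambda>N. ln (3 * real N) * (\<Sum>n\<in>window N. weight N n)) (2 / \<tau> * (shift_loss / real k * root_mass (real k) b))"
proof (rule asymp_leI)
  let ?U = "\<lambda>N. 1 + 2 * b * root_ratio 1 N + b\<^sup>2 * root_ratio 2 N"
  show "((\<lambda>N. ln (3 * real N) / ln (R N) * (root_prime_ratio N * ?U N)) \<longlongrightarrow> 2 / \<tau> * (shift_loss / real k * root_mass (real k) b)) sequentially"
    unfolding root_mass_def by (intro tendsto_intros ln_R_limits root_prime_ratio_limit ratio_limits)
  have "\<tau> + (1 - \<tau>) / 2 < 1" using \<tau> by (auto simp: field_simps)
  from polynomial_error_small[OF this]
  show "\<forall>\<^sub>F N in sequentially. ln (3 * real N) * (\<Sum>n\<in>window N. weight N n)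
      \<le> scale N * (ln (3 * real N) / ln (R N) * (root_prime_ratio N * ?U N)) + ln (3 * real N) * real N"
    using eventually_ge_at_top[of 2]
  proof eventually_elim
    case (elim N)
    note R1 = R_gt_1[OF elim(2)] and rm0 = moments_0_ge_1(1)[of "R N"]
    let ?c = "(coeff_bound (1 + b) (R N))\<^sup>2" and ?d = "divisor_bound (R N * R N)"
    have d: "0 \<le> ?d" by (rule divisor_bound_nonneg[OF R_square_ge_1[OF elim(2)]])
    have U: "0 \<le> ?U N"
      using R1 rm0 moments_nonneg b_nonneg unfolding root_ratio_def by (intro add_nonneg_nonneg mult_nonneg_nonneg) auto
    have "?c * ?d * 1 \<le> ?c * (real k * ?d) * real N powr ((1 - \<tau>) / 2)"
      using d k_ge_2 elim(2) \<tau> by (intro mult_mono mult_left_mono) (auto simp: mult_le_cancel_right1 ge_one_powr_ge_zero)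
    then have "(\<Sum>n\<in>window N. weight N n) \<le> real N / real W * root_form (R N) (linear_profile b (R N)) + real N"
      using selberg_weight_sum_bound[OF less_imp_le[OF R1] bounded_profile_R[OF elim(2)], of N] elim(1) by linarith
    also have "root_form (R N) (linear_profile b (R N)) = root_moment 0 (R N) * ?U N"
      unfolding root_form_linear_profile[OF R1] moment_eq_ratio(1)[OF elim(2), of 1] moment_eq_ratio(1)[OF elim(2), of 2]
      using R1 by (simp add: field_simps power2_eq_square)
    also have "real N / real W * (root_moment 0 (R N) * ?U N)
        \<le> real N / real W * (\<Phi> * prime_moment 0 (R N) * ln (R N) * root_prime_ratio N * ?U N)"
      using U by (intro mult_left_mono mult_right_mono root_moment_0_le_prime_moment_0 elim) auto
    also have "\<dots> = scale N / ln (R N) * (root_prime_ratio N * ?U N)"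
      unfolding scale_def using R1 by (simp add: power2_eq_square)
    finally have "ln (3 * real N) * (\<Sum>n\<in>window N. weight N n)
        \<le> ln (3 * real N) * (scale N / ln (R N) * (root_prime_ratio N * ?U N) + real N)"
      using elim(2) by (intro mult_left_mono) auto
    then show ?case by (simp add: distrib_left mult_ac)
  qed
qed

lemma asymp_prime_sum:
  assumes h: "h \<in> H"
  shows "asymp_le (\<lambda>N. - (\<Sum>n\<in>window N. weight N n * ln_prime (n + h))) (- prime_mass (real k) b)"
proof (rule asymp_leI)
  let ?L = "\<lambda>N. prime_ratio 2 N + b * prime_ratio 3 N + b\<^sup>2 / 4 * prime_ratio 4 N"
  show "((\<lambda>N. - ?L N) \<longlongrightarrow> - prime_mass (real k) b) sequentially"
    unfolding prime_mass_def by (intro tendsto_intros ratio_limits)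
  show "\<forall>\<^sub>F N in sequentially. - (\<Sum>n\<in>window N. weight N n * ln_prime (n + h)) \<le> scale N * - ?L N + ln (3 * real N) * real N"
    using prime_discrepancy_error_small eventually_ge_at_top[of 2]
  proof eventually_elim
    case (elim N)
    note R1 = R_gt_1[OF elim(2)]
    let ?F = "prime_form (R N) (linear_profile b (R N))"
    have "\<Phi>\<^sup>2 * prime_moment 0 (R N) * (ln (R N))\<^sup>2 * ?L N \<le> ?F"
      using prime_form_ge[OF R1 b_nonneg] R1
      unfolding moment_eq_ratio(2)[OF elim(2), of 2] moment_eq_ratio(2)[OF elim(2), of 3] moment_eq_ratio(2)[OF elim(2), of 4]
      by (simp add: field_simps power2_eq_square power3_eq_cube power4_eq_xxxx)
    then have "real N / real (totient W) * (\<Phi>\<^sup>2 * prime_moment 0 (R N) * (ln (R N))\<^sup>2 * ?L N) \<le> real N / real (totient W) * ?F"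
      by (intro mult_left_mono) auto
    moreover have "real N / real (totient W) * (\<Phi>\<^sup>2 * prime_moment 0 (R N) * (ln (R N))\<^sup>2 * ?L N) = scale N * ?L N"
      unfolding scale_def totient_ratio_def using primorial_pos[of D] totient_primorial_pos[of D] by (simp add: power2_eq_square)
    moreover have "\<bar>(\<Sum>n\<in>window N. weight N n * ln_prime (n + h)) - real N / real (totient W) * ?F\<bar> \<le> real N"
      using selberg_weight_prime_sum_bound[OF less_imp_le[OF R1] bounded_profile_R[OF elim(2)] h R_square_le] elim h
      by (fastforce intro: order_trans)
    moreover have "1 * real N \<le> ln (3 * real N) * real N"
      using elim(2) exp_le by (intro mult_right_mono) (auto simp: ln_ge_iff)
    ultimately show ?case by linarith
  qed
qed

lemma asymp_liouville_sum:
  assumes h: "h \<in> H"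
  shows "asymp_le (\<lambda>N. ln (3 * real N) * \<bar>\<Sum>n\<in>window N. weight N n * liouville (n + h)\<bar>) 0"
proof (rule asymp_leI)
  show "((\<lambda>N. 0) \<longlongrightarrow> (0 :: real)) sequentially" by simp
  show "\<forall>\<^sub>F N in sequentially. ln (3 * real N) * \<bar>\<Sum>n\<in>window N. weight N n * liouville (n + h)\<bar>
      \<le> scale N * 0 + ln (3 * real N) * real N"
    using liouville_discrepancy_error_small eventually_ge_at_top[of "max 2 D"]
  proof eventually_elim
    case (elim N)
    then have N: "2 \<le> N" "h \<le> N" using H_le_D[OF h] by auto
    have "\<bar>\<Sum>n\<in>window N. weight N n * liouville (n + h)\<bar> \<le> real N"
      using selberg_weight_liouville_sum_bound[OF less_imp_le[OF R_gt_1[OF N(1)]] bounded_profile_R[OF N(1)] N(2)] elim(1)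
      by (rule order_trans)
    then show ?case using N by (auto intro!: mult_left_mono)
  qed
qed

definition multiple_mass :: real where
  "multiple_mass = b\<^sup>2 * \<Phi> * (shift_loss / real k) + 2 * (1 + b)\<^sup>2 * shift_loss"

definition multiple_ratio :: "nat \<Rightarrow> real" where
  "multiple_ratio N = b\<^sup>2 * \<Phi> * root_prime_ratio N + 2 * (1 + b)\<^sup>2 * shift_loss"

lemma multiple_ratio_limit: "(multiple_ratio \<longlongrightarrow> multiple_mass) sequentially"
  unfolding multiple_ratio_def multiple_mass_def by (intro tendsto_intros root_prime_ratio_limit)

lemma multiple_ratio_nonneg:
  assumes "2 \<le> N"
  shows "0 \<le> multiple_ratio N"
proof -
  have "0 \<le> root_prime_ratio N"
    using R_gt_1[OF assms] moments_nonneg moments_0_ge_1[of "R N"] totient_ratio_primorial_pos[of D] shift_loss_pos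
    unfolding root_prime_ratio_def prime_ratio_def
    by (intro mult_nonneg_nonneg add_nonneg_nonneg divide_nonneg_nonneg) auto
  then show ?thesis
    unfolding multiple_ratio_def using totient_ratio_primorial_pos[of D] shift_loss_pos
    by (intro add_nonneg_nonneg mult_nonneg_nonneg) auto
qed

lemma root_sum_le:
  assumes N: "2 \<le> N" and q: "prime q" "D < q" "real q \<le> R N"
  shows "(\<Sum>n | n \<in> window N \<and> has_root n q. weight N n)
    \<le> real N / real W * real k * prime_moment 0 (R N) * multiple_ratio N * (ln (real q) / real q)
      + (coeff_bound (1 + b) (R N))\<^sup>2 * (real k * divisor_bound (R N * R N))"
proof -
  note R1 = R_gt_1[OF N]
  let ?F = "root_form_at q (R N) (linear_profile b (R N))"
  let ?M = "prime_moment 0 (R N) * multiple_ratio N"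
  have "root_moment 0 (R N) / ln (R N) \<le> \<Phi> * prime_moment 0 (R N) * root_prime_ratio N"
    using root_moment_0_le_prime_moment_0[OF N] R1 by (simp add: field_simps)
  then have "b\<^sup>2 * (root_moment 0 (R N) / ln (R N)) \<le> b\<^sup>2 * (\<Phi> * prime_moment 0 (R N) * root_prime_ratio N)"
    by (intro mult_left_mono) auto
  then have "ln (real q) * (b\<^sup>2 * (root_moment 0 (R N) / ln (R N)) + 2 * (1 + b)\<^sup>2 * shift_loss * prime_moment 0 (R N))
      \<le> ln (real q) * ?M"
    using q by (intro mult_left_mono) (auto simp: multiple_ratio_def algebra_simps)
  with root_form_at_le[OF R1 b_nonneg q] have "?F \<le> ln (real q) * ?M" by linarith
  then have "real N / real W * (real k / real q * ?F) \<le> real N / real W * (real k / real q * (ln (real q) * ?M))"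
    by (intro mult_left_mono) auto
  then show ?thesis
    using selberg_weight_root_sum_bound[OF less_imp_le[OF R1] bounded_profile_R[OF N] q(1,2), of N] by (simp add: mult_ac)
qed

lemma ex_sum_ln_div_sieving_primes_le:
  "\<exists>E\<ge>0. \<forall>z\<ge>1. (\<Sum>q\<in>sieving_primes z. ln (real q) / real q) \<le> ln z + E"
proof -
  obtain E0 where "mertens_bound E0" using ex_mertens_bound by blast
  from sieve_density_shift[OF this, of 0 D 1]
  obtain E Z where "sieve_density D (\<lambda>p. 1 / (real p - real 0)) 1 E Z" by auto
  then interpret reciprocal: sieve_density D "\<lambda>p. 1 / (real p - real 0)" 1 E Z .
  have "(\<Sum>q\<in>sieving_primes z. ln (real q) / real q) \<le> ln z + (E + 1)" if "1 \<le> z" for z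
    using reciprocal.sum_density_div_le[OF that] by (simp add: sieving_primes_def)
  moreover have "0 \<le> E + 1" using order_trans[OF abs_ge_zero reciprocal.dimension[of 0]] by simp
  ultimately show ?thesis by blast
qed

lemma root_sum_over_sieving_primes_le:
  assumes N: "2 \<le> N" and c: "0 < c" "c \<le> \<tau> / 2"
    and E: "\<And>z. 1 \<le> z \<Longrightarrow> (\<Sum>q\<in>sieving_primes z. ln (real q) / real q) \<le> ln z + E"
  shows "(\<Sum>q\<in>sieving_primes (real N powr c). \<Sum>n | n \<in> window N \<and> has_root n q. weight N n)
    \<le> real N / real W * real k * prime_moment 0 (R N) * multiple_ratio N * (c * ln (real N) + E)
      + (coeff_bound (1 + b) (R N))\<^sup>2 * (real k * divisor_bound (R N * R N)) * real N powr c"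
proof -
  let ?z = "real N powr c" and ?e = "(coeff_bound (1 + b) (R N))\<^sup>2 * (real k * divisor_bound (R N * R N))"
  let ?m = "real N / real W * real k * prime_moment 0 (R N) * multiple_ratio N"
  have z: "1 \<le> ?z" "?z \<le> R N" "ln ?z = c * ln (real N)"
    using c N by (auto simp: R_def ge_one_powr_ge_zero ln_powr intro: powr_mono)
  have "0 \<le> ?m" using multiple_ratio_nonneg[OF N] moments_nonneg by (intro mult_nonneg_nonneg) auto
  have "0 \<le> ?e" using divisor_bound_nonneg[OF R_square_ge_1[OF N]] by simp
  have "(\<Sum>q\<in>sieving_primes ?z. \<Sum>n | n \<in> window N \<and> has_root n q. weight N n)
      \<le> (\<Sum>q\<in>sieving_primes ?z. ?m * (ln (real q) / real q) + ?e)"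
    using z by (intro sum_mono root_sum_le[OF N]) (auto simp: sieving_primes_def)
  also have "\<dots> = ?m * (\<Sum>q\<in>sieving_primes ?z. ln (real q) / real q) + ?e * real (card (sieving_primes ?z))"
    unfolding sum.distrib sum_distrib_left[symmetric] sum_constant by (simp only: mult_ac)
  also have "\<dots> \<le> ?m * (c * ln (real N) + E) + ?e * ?z"
    using E[OF z(1)] z card_sieving_primes_le[of ?z] \<open>0 \<le> ?m\<close> \<open>0 \<le> ?e\<close> by (intro add_mono mult_left_mono) auto
  finally show ?thesis .
qed

lemma asymp_root_sum:
  assumes c: "0 < c" "\<tau> + c < 1" "c \<le> \<tau> / 2"
  shows "asymp_le (\<lambda>N. ln (3 * real N) * (\<Sum>q\<in>sieving_primes (real N powr c). \<Sum>n | n \<in> window N \<and> has_root n q. weight N n))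
    (real k / \<Phi> * (2 / \<tau>) * (2 * c / \<tau>) * multiple_mass)"
proof -
  obtain E where E: "\<And>z. 1 \<le> z \<Longrightarrow> (\<Sum>q\<in>sieving_primes z. ln (real q) / real q) \<le> ln z + E"
    using ex_sum_ln_div_sieving_primes_le by blast
  let ?f = "\<lambda>N. real k / \<Phi> * (ln (3 * real N) / ln (R N)) * ((c * ln (real N) + E) / ln (R N)) * multiple_ratio N"
  let ?T = "\<lambda>N. \<Sum>q\<in>sieving_primes (real N powr c). \<Sum>n | n \<in> window N \<and> has_root n q. weight N n"
  have "\<forall>\<^sub>F N in sequentially. ln (3 * real N) * ?T N \<le> scale N * ?f N + ln (3 * real N) * real N"
    using polynomial_error_small[OF c(2)] eventually_ge_at_top[of 2]
  proof eventually_elim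
    case (elim N)
    let ?m = "real N / real W * real k * prime_moment 0 (R N) * multiple_ratio N"
    have "?T N \<le> ?m * (c * ln (real N) + E) + real N"
      using root_sum_over_sieving_primes_le[OF elim(2) c(1,3) E] elim(1) by linarith
    then have "ln (3 * real N) * ?T N \<le> ln (3 * real N) * (?m * (c * ln (real N) + E) + real N)"
      using elim(2) by (intro mult_left_mono) auto
    also have "\<dots> = scale N * ?f N + ln (3 * real N) * real N"
      unfolding scale_def using R_gt_1[OF elim(2)] totient_ratio_primorial_pos[of D]
      by (simp add: distrib_left power2_eq_square mult_ac)
    finally show ?case .
  qed
  moreover have "(?f \<longlongrightarrow> real k / \<Phi> * (2 / \<tau>) * (2 * c / \<tau>) * multiple_mass) sequentially"
    by (intro tendsto_intros ln_R_limits multiple_ratio_limit)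
  ultimately show ?thesis by (intro asymp_leI)
qed

definition parity_excess :: "real \<Rightarrow> nat \<Rightarrow> real" where
  "parity_excess c N = real k / 2 * (ln (3 * real N) * (\<Sum>n\<in>window N. weight N n))
    + 1 / 2 * (\<Sum>h\<in>H. ln (3 * real N) * \<bar>\<Sum>n\<in>window N. weight N n * liouville (n + h)\<bar>)
    + (real k)\<^sup>2 * (ln (3 * real N) *
        (\<Sum>q\<in>sieving_primes (real N powr c). \<Sum>n | n \<in> window N \<and> has_root n q. weight N n))
    + (real k - 1) * (\<Sum>h\<in>H. - (\<Sum>n\<in>window N. weight N n * ln_prime (n + h)))"

definition parity_excess_limit :: "real \<Rightarrow> real" where
  "parity_excess_limit c = real k / 2 * (2 / \<tau> * (shift_loss / real k * root_mass (real k) b)) + 1 / 2 * (real k * 0)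
    + (real k)\<^sup>2 * (real k / \<Phi> * (2 / \<tau>) * (2 * c / \<tau>) * multiple_mass)
    + (real k - 1) * (real k * - prime_mass (real k) b)"

lemma asymp_parity_excess:
  assumes c: "0 < c" "\<tau> + c < 1" "c \<le> \<tau> / 2"
  shows "asymp_le (parity_excess c) (parity_excess_limit c)"
proof -
  have "asymp_le (\<lambda>N. \<Sum>h\<in>H. ln (3 * real N) * \<bar>\<Sum>n\<in>window N. weight N n * liouville (n + h)\<bar>) (real k * 0)"
    using asymp_le_sum[OF finite_H asymp_liouville_sum] by (simp only: card_H)
  moreover have "asymp_le (\<lambda>N. \<Sum>h\<in>H. - (\<Sum>n\<in>window N. weight N n * ln_prime (n + h))) (real k * - prime_mass (real k) b)"
    using asymp_le_sum[OF finite_H asymp_prime_sum] by (simp only: card_H)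
  ultimately show ?thesis
    unfolding parity_excess_def parity_excess_limit_def using k_ge_2
    by (intro asymp_le_add asymp_le_cmult asymp_weight_sum asymp_root_sum[OF c]) auto
qed

lemma ex_parity_excess_limit_neg:
  assumes gap: "shift_loss * root_mass (real k) b < \<tau> * (real k * (real k - 1) * prime_mass (real k) b)"
  obtains c where "0 < c" "\<tau> + c < 1" "c \<le> \<tau> / 2" "parity_excess_limit c < 0"
proof -
  have "parity_excess_limit 0
      = (shift_loss * root_mass (real k) b - \<tau> * (real k * (real k - 1) * prime_mass (real k) b)) / \<tau>"
    unfolding parity_excess_limit_def using \<tau> k_ge_2 by (simp add: field_simps)
  then have "parity_excess_limit 0 < 0" using gap \<tau> by (simp add: divide_neg_pos)
  moreover have "(parity_excess_limit \<longlongrightarrow> parity_excess_limit 0) (at_right 0)"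
    unfolding parity_excess_limit_def using \<tau> by (intro tendsto_intros) auto
  ultimately have "\<forall>\<^sub>F c in at_right 0. parity_excess_limit c < 0" using order_tendstoD(2) by blast
  moreover have "\<forall>\<^sub>F c in at_right 0. c < min (1 - \<tau>) (\<tau> / 2)"
    using \<tau> by (intro order_tendstoD(2)[OF tendsto_ident_at]) auto
  ultimately have "\<forall>\<^sub>F c in at_right 0. parity_excess_limit c < 0 \<and> c < min (1 - \<tau>) (\<tau> / 2) \<and> 0 < c"
    using eventually_at_right_less[of 0] by eventually_elim auto
  then obtain c where "parity_excess_limit c < 0 \<and> c < min (1 - \<tau>) (\<tau> / 2) \<and> 0 < c"
    using eventually_happens'[of "at_right (0 :: real)"] by force
  then show ?thesis by (intro that[of c]) auto
qed

lemma parity_excess_nonneg: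
  assumes N: "1 \<le> N" "D \<le> N"
    and no_pair: "\<And>n. n \<in> window N \<Longrightarrow> rough_tuple n (real N powr c) \<Longrightarrow> \<not> prime_odd_pair n"
  shows "0 \<le> parity_excess c N"
proof -
  have "(real k - 1) * (\<Sum>h\<in>H. \<Sum>n\<in>window N. weight N n * ln_prime (n + h))
    \<le> ln (3 * real N) * (real k / 2 * (\<Sum>n\<in>window N. weight N n)
      + 1 / 2 * (\<Sum>h\<in>H. \<bar>\<Sum>n\<in>window N. weight N n * liouville (n + h)\<bar>)
      + (real k)\<^sup>2 * (\<Sum>q\<in>sieving_primes (real N powr c). \<Sum>n | n \<in> window N \<and> has_root n q. weight N n))"
    using N H_le_D no_pair by (intro parity_inequality) force+
  then show ?thesis unfolding parity_excess_def by (simp add: sum_distrib_left[symmetric] sum_negf algebra_simps)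
qed

theorem ex_prime_odd_pair:
  assumes gap: "shift_loss * root_mass (real k) b < \<tau> * (real k * (real k - 1) * prime_mass (real k) b)"
  shows "\<exists>c>0. \<forall>\<^sub>F N in sequentially. \<exists>n\<in>window N. rough_tuple n (real N powr c) \<and> prime_odd_pair n"
proof -
  obtain c where c: "0 < c" "\<tau> + c < 1" "c \<le> \<tau> / 2" "parity_excess_limit c < 0"
    using ex_parity_excess_limit_neg[OF gap] by blast
  from asymp_le_imp_eventually_neg[OF asymp_parity_excess[OF c(1-3)] c(4)]
  have "\<forall>\<^sub>F N in sequentially. \<exists>n\<in>window N. rough_tuple n (real N powr c) \<and> prime_odd_pair n"
    using eventually_ge_at_top[of "max 1 D"]
  proof eventually_elim
    case (elim N)
    then show ?case using parity_excess_nonneg[of N c] by (meson max.boundedE not_le)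
  qed
  then show ?thesis using c(1) by blast
qed

end

section \<open>Almost primes next to primes\<close>

definition admissible :: "nat set \<Rightarrow> bool" where
  "admissible H \<longleftrightarrow> (\<forall>p. prime p \<longrightarrow> (\<exists>a. \<forall>h\<in>H. \<not> p dvd a + h))"

lemma admissibleI_card:
  assumes "finite H" "\<And>p. prime p \<Longrightarrow> p \<le> card H \<Longrightarrow> \<exists>a. \<forall>h\<in>H. \<not> p dvd a + h"
  shows "admissible H"
  unfolding admissible_def
proof (intro allI impI)
  fix p :: nat assume p: "prime p"
  show "\<exists>a. \<forall>h\<in>H. \<not> p dvd a + h"
  proof (cases "p \<le> card H")
    case False
    let ?r = "\<lambda>h. (p - h mod p) mod p"
    have "card (?r ` H) < card {..<p}"
      using False card_image_le[OF assms(1), of ?r] by simp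
    then have "\<not> {..<p} \<subseteq> ?r ` H"
      using assms(1) by (auto dest!: card_mono[rotated])
    then obtain a where a: "a < p" "a \<notin> ?r ` H" by auto
    have "\<not> p dvd a + h" if "h \<in> H" for h
    proof -
      have "p dvd a + h mod p \<longleftrightarrow> a = ?r h"
        using a(1) p by (intro dvd_add_iff_eq_neg_residue) (auto simp: prime_gt_0_nat)
      then show ?thesis using a(2) that dvd_mod_add_iff[of p h a] by (auto simp: add.commute)
    qed
    then show ?thesis by blast
  qed (use assms(2) p in blast)
qed

lemma admissible_set_listI:
  assumes "\<forall>p\<in>set [2..<Suc (length hs)]. \<exists>a\<in>set [0..<p]. \<forall>h\<in>set hs. \<not> p dvd a + h"
  shows "admissible (set hs)"
proof (rule admissibleI_card)
  fix p assume p: "prime p" "p \<le> card (set hs)"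
  have "p \<le> length hs" using p(2) card_length by (rule order_trans)
  then have "p \<in> set [2..<Suc (length hs)]" using prime_ge_2_nat[OF p(1)] by (auto simp: less_Suc_eq_le)
  then show "\<exists>a. \<forall>h\<in>set hs. \<not> p dvd a + h" using assms by blast
qed simp

lemma admissible_imp_coprime_residue:
  assumes "admissible H"
  obtains v where "v < primorial D" "\<And>h. h \<in> H \<Longrightarrow> coprime (v + h) (primorial D)"
proof -
  let ?C = "{p. prime p \<and> p \<le> D}" and ?S = "\<lambda>p. {a. a < p \<and> (\<forall>h\<in>H. \<not> p dvd a + h)}"
  have "card (?S p) \<noteq> 0" if "p \<in> ?C" for p
  proof -
    obtain a where a: "\<forall>h\<in>H. \<not> p dvd a + h" using assms \<open>p \<in> ?C\<close> unfolding admissible_def by blast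
    have "a mod p \<in> ?S p" using a that by (auto simp: dvd_mod_add_iff prime_gt_0_nat)
    then show ?thesis by (auto simp: card_eq_0_iff)
  qed
  moreover have "card (res_classes 1 0 ?S ?C) = (\<Prod>p\<in>?C. card (?S p))"
    by (rule card_res_classes) auto
  ultimately have "card (res_classes 1 0 ?S ?C) \<noteq> 0" by simp
  then have "res_classes 1 0 ?S ?C \<noteq> {}" by auto
  then obtain v where v: "v \<in> res_classes 1 0 ?S ?C" by blast
  show ?thesis
  proof (rule that)
    show "v < primorial D" using v by (simp add: res_classes_def primorial_def)
    fix h assume h: "h \<in> H"
    have "coprime (v + h) p" if p: "p \<in> ?C" for p
    proof -
      have "\<not> p dvd v + h" using v p h by (auto simp: res_classes_def dvd_mod_add_iff)
      then show ?thesis using p prime_imp_coprime[of p "v + h"] by (simp add: coprime_commute)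
    qed
    then show "coprime (v + h) (primorial D)" unfolding primorial_def by (simp add: coprime_modulus_iff)
  qed
qed

lemma power_bigOmega_le:
  assumes "0 < m" "0 \<le> z" "\<And>q. prime q \<Longrightarrow> q dvd m \<Longrightarrow> z \<le> real q"
  shows "z ^ bigOmega m \<le> real m"
proof -
  have "z ^ size A \<le> real (prod_mset A)" if "\<And>q. q \<in># A \<Longrightarrow> z \<le> real q" for A :: "nat multiset"
    using that
  proof (induction A)
    case (add q A)
    have "z * z ^ size A \<le> real q * real (prod_mset A)"
      using add assms(2) by (intro mult_mono) auto
    then show ?case by simp
  qed simp
  from this[of "prime_factorization m"] show ?thesis
    using assms by (simp add: bigOmega_def prime_factors_dvd prod_mset_prime_factorization_nat)
qed

lemma least_prime_factor_gt:
  assumes "1 < m" "\<And>q. prime q \<Longrightarrow> q dvd m \<Longrightarrow> z < real q"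
  shows "z < real (least_prime_factor m)"
proof -
  obtain q where "prime q" "q dvd m" using prime_factor_nat[of m] assms(1) by auto
  then have "q \<in> prime_factors m" using assms(1) by (simp add: prime_factors_dvd)
  then have "least_prime_factor m \<in> prime_factors m"
    unfolding least_prime_factor_def by (intro Min_in) auto
  then show ?thesis using assms(2) by auto
qed

lemma bigOmega_le_of_rough:
  assumes c: "0 < c" and N: "1 < N" and m: "1 < m" "real m \<le> real N powr a"
    and rough: "\<And>q. prime q \<Longrightarrow> q dvd m \<Longrightarrow> real N powr c < real q"
  shows "real (bigOmega m) \<le> a / c"
proof -
  have "(real N powr c) ^ bigOmega m \<le> real m"
    using m(1) rough by (intro power_bigOmega_le) (auto intro: less_imp_le)
  also have "(real N powr c) ^ bigOmega m = real N powr (c * real (bigOmega m))"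
    using N by (simp add: powr_realpow[symmetric] powr_powr)
  finally have "real N powr (c * real (bigOmega m)) \<le> real N powr a" using m(2) by linarith
  then have "c * real (bigOmega m) \<le> a" using N by (subst (asm) powr_le_cancel_iff) auto
  then show ?thesis using c by (simp add: field_simps)
qed

definition almost_prime_shifts :: "real \<Rightarrow> int \<Rightarrow> int \<Rightarrow> nat set" where
  "almost_prime_shifts c \<omega> d = {p. prime p \<and> int p + d > 1
     \<and> real (least_prime_factor (nat (int p + d))) > real p powr c
     \<and> int (bigOmega (nat (int p + d))) = \<omega>}"

context tuple_sieve
begin

lemma rough_tuple_prime_factor_gt:
  assumes n: "n \<in> window N" and rough: "rough_tuple n z" and h: "h \<in> H" and q: "prime q" "q dvd n + h"
  shows "z < real q"
proof (rule ccontr)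
  assume z: "\<not> z < real q"
  have "has_root n q" unfolding has_root_def using h q by auto
  then have "q \<le> D" using rough q(1) z unfolding rough_tuple_def by (meson linorder_not_le order_le_less)
  then have qW: "q dvd W" using q by (simp add: prime_dvd_primorial_iff)
  have "[n + h = v + h] (mod W)" using n v_less by (auto simp: window_def cong_def mod_add_left_eq)
  then have "[n + h = v + h] (mod q)" using qW by (rule cong_dvd_modulus_nat)
  then have "q dvd v + h" using q by (simp add: cong_dvd_iff)
  then have "is_unit q" using v_coprime[OF h] qW by (meson coprime_common_divisor)
  then show False using q by simp
qed

lemma prime_odd_pair_almost_prime_shift:
  assumes c: "0 < c" and n: "n \<in> window N" and rough: "rough_tuple n (real N powr c)" and pair: "prime_odd_pair n"
    and N: "3 \<le> N" "D \<le> N"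
  obtains h h' \<omega> where "h \<in> H" "h' \<in> H" "h \<noteq> h'" "odd \<omega>" "0 \<le> \<omega>" "real_of_int \<omega> \<le> 2 / c"
    "n + h \<in> almost_prime_shifts (c / 2) \<omega> (int h' - int h)"
proof -
  obtain h h' where h: "h \<in> H" "h' \<in> H" "h \<noteq> h'" "prime (n + h)" "liouville (n + h') = -1"
    using pair unfolding prime_odd_pair_def by blast
  have range: "N < n" "n \<le> 2 * N" using n by (auto simp: window_def)
  have sq: "real (n + j) \<le> real N powr 2" if "j \<in> H" for j
  proof -
    have "n + j \<le> 3 * N" using range H_le_D[OF that] N by simp
    also have "\<dots> \<le> N * N" using N by simp
    finally have "real (n + j) \<le> real (N * N)" by (simp only: of_nat_le_iff)
    also have "\<dots> = real N powr 2" using N by (simp add: power2_eq_square)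
    finally show ?thesis .
  qed
  have factor_gt: "real N powr c < real q" if "prime q" "q dvd n + h'" for q
    using rough_tuple_prime_factor_gt[OF n rough h(2) that] .
  have "real (n + h) powr (c / 2) \<le> (real N powr 2) powr (c / 2)"
    using c sq[OF h(1)] by (intro powr_mono2) auto
  also have "\<dots> = real N powr c" by (simp add: powr_powr del: powr_numeral)
  also have "\<dots> < real (least_prime_factor (n + h'))"
    using range N factor_gt by (intro least_prime_factor_gt) auto
  finally have "n + h \<in> almost_prime_shifts (c / 2) (int (bigOmega (n + h'))) (int h' - int h)"
    using h(4) range N by (simp add: almost_prime_shifts_def nat_add_distrib)
  moreover have "real (bigOmega (n + h')) \<le> 2 / c"
    using range N sq[OF h(2)] by (intro bigOmega_le_of_rough[OF c _ _ _ factor_gt]) auto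
  moreover have "odd (bigOmega (n + h'))" using h(5) by (auto simp: liouville_def)
  ultimately show ?thesis using h by (intro that[of h h' "int (bigOmega (n + h'))"]) auto
qed

end

lemma infinite_fibre_of_unbounded:
  fixes T :: "'i \<Rightarrow> nat set"
  assumes "finite I" "\<And>m. \<exists>p>m. \<exists>i\<in>I. p \<in> T i"
  obtains i where "i \<in> I" "infinite (T i)"
proof -
  have "infinite (\<Union>i\<in>I. T i)" using assms(2) by (auto simp: infinite_nat_iff_unbounded)
  then show ?thesis using that assms(1) by (auto simp: finite_UN)
qed

lemma (in tuple_sieve) infinite_almost_prime_shifts_of_prime_odd_pairs:
  assumes c: "0 < c" and pairs: "\<forall>\<^sub>F N in sequentially. \<exists>n\<in>window N. rough_tuple n (real N powr c) \<and> prime_odd_pair n"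
    and H: "\<And>h. h \<in> H \<Longrightarrow> even h" "\<And>h. h \<in> H \<Longrightarrow> int h \<le> \<Delta>"
  obtains \<omega> d where "odd \<omega>" "even d" "0 < \<bar>d\<bar>" "\<bar>d\<bar> \<le> \<Delta>" "infinite (almost_prime_shifts (c / 2) \<omega> d)"
proof -
  define I where "I = {(\<omega>, d). odd \<omega> \<and> 0 \<le> \<omega> \<and> \<omega> \<le> \<lfloor>2 / c\<rfloor> \<and> even d \<and> 0 < \<bar>d\<bar> \<and> \<bar>d\<bar> \<le> \<Delta>}"
  have "finite I"
    by (rule finite_subset[of _ "{0..\<lfloor>2 / c\<rfloor>} \<times> {-\<Delta>..\<Delta>}"]) (auto simp: I_def)
  moreover have "\<exists>p>m. \<exists>i\<in>I. p \<in> almost_prime_shifts (c / 2) (fst i) (snd i)" for m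
  proof -
    have "\<forall>\<^sub>F N in sequentially. (\<exists>n\<in>window N. rough_tuple n (real N powr c) \<and> prime_odd_pair n) \<and> max (max 3 D) m \<le> N"
      using pairs by (intro eventually_conj eventually_ge_at_top)
    then obtain N n where n: "n \<in> window N" "rough_tuple n (real N powr c)" "prime_odd_pair n"
      and N: "3 \<le> N" "D \<le> N" "m \<le> N"
      using eventually_happens'[OF sequentially_bot] by fastforce
    obtain h h' \<omega> where shift: "h \<in> H" "h' \<in> H" "h \<noteq> h'" "odd \<omega>" "0 \<le> \<omega>" "real_of_int \<omega> \<le> 2 / c"
      "n + h \<in> almost_prime_shifts (c / 2) \<omega> (int h' - int h)"
      using prime_odd_pair_almost_prime_shift[OF c n N(1,2)] by blast
    have "(\<omega>, int h' - int h) \<in> I"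
      unfolding I_def using shift H[of h] H[of h'] by (auto simp: le_floor_iff)
    moreover have "m < n + h" using n N by (auto simp: window_def)
    ultimately show ?thesis using shift(7) by (metis fst_conv snd_conv)
  qed
  ultimately obtain i where "i \<in> I" "infinite (almost_prime_shifts (c / 2) (fst i) (snd i))"
    by (rule infinite_fibre_of_unbounded)
  then show ?thesis using that unfolding I_def by auto
qed

definition critical_level :: "real \<Rightarrow> real \<Rightarrow> real" where
  "critical_level \<kappa> b = root_mass \<kappa> b / (\<kappa> * (\<kappa> - 1) * prime_mass \<kappa> b)"

lemma critical_level_denominator_pos:
  assumes "1 < \<kappa>" "0 \<le> b"
  shows "0 < \<kappa> * (\<kappa> - 1) * prime_mass \<kappa> b"
  unfolding prime_mass_def using assms beta_ratio_pos[of "\<kappa> - 1"]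
  by (intro mult_pos_pos add_pos_nonneg mult_nonneg_nonneg) (auto simp: less_imp_le)

lemma critical_level_nonneg:
  assumes "1 < \<kappa>" "0 \<le> b"
  shows "0 \<le> critical_level \<kappa> b"
  unfolding critical_level_def root_mass_def using assms critical_level_denominator_pos[OF assms]
  by (intro divide_nonneg_pos add_nonneg_nonneg mult_nonneg_nonneg less_imp_le[OF beta_ratio_pos]) auto

lemma ex_tuple_sieve:
  assumes "finite H" "2 \<le> card H" "admissible H" "2 * card H \<le> D" "\<And>h. h \<in> H \<Longrightarrow> h \<le> D"
  obtains v where "tuple_sieve H (card H) D v"
proof -
  obtain v where "v < primorial D" "\<And>h. h \<in> H \<Longrightarrow> coprime (v + h) (primorial D)"
    using admissible_imp_coprime_residue[OF assms(3)] by blast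
  then have "tuple_sieve H (card H) D v" using assms by unfold_locales auto
  then show ?thesis by (rule that)
qed

theorem infinite_almost_prime_shifts:
  assumes A: "condA \<theta>" and B: "condB \<theta>"
    and H: "finite H" "2 \<le> card H" "admissible H" "\<And>h. h \<in> H \<Longrightarrow> even h" "\<And>h. h \<in> H \<Longrightarrow> int h \<le> \<Delta>"
    and b: "0 \<le> b" and level: "critical_level (real (card H)) b < \<theta>" "critical_level (real (card H)) b < 1"
  obtains c \<omega> d where "0 < c" "odd \<omega>" "even d" "0 < \<bar>d\<bar>" "\<bar>d\<bar> \<le> \<Delta>" "infinite (almost_prime_shifts c \<omega> d)"
proof -
  let ?k = "real (card H)"
  let ?P = "?k * (?k - 1) * prime_mass ?k b"
  have P: "0 < ?P" using H b by (intro critical_level_denominator_pos) auto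
  obtain \<tau> where \<tau>: "critical_level ?k b < \<tau>" "\<tau> < \<theta>" "\<tau> < 1"
    using dense[of "critical_level ?k b" "min \<theta> 1"] level by auto
  have \<tau>_pos: "0 < \<tau>" using \<tau>(1) critical_level_nonneg[of ?k b] H b by auto
  have gap: "exp 0 * root_mass ?k b < \<tau> * ?P"
    using \<tau>(1) P by (simp add: critical_level_def divide_less_eq)
  have "((\<lambda>D::nat. exp (2 * ?k / real D) * root_mass ?k b) \<longlongrightarrow> exp 0 * root_mass ?k b) sequentially"
    by (intro tendsto_intros)
  then have "\<forall>\<^sub>F D::nat in sequentially. exp (2 * ?k / real D) * root_mass ?k b < \<tau> * ?P \<and> 2 * card H \<le> D \<and> Max H \<le> D"
    using gap by (intro eventually_conj order_tendstoD(2) eventually_ge_at_top)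
  then obtain D :: nat where D: "exp (2 * ?k / real D) * root_mass ?k b < \<tau> * ?P" "2 * card H \<le> D" "Max H \<le> D"
    using eventually_happens'[OF sequentially_bot] by blast
  have "h \<le> D" if "h \<in> H" for h using Max_ge[OF H(1) that] D(3) by (rule order_trans)
  then obtain v where "tuple_sieve H (card H) D v" using ex_tuple_sieve[OF H(1,2,3) D(2)] by blast
  then interpret tuple_sieve H "card H" D v .
  interpret tuple_sieve_limit H "card H" D v \<theta> \<tau> b
    using A B \<tau> \<tau>_pos b
    by unfold_locales (simp_all add: condA_iff_level_of_distribution condB_iff_level_of_distribution)
  obtain c where c: "0 < c" "\<forall>\<^sub>F N in sequentially. \<exists>n\<in>window N. rough_tuple n (real N powr c) \<and> prime_odd_pair n"
    using ex_prime_odd_pair D(1) unfolding shift_loss_def by blast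
  obtain \<omega> d where "odd \<omega>" "even d" "0 < \<bar>d\<bar>" "\<bar>d\<bar> \<le> \<Delta>" "infinite (almost_prime_shifts (c / 2) \<omega> d)"
    using infinite_almost_prime_shifts_of_prime_odd_pairs[OF c H(4,5)] by blast
  then show ?thesis using that c(1) by (meson half_gt_zero)
qed

lemma beta_ratio_values:
  "beta_ratio \<kappa> (Suc 0) = 1 / (1 + \<kappa>)" "beta_ratio \<kappa> 2 = 1 / (1 + \<kappa>) * (2 / (2 + \<kappa>))"
  "beta_ratio \<kappa> 3 = 1 / (1 + \<kappa>) * (2 / (2 + \<kappa>)) * (3 / (3 + \<kappa>))"
  "beta_ratio \<kappa> 4 = 1 / (1 + \<kappa>) * (2 / (2 + \<kappa>)) * (3 / (3 + \<kappa>)) * (4 / (4 + \<kappa>))"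
  by (simp_all add: beta_ratio_def numeral_eq_Suc)

lemmas critical_level_expand = critical_level_def root_mass_def prime_mass_def beta_ratio_values

lemma ex_critical_tuple:
  fixes \<theta>0 :: real and D :: int
  assumes "(\<theta>0, D) \<in> {(0.924, 6), (0.739, 8), (0.643, 12), (0.584, 16), (0.544, 20), (0.516, 26)}"
  obtains H b where "finite H" "2 \<le> card H" "admissible H" "\<forall>h\<in>H. even h \<and> int h \<le> D"
    "0 \<le> b" "critical_level (real (card H)) b \<le> \<theta>0" "\<theta>0 < 1"
proof -
  consider (triple) "\<theta>0 = 0.924" "D = 6" | (quadruple) "\<theta>0 = 0.739" "D = 8" | (quintuple) "\<theta>0 = 0.643" "D = 12"
    | (sextuple) "\<theta>0 = 0.584" "D = 16" | (septuple) "\<theta>0 = 0.544" "D = 20" | (octuple) "\<theta>0 = 0.516" "D = 26"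
    using assms by auto
  then show ?thesis
    \<comment> \<open>In each case b is close to the value that minimises the critical level.\<close>
  proof cases
    case triple
    have "admissible (set [0, 2, 6])" by (rule admissible_set_listI) code_simp
    then show ?thesis using triple by (intro that[of "set [0, 2, 6]" 3]) (simp_all add: critical_level_expand)
  next
    case quadruple
    have "admissible (set [0, 2, 6, 8])" by (rule admissible_set_listI) code_simp
    then show ?thesis using quadruple by (intro that[of "set [0, 2, 6, 8]" 5]) (simp_all add: critical_level_expand)
  next
    case quintuple
    have "admissible (set [0, 2, 6, 8, 12])" by (rule admissible_set_listI) code_simp
    then show ?thesis using quintuple by (intro that[of "set [0, 2, 6, 8, 12]" 7]) (simp_all add: critical_level_expand)
  next
    case sextuple
    have "admissible (set [0, 4, 6, 10, 12, 16])" by (rule admissible_set_listI) code_simp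
    then show ?thesis using sextuple by (intro that[of "set [0, 4, 6, 10, 12, 16]" 10]) (simp_all add: critical_level_expand)
  next
    case septuple
    have "admissible (set [0, 2, 6, 8, 12, 18, 20])" by (rule admissible_set_listI) code_simp
    then show ?thesis using septuple by (intro that[of "set [0, 2, 6, 8, 12, 18, 20]" 15]) (simp_all add: critical_level_expand)
  next
    case octuple
    have "admissible (set [0, 2, 6, 8, 12, 18, 20, 26])" by (rule admissible_set_listI) code_simp
    then show ?thesis using octuple by (intro that[of "set [0, 2, 6, 8, 12, 18, 20, 26]" 22]) (simp_all add: critical_level_expand)
  qed
qed

theorem theorem8:
  fixes \<theta> \<theta>0 :: real and D :: int
  assumes pair: "(\<theta>0, D) \<in> {(0.924, 6), (0.739, 8), (0.643, 12), (0.584, 16), (0.544, 20), (0.516, 26)}"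
    and gt: "\<theta> > \<theta>0"
    and A: "condA \<theta>"
    and B: "condB \<theta>"
  shows "\<exists>C::real. \<exists>c::real. c > 0 \<and> (\<exists>b::int. \<exists>d::int. odd b \<and> real_of_int b \<le> C \<and> even d
           \<and> 0 < \<bar>d\<bar> \<and> \<bar>d\<bar> \<le> D
           \<and> infinite {p::nat. prime p \<and> int p + d > 1
                 \<and> real (least_prime_factor (nat (int p + d))) > real p powr c
                 \<and> int (bigOmega (nat (int p + d))) = b})"
proof -
  obtain H b where H: "finite H" "2 \<le> card H" "admissible H" "\<forall>h\<in>H. even h \<and> int h \<le> D"
    and b: "0 \<le> b" and level: "critical_level (real (card H)) b \<le> \<theta>0" "\<theta>0 < 1"
    using ex_critical_tuple[OF pair] by blast
  have "critical_level (real (card H)) b < \<theta>" "critical_level (real (card H)) b < 1"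
    using level gt by auto
  then obtain c \<omega> d where "0 < c" "odd \<omega>" "even d" "0 < \<bar>d\<bar>" "\<bar>d\<bar> \<le> D" "infinite (almost_prime_shifts c \<omega> d)"
    using infinite_almost_prime_shifts[OF A B H(1-3), of D b] H(4) b by blast
  then show ?thesis
    unfolding almost_prime_shifts_def
    by (intro exI[of _ "real_of_int \<omega>"] exI[of _ c] exI[of _ \<omega>] exI[of _ d] conjI) auto
qed

end
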